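(* Let $D$ be any Dedekind domain and let $H$ be a congruence subgroup of (finite) index $n$ in $SL_2(D)$ whose level $l(H)$ satisfies Condition L. Then $$|D/l(H)|\ \text{ divides }\ n!,$$ and if $H$ is a normal subgroup of $SL_2(D)$ then even $$|D/l(H)|\ \text{ divides }\ n.$$
   Context: Dedekind domains are integrally closed Noetherian domains of Krull dimension one (so not fields). For $r\in D$ put $T(r)=\begin{pmatrix}1&r\\0&1\end{pmatrix}$. For an ideal $\mathfrak{q}$ of $D$, $SL_2(D,\mathfrak{q})=\{X\in SL_2(D): X\equiv I_2 \pmod{\mathfrak{q}}\}$. A subgroup $H$ of $SL_2(D)$ is a congruence subgroup if $SL_2(D,\mathfrak{q}')\le H$ for some non-zero ideal $\mathfrak{q}'$ of $D$. The level $l(H)$ is the largest ideal $\mathfrak{q}$ of $D$ such that for all $r\in\mathfrak{q}$ the matrix $T(r)$ lies in every conjugate of $H$ in $SL_2(D)$. Condition L for a subgroup $H$ of non-zero level $\mathfrak{q}=l(H)$: (i) $\mathfrak{q}+(2)=D$; and (ii) there are no prime ideals $\mathfrak{p}$ of $D$ for which $|D/\mathfrak{p}|=3$ and $\mathrm{ord}_{\mathfrak{p}}(\mathfrak{q})=1$, where $\mathrm{ord}_{\mathfrak{p}}(\mathfrak{q})$ is the exponent of $\mathfrak{p}$ in the prime factorization of $\mathfrak{q}$. *)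

theory Defs
  imports
    "HOL-Algebra.Group_Action"
    "HOL-Algebra.Ideal_Product"
    "HOL-Algebra.Polynomials"
    "HOL-Algebra.QuotRing"
    "HOL-Algebra.Ring_Divisibility"
    "HOL-Library.Extended_Nat"
begin

section \<open>Dedekind domains\<close>

subsection \<open>Field of fractions\<close>

definition fraction_rel :: "('a, 'm) ring_scheme \<Rightarrow> (('a \<times> 'a) \<times> ('a \<times> 'a)) set" where
  "fraction_rel R =
     {((a, b), (c, d)). a \<in> carrier R \<and> b \<in> carrier R - {\<zero>\<^bsub>R\<^esub>} \<and>
        c \<in> carrier R \<and> d \<in> carrier R - {\<zero>\<^bsub>R\<^esub>} \<and> a \<otimes>\<^bsub>R\<^esub> d = c \<otimes>\<^bsub>R\<^esub> b}"

definition fraction :: "('a, 'm) ring_scheme \<Rightarrow> 'a \<Rightarrow> 'a \<Rightarrow> ('a \<times> 'a) set" where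
  "fraction R a b = fraction_rel R `` {(a, b)}"

text \<open>The operations are defined on equivalence classes by taking the union over all
  representatives; the lemmas below show that this is well defined over a domain.\<close>

definition fraction_field :: "('a, 'm) ring_scheme \<Rightarrow> ('a \<times> 'a) set ring" where
  "fraction_field R =
     \<lparr> carrier = {fraction R a b | a b. a \<in> carrier R \<and> b \<in> carrier R - {\<zero>\<^bsub>R\<^esub>}},
       monoid.mult = (\<lambda>x y. \<Union>(a, b)\<in>x. \<Union>(c, d)\<in>y. fraction R (a \<otimes>\<^bsub>R\<^esub> c) (b \<otimes>\<^bsub>R\<^esub> d)),
       one = fraction R \<one>\<^bsub>R\<^esub> \<one>\<^bsub>R\<^esub>,
       zero = fraction R \<zero>\<^bsub>R\<^esub> \<one>\<^bsub>R\<^esub>,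
       add = (\<lambda>x y. \<Union>(a, b)\<in>x. \<Union>(c, d)\<in>y.
                 fraction R (a \<otimes>\<^bsub>R\<^esub> d \<oplus>\<^bsub>R\<^esub> c \<otimes>\<^bsub>R\<^esub> b) (b \<otimes>\<^bsub>R\<^esub> d)) \<rparr>"

definition to_fraction_field :: "('a, 'm) ring_scheme \<Rightarrow> 'a \<Rightarrow> ('a \<times> 'a) set" where
  "to_fraction_field R a = fraction R a \<one>\<^bsub>R\<^esub>"

context domain
begin

lemma fraction_rel_equiv: "equiv (carrier R \<times> (carrier R - {\<zero>})) (fraction_rel R)"
proof (rule equivI)
  show "fraction_rel R \<subseteq> (carrier R \<times> (carrier R - {\<zero>})) \<times> (carrier R \<times> (carrier R - {\<zero>}))"
    by (auto simp: fraction_rel_def)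
  show "refl_on (carrier R \<times> (carrier R - {\<zero>})) (fraction_rel R)"
    by (auto simp: refl_on_def fraction_rel_def)
  show "sym (fraction_rel R)"
    by (auto simp: sym_def fraction_rel_def)
  show "trans (fraction_rel R)"
  proof (rule transI, clarify)
    fix a b c d e f
    assume "((a, b), (c, d)) \<in> fraction_rel R" "((c, d), (e, f)) \<in> fraction_rel R"
    then have car: "a \<in> carrier R" "b \<in> carrier R" "c \<in> carrier R" "d \<in> carrier R"
        "e \<in> carrier R" "f \<in> carrier R"
      and nz: "b \<noteq> \<zero>" "d \<noteq> \<zero>" "f \<noteq> \<zero>"
      and eq: "a \<otimes> d = c \<otimes> b" "c \<otimes> f = e \<otimes> d"
      by (auto simp: fraction_rel_def)
    have "d \<otimes> (a \<otimes> f) = (a \<otimes> d) \<otimes> f" using car by (simp add: m_ac)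
    also have "\<dots> = (c \<otimes> b) \<otimes> f" by (simp only: eq(1))
    also have "\<dots> = (c \<otimes> f) \<otimes> b" using car by (simp add: m_ac)
    also have "\<dots> = (e \<otimes> d) \<otimes> b" by (simp only: eq(2))
    also have "\<dots> = d \<otimes> (e \<otimes> b)" using car by (simp add: m_ac)
    finally have "a \<otimes> f = e \<otimes> b" using m_lcancel[of d "a \<otimes> f" "e \<otimes> b"] car nz by simp
    then show "((a, b), (e, f)) \<in> fraction_rel R"
      using car nz by (auto simp: fraction_rel_def)
  qed
qed

lemma fraction_eq_iff:
  assumes "a \<in> carrier R" "b \<in> carrier R" "b \<noteq> \<zero>" "c \<in> carrier R" "d \<in> carrier R" "d \<noteq> \<zero>"
  shows "fraction R a b = fraction R c d \<longleftrightarrow> a \<otimes> d = c \<otimes> b"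
proof -
  have "fraction R a b = fraction R c d \<longleftrightarrow> ((a, b), (c, d)) \<in> fraction_rel R"
    unfolding fraction_def
    by (rule eq_equiv_class_iff[OF fraction_rel_equiv]) (use assms in auto)
  then show ?thesis using assms by (auto simp: fraction_rel_def)
qed

lemma fraction_mem_iff:
  assumes "a \<in> carrier R" "b \<in> carrier R" "b \<noteq> \<zero>"
  shows "(c, d) \<in> fraction R a b \<longleftrightarrow>
    c \<in> carrier R \<and> d \<in> carrier R \<and> d \<noteq> \<zero> \<and> fraction R c d = fraction R a b"
proof -
  have "(c, d) \<in> fraction R a b \<longleftrightarrow>
      c \<in> carrier R \<and> d \<in> carrier R \<and> d \<noteq> \<zero> \<and> a \<otimes> d = c \<otimes> b"
    using assms by (auto simp: fraction_def fraction_rel_def)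
  then show ?thesis
    using assms fraction_eq_iff[of c d a b] by auto
qed

lemma fraction_self:
  assumes "a \<in> carrier R" "b \<in> carrier R" "b \<noteq> \<zero>"
  shows "(a, b) \<in> fraction R a b"
  using assms by (simp add: fraction_mem_iff)

lemma fraction_field_mult:
  assumes "a \<in> carrier R" "b \<in> carrier R" "b \<noteq> \<zero>" "c \<in> carrier R" "d \<in> carrier R" "d \<noteq> \<zero>"
  shows "fraction R a b \<otimes>\<^bsub>fraction_field R\<^esub> fraction R c d = fraction R (a \<otimes> c) (b \<otimes> d)"
proof -
  have *: "fraction R (a' \<otimes> c') (b' \<otimes> d') = fraction R (a \<otimes> c) (b \<otimes> d)"
    if "(a', b') \<in> fraction R a b" "(c', d') \<in> fraction R c d" for a' b' c' d'
  proof -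
    have car: "a' \<in> carrier R" "b' \<in> carrier R" "b' \<noteq> \<zero>" "c' \<in> carrier R" "d' \<in> carrier R" "d' \<noteq> \<zero>"
      and eq: "a' \<otimes> b = a \<otimes> b'" "c' \<otimes> d = c \<otimes> d'"
      using that assms by (auto simp: fraction_mem_iff fraction_eq_iff)
    have "(a' \<otimes> c') \<otimes> (b \<otimes> d) = (a' \<otimes> b) \<otimes> (c' \<otimes> d)" using car assms by (simp add: m_ac)
    also have "\<dots> = (a \<otimes> c) \<otimes> (b' \<otimes> d')" unfolding eq using car assms by (simp add: m_ac)
    finally show ?thesis using car assms by (subst fraction_eq_iff) (auto simp: integral_iff)
  qed
  have "fraction R a b \<otimes>\<^bsub>fraction_field R\<^esub> fraction R c d =
     (\<Union>(a', b')\<in>fraction R a b. \<Union>(c', d')\<in>fraction R c d. fraction R (a' \<otimes> c') (b' \<otimes> d'))"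
    by (simp add: fraction_field_def)
  also have "\<dots> = (\<Union>(a', b')\<in>fraction R a b. \<Union>(c', d')\<in>fraction R c d. fraction R (a \<otimes> c) (b \<otimes> d))"
    using * by (intro SUP_cong refl) (auto intro!: SUP_cong split: prod.splits)
  also have "\<dots> = fraction R (a \<otimes> c) (b \<otimes> d)"
    using fraction_self[of a b] fraction_self[of c d] assms by auto
  finally show ?thesis .
qed

lemma fraction_field_add:
  assumes "a \<in> carrier R" "b \<in> carrier R" "b \<noteq> \<zero>" "c \<in> carrier R" "d \<in> carrier R" "d \<noteq> \<zero>"
  shows "fraction R a b \<oplus>\<^bsub>fraction_field R\<^esub> fraction R c d = fraction R (a \<otimes> d \<oplus> c \<otimes> b) (b \<otimes> d)"
proof -
  have *: "fraction R (a' \<otimes> d' \<oplus> c' \<otimes> b') (b' \<otimes> d') = fraction R (a \<otimes> d \<oplus> c \<otimes> b) (b \<otimes> d)"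
    if "(a', b') \<in> fraction R a b" "(c', d') \<in> fraction R c d" for a' b' c' d'
  proof -
    have car: "a' \<in> carrier R" "b' \<in> carrier R" "b' \<noteq> \<zero>" "c' \<in> carrier R" "d' \<in> carrier R" "d' \<noteq> \<zero>"
      and eq: "a' \<otimes> b = a \<otimes> b'" "c' \<otimes> d = c \<otimes> d'"
      using that assms by (auto simp: fraction_mem_iff fraction_eq_iff)
    have "(a' \<otimes> d' \<oplus> c' \<otimes> b') \<otimes> (b \<otimes> d) = (a' \<otimes> b) \<otimes> (d' \<otimes> d) \<oplus> (c' \<otimes> d) \<otimes> (b' \<otimes> b)"
      using car assms by (simp add: m_ac l_distr r_distr)
    also have "\<dots> = (a \<otimes> d \<oplus> c \<otimes> b) \<otimes> (b' \<otimes> d')" 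
      unfolding eq using car assms by (simp add: m_ac l_distr r_distr)
    finally show ?thesis using car assms by (subst fraction_eq_iff) (auto simp: integral_iff)
  qed
  have "fraction R a b \<oplus>\<^bsub>fraction_field R\<^esub> fraction R c d =
     (\<Union>(a', b')\<in>fraction R a b. \<Union>(c', d')\<in>fraction R c d.
        fraction R (a' \<otimes> d' \<oplus> c' \<otimes> b') (b' \<otimes> d'))"
    by (simp add: fraction_field_def)
  also have "\<dots> = (\<Union>(a', b')\<in>fraction R a b. \<Union>(c', d')\<in>fraction R c d.
        fraction R (a \<otimes> d \<oplus> c \<otimes> b) (b \<otimes> d))"
    using * by (intro SUP_cong refl) (auto intro!: SUP_cong split: prod.splits)
  also have "\<dots> = fraction R (a \<otimes> d \<oplus> c \<otimes> b) (b \<otimes> d)"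
    using fraction_self[of a b] fraction_self[of c d] assms by auto
  finally show ?thesis .
qed

lemma fraction_field_carrierE:
  assumes "x \<in> carrier (fraction_field R)"
  obtains a b where "a \<in> carrier R" "b \<in> carrier R" "b \<noteq> \<zero>" "x = fraction R a b"
  using assms by (auto simp: fraction_field_def)

lemma fraction_in_carrier:
  assumes "a \<in> carrier R" "b \<in> carrier R" "b \<noteq> \<zero>"
  shows "fraction R a b \<in> carrier (fraction_field R)"
  using assms by (auto simp: fraction_field_def)

lemma fraction_field_one: "\<one>\<^bsub>fraction_field R\<^esub> = fraction R \<one> \<one>"
  and fraction_field_zero: "\<zero>\<^bsub>fraction_field R\<^esub> = fraction R \<zero> \<one>"
  by (simp_all add: fraction_field_def)

lemmas fraction_field_ops = fraction_field_mult fraction_field_add fraction_in_carrier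
  fraction_field_one fraction_field_zero fraction_eq_iff integral_iff

lemma fraction_field_is_field: "field (fraction_field R)"
proof -
  let ?F = "fraction_field R"
  have "abelian_group ?F"
  proof (rule abelian_groupI)
    fix x y assume "x \<in> carrier ?F" "y \<in> carrier ?F"
    then show "x \<oplus>\<^bsub>?F\<^esub> y \<in> carrier ?F" "x \<oplus>\<^bsub>?F\<^esub> y = y \<oplus>\<^bsub>?F\<^esub> x"
      by (elim fraction_field_carrierE; simp add: fraction_field_ops m_ac a_ac)+
  next
    fix x y z assume "x \<in> carrier ?F" "y \<in> carrier ?F" "z \<in> carrier ?F"
    then show "x \<oplus>\<^bsub>?F\<^esub> y \<oplus>\<^bsub>?F\<^esub> z = x \<oplus>\<^bsub>?F\<^esub> (y \<oplus>\<^bsub>?F\<^esub> z)"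
      by (elim fraction_field_carrierE; simp add: fraction_field_ops m_ac a_ac l_distr r_distr)
  next
    show "\<zero>\<^bsub>?F\<^esub> \<in> carrier ?F" by (simp add: fraction_field_ops)
  next
    fix x assume "x \<in> carrier ?F"
    then obtain a b where x: "a \<in> carrier R" "b \<in> carrier R" "b \<noteq> \<zero>" "x = fraction R a b"
      by (elim fraction_field_carrierE)
    then show "\<zero>\<^bsub>?F\<^esub> \<oplus>\<^bsub>?F\<^esub> x = x" by (simp add: fraction_field_ops)
    have "fraction R (\<ominus> a) b \<oplus>\<^bsub>?F\<^esub> x = \<zero>\<^bsub>?F\<^esub>"
      using x by (simp add: fraction_field_ops l_minus l_neg)
    then show "\<exists>y\<in>carrier ?F. y \<oplus>\<^bsub>?F\<^esub> x = \<zero>\<^bsub>?F\<^esub>"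
      using x by (intro bexI[of _ "fraction R (\<ominus> a) b"]) (auto simp: fraction_field_ops)
  qed
  moreover have "comm_monoid ?F"
  proof (rule comm_monoidI)
    fix x y assume "x \<in> carrier ?F" "y \<in> carrier ?F"
    then show "x \<otimes>\<^bsub>?F\<^esub> y \<in> carrier ?F" "x \<otimes>\<^bsub>?F\<^esub> y = y \<otimes>\<^bsub>?F\<^esub> x"
      by (elim fraction_field_carrierE; simp add: fraction_field_ops m_ac)+
  next
    fix x y z assume "x \<in> carrier ?F" "y \<in> carrier ?F" "z \<in> carrier ?F"
    then show "x \<otimes>\<^bsub>?F\<^esub> y \<otimes>\<^bsub>?F\<^esub> z = x \<otimes>\<^bsub>?F\<^esub> (y \<otimes>\<^bsub>?F\<^esub> z)"
      by (elim fraction_field_carrierE; simp add: fraction_field_ops m_ac)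
  next
    show "\<one>\<^bsub>?F\<^esub> \<in> carrier ?F" by (simp add: fraction_field_ops)
  next
    fix x assume "x \<in> carrier ?F"
    then show "\<one>\<^bsub>?F\<^esub> \<otimes>\<^bsub>?F\<^esub> x = x"
      by (elim fraction_field_carrierE; simp add: fraction_field_ops)
  qed
  ultimately have F: "cring ?F"
  proof (rule cringI)
    fix x y z assume "x \<in> carrier ?F" "y \<in> carrier ?F" "z \<in> carrier ?F"
    then show "(x \<oplus>\<^bsub>?F\<^esub> y) \<otimes>\<^bsub>?F\<^esub> z = x \<otimes>\<^bsub>?F\<^esub> z \<oplus>\<^bsub>?F\<^esub> y \<otimes>\<^bsub>?F\<^esub> z"
      by (elim fraction_field_carrierE; simp add: fraction_field_ops m_ac l_distr r_distr)
  qed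
  interpret F: cring ?F by (rule F)
  show ?thesis
  proof (rule F.cring_fieldI2)
    show "\<zero>\<^bsub>?F\<^esub> \<noteq> \<one>\<^bsub>?F\<^esub>" by (simp add: fraction_field_ops)
    fix x assume "x \<in> carrier ?F" "x \<noteq> \<zero>\<^bsub>?F\<^esub>"
    then obtain a b where x: "a \<in> carrier R" "b \<in> carrier R" "b \<noteq> \<zero>" "x = fraction R a b"
      by (elim fraction_field_carrierE)
    then have "a \<noteq> \<zero>" using \<open>x \<noteq> \<zero>\<^bsub>?F\<^esub>\<close> by (auto simp: fraction_field_ops)
    then show "\<exists>y\<in>carrier ?F. x \<otimes>\<^bsub>?F\<^esub> y = \<one>\<^bsub>?F\<^esub>"
      using x by (intro bexI[of _ "fraction R b a"]) (auto simp: fraction_field_ops m_comm)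
  qed
qed

lemma to_fraction_field_hom: "to_fraction_field R \<in> ring_hom R (fraction_field R)"
  by (rule ring_hom_memI) (simp_all add: to_fraction_field_def fraction_field_ops)

lemma to_fraction_field_inj: "inj_on (to_fraction_field R) (carrier R)"
  by (auto simp: inj_on_def to_fraction_field_def fraction_field_ops)

lemma fraction_eq_div:
  assumes "a \<in> carrier R" "b \<in> carrier R" "b \<noteq> \<zero>"
  shows "fraction R a b \<otimes>\<^bsub>fraction_field R\<^esub> to_fraction_field R b = to_fraction_field R a"
  using assms by (simp add: to_fraction_field_def fraction_field_ops m_comm)

end


subsection \<open>Integral closure and dimension\<close>

definition integral_over :: "('a, 'm) ring_scheme \<Rightarrow> 'a set \<Rightarrow> 'a \<Rightarrow> bool" where
  "integral_over K A x \<longleftrightarrow>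
     (\<exists>p \<in> carrier (A[X]\<^bsub>K\<^esub>). p \<noteq> [] \<and> lead_coeff p = \<one>\<^bsub>K\<^esub> \<and> ring.eval K p x = \<zero>\<^bsub>K\<^esub>)"

definition integrally_closed :: "('a, 'm) ring_scheme \<Rightarrow> bool" where
  "integrally_closed R \<longleftrightarrow>
     (\<forall>x \<in> carrier (fraction_field R).
        integral_over (fraction_field R) (to_fraction_field R ` carrier R) x \<longrightarrow>
        x \<in> to_fraction_field R ` carrier R)"

definition krull_dim :: "('a, 'm) ring_scheme \<Rightarrow> enat" where
  "krull_dim R =
     Sup {enat n | n. \<exists>P :: nat \<Rightarrow> 'a set.
            (\<forall>i\<le>n. primeideal (P i) R) \<and> (\<forall>i<n. P i \<subset> P (Suc i))}"

locale dedekind_domain = noetherian_domain R for R (structure) +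
  assumes integrally_closed: "integrally_closed R"
    and krull_dim_one: "krull_dim R = 1"


subsection \<open>Order of an ideal at a prime\<close>

definition is_prime_factorization :: "('a, 'm) ring_scheme \<Rightarrow> 'a set \<Rightarrow> ('a set \<Rightarrow> nat) \<Rightarrow> bool" where
  "is_prime_factorization R q e \<longleftrightarrow>
     finite {p. e p \<noteq> 0} \<and> (\<forall>p. e p \<noteq> 0 \<longrightarrow> primeideal p R) \<and>
     q = finprod (ideals_set R) (\<lambda>p. p [^]\<^bsub>ideals_set R\<^esub> e p) {p. e p \<noteq> 0}"

text \<open>Meaningful for a non-zero ideal of a Dedekind domain, where the prime factorization
  exists and is unique.\<close>

definition ideal_ord :: "('a, 'm) ring_scheme \<Rightarrow> 'a set \<Rightarrow> 'a set \<Rightarrow> nat" where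
  "ideal_ord R p q = (THE e. is_prime_factorization R q e) p"


section \<open>The group $SL_2$\<close>

datatype 'a mat2 = Mat2 (e11: 'a) (e12: 'a) (e21: 'a) (e22: 'a)

definition mat2_mult :: "('a, 'm) ring_scheme \<Rightarrow> 'a mat2 \<Rightarrow> 'a mat2 \<Rightarrow> 'a mat2" where
  "mat2_mult R M N = Mat2
     (e11 M \<otimes>\<^bsub>R\<^esub> e11 N \<oplus>\<^bsub>R\<^esub> e12 M \<otimes>\<^bsub>R\<^esub> e21 N) (e11 M \<otimes>\<^bsub>R\<^esub> e12 N \<oplus>\<^bsub>R\<^esub> e12 M \<otimes>\<^bsub>R\<^esub> e22 N)
     (e21 M \<otimes>\<^bsub>R\<^esub> e11 N \<oplus>\<^bsub>R\<^esub> e22 M \<otimes>\<^bsub>R\<^esub> e21 N) (e21 M \<otimes>\<^bsub>R\<^esub> e12 N \<oplus>\<^bsub>R\<^esub> e22 M \<otimes>\<^bsub>R\<^esub> e22 N)"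

definition mat2_det :: "('a, 'm) ring_scheme \<Rightarrow> 'a mat2 \<Rightarrow> 'a" where
  "mat2_det R M = e11 M \<otimes>\<^bsub>R\<^esub> e22 M \<ominus>\<^bsub>R\<^esub> e12 M \<otimes>\<^bsub>R\<^esub> e21 M"

definition SL2 :: "('a, 'm) ring_scheme \<Rightarrow> 'a mat2 monoid" where
  "SL2 R =
     \<lparr> carrier = {M. set_mat2 M \<subseteq> carrier R \<and> mat2_det R M = \<one>\<^bsub>R\<^esub>},
       monoid.mult = mat2_mult R,
       one = Mat2 \<one>\<^bsub>R\<^esub> \<zero>\<^bsub>R\<^esub> \<zero>\<^bsub>R\<^esub> \<one>\<^bsub>R\<^esub> \<rparr>"

definition transvection :: "('a, 'm) ring_scheme \<Rightarrow> 'a \<Rightarrow> 'a mat2" where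
  "transvection R r = Mat2 \<one>\<^bsub>R\<^esub> r \<zero>\<^bsub>R\<^esub> \<one>\<^bsub>R\<^esub>"

definition principal_congruence_subgroup :: "('a, 'm) ring_scheme \<Rightarrow> 'a set \<Rightarrow> 'a mat2 set" where
  "principal_congruence_subgroup R q =
     {M \<in> carrier (SL2 R). e11 M \<ominus>\<^bsub>R\<^esub> \<one>\<^bsub>R\<^esub> \<in> q \<and> e12 M \<in> q \<and> e21 M \<in> q \<and> e22 M \<ominus>\<^bsub>R\<^esub> \<one>\<^bsub>R\<^esub> \<in> q}"

definition congruence_subgroup :: "('a, 'm) ring_scheme \<Rightarrow> 'a mat2 set \<Rightarrow> bool" where
  "congruence_subgroup R H \<longleftrightarrow>
     subgroup H (SL2 R) \<and>
     (\<exists>q. ideal q R \<and> q \<noteq> {\<zero>\<^bsub>R\<^esub>} \<and> principal_congruence_subgroup R q \<subseteq> H)"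

text \<open>Greatest with respect to inclusion; it always exists, see \<open>level_greatest\<close> below.\<close>

definition level :: "('a, 'm) ring_scheme \<Rightarrow> 'a mat2 set \<Rightarrow> 'a set" where
  "level R H =
     (GREATEST q. ideal q R \<and>
        (\<forall>r\<in>q. \<forall>g\<in>carrier (SL2 R).
           transvection R r \<in> g <#\<^bsub>SL2 R\<^esub> H #>\<^bsub>SL2 R\<^esub> inv\<^bsub>SL2 R\<^esub> g))"

definition condition_L :: "('a, 'm) ring_scheme \<Rightarrow> 'a set \<Rightarrow> bool" where
  "condition_L R q \<longleftrightarrow>
     q \<noteq> {\<zero>\<^bsub>R\<^esub>} \<and>
     q <+>\<^bsub>R\<^esub> PIdl\<^bsub>R\<^esub> (\<one>\<^bsub>R\<^esub> \<oplus>\<^bsub>R\<^esub> \<one>\<^bsub>R\<^esub>) = carrier R \<and>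
     \<not> (\<exists>p. primeideal p R \<and> card (carrier (R Quot p)) = 3 \<and> ideal_ord R p q = 1)"

context cring
begin

lemma SL2_carrier_iff:
  "Mat2 a b c d \<in> carrier (SL2 R) \<longleftrightarrow>
     a \<in> carrier R \<and> b \<in> carrier R \<and> c \<in> carrier R \<and> d \<in> carrier R \<and> a \<otimes> d \<ominus> b \<otimes> c = \<one>"
  by (auto simp: SL2_def mat2_det_def)

lemma SL2_mult:
  "Mat2 a b c d \<otimes>\<^bsub>SL2 R\<^esub> Mat2 a' b' c' d' =
     Mat2 (a \<otimes> a' \<oplus> b \<otimes> c') (a \<otimes> b' \<oplus> b \<otimes> d') (c \<otimes> a' \<oplus> d \<otimes> c') (c \<otimes> b' \<oplus> d \<otimes> d')"
  by (simp add: SL2_def mat2_mult_def)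

lemma SL2_one: "\<one>\<^bsub>SL2 R\<^esub> = Mat2 \<one> \<zero> \<zero> \<one>"
  by (simp add: SL2_def)

lemma SL2_group: "group (SL2 R)"
proof (rule groupI)
  fix M N assume "M \<in> carrier (SL2 R)" "N \<in> carrier (SL2 R)"
  then obtain a b c d a' b' c' d' where M: "M = Mat2 a b c d" and N: "N = Mat2 a' b' c' d'"
    and car: "a \<in> carrier R" "b \<in> carrier R" "c \<in> carrier R" "d \<in> carrier R"
       "a' \<in> carrier R" "b' \<in> carrier R" "c' \<in> carrier R" "d' \<in> carrier R"
    and det: "a \<otimes> d \<ominus> b \<otimes> c = \<one>" "a' \<otimes> d' \<ominus> b' \<otimes> c' = \<one>"
    by (cases M; cases N) (auto simp: SL2_carrier_iff)
  have "(a \<otimes> a' \<oplus> b \<otimes> c') \<otimes> (c \<otimes> b' \<oplus> d \<otimes> d') \<ominus> (a \<otimes> b' \<oplus> b \<otimes> d') \<otimes> (c \<otimes> a' \<oplus> d \<otimes> c') =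
      (a \<otimes> d \<ominus> b \<otimes> c) \<otimes> (a' \<otimes> d' \<ominus> b' \<otimes> c')"
    using car by algebra
  then show "M \<otimes>\<^bsub>SL2 R\<^esub> N \<in> carrier (SL2 R)"
    using car det by (simp add: M N SL2_mult SL2_carrier_iff)
next
  fix M N K assume "M \<in> carrier (SL2 R)" "N \<in> carrier (SL2 R)" "K \<in> carrier (SL2 R)"
  then show "M \<otimes>\<^bsub>SL2 R\<^esub> N \<otimes>\<^bsub>SL2 R\<^esub> K = M \<otimes>\<^bsub>SL2 R\<^esub> (N \<otimes>\<^bsub>SL2 R\<^esub> K)"
    by (cases M; cases N; cases K) (simp add: SL2_mult SL2_carrier_iff l_distr r_distr m_ac a_ac)
next
  show "\<one>\<^bsub>SL2 R\<^esub> \<in> carrier (SL2 R)"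
    by (simp add: SL2_one SL2_carrier_iff a_minus_def)
next
  fix M assume M: "M \<in> carrier (SL2 R)"
  then show "\<one>\<^bsub>SL2 R\<^esub> \<otimes>\<^bsub>SL2 R\<^esub> M = M"
    by (cases M) (simp add: SL2_one SL2_mult SL2_carrier_iff)
  obtain a b c d where M': "M = Mat2 a b c d" by (cases M)
  then have car: "a \<in> carrier R" "b \<in> carrier R" "c \<in> carrier R" "d \<in> carrier R"
    and det: "a \<otimes> d \<ominus> b \<otimes> c = \<one>" using M by (auto simp: SL2_carrier_iff)
  have "d \<otimes> a \<ominus> (\<ominus> b) \<otimes> (\<ominus> c) = a \<otimes> d \<ominus> b \<otimes> c" "d \<otimes> a \<oplus> (\<ominus> b) \<otimes> c = a \<otimes> d \<ominus> b \<otimes> c"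
    "d \<otimes> b \<oplus> (\<ominus> b) \<otimes> d = \<zero>" "(\<ominus> c) \<otimes> a \<oplus> a \<otimes> c = \<zero>" "(\<ominus> c) \<otimes> b \<oplus> a \<otimes> d = a \<otimes> d \<ominus> b \<otimes> c"
    using car by algebra+
  then have "Mat2 d (\<ominus> b) (\<ominus> c) a \<in> carrier (SL2 R)" 
    "Mat2 d (\<ominus> b) (\<ominus> c) a \<otimes>\<^bsub>SL2 R\<^esub> M = \<one>\<^bsub>SL2 R\<^esub>"
    using car det by (simp_all add: M' SL2_carrier_iff SL2_mult SL2_one)
  then show "\<exists>N\<in>carrier (SL2 R). N \<otimes>\<^bsub>SL2 R\<^esub> M = \<one>\<^bsub>SL2 R\<^esub>" by blast
qed

lemma transvection_in_SL2: "r \<in> carrier R \<Longrightarrow> transvection R r \<in> carrier (SL2 R)"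
  by (simp add: transvection_def SL2_carrier_iff a_minus_def)

lemma transvection_mult:
  "r \<in> carrier R \<Longrightarrow> s \<in> carrier R \<Longrightarrow>
     transvection R r \<otimes>\<^bsub>SL2 R\<^esub> transvection R s = transvection R (r \<oplus> s)"
  by (simp add: transvection_def SL2_mult a_comm)

lemma transvection_inv:
  assumes "r \<in> carrier R"
  shows "inv\<^bsub>SL2 R\<^esub> transvection R r = transvection R (\<ominus> r)"
proof -
  interpret S: group "SL2 R" by (rule SL2_group)
  have "transvection R (\<ominus> r) \<otimes>\<^bsub>SL2 R\<^esub> transvection R r = \<one>\<^bsub>SL2 R\<^esub>"
    using assms by (simp add: transvection_mult l_neg) (simp add: transvection_def SL2_one)
  then show ?thesis using assms by (intro S.inv_equality) (auto simp: transvection_in_SL2)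
qed

lemma level_greatest:
  assumes H: "subgroup H (SL2 R)"
  defines "P \<equiv> \<lambda>q. ideal q R \<and>
        (\<forall>r\<in>q. \<forall>g\<in>carrier (SL2 R).
           transvection R r \<in> g <#\<^bsub>SL2 R\<^esub> H #>\<^bsub>SL2 R\<^esub> inv\<^bsub>SL2 R\<^esub> g)"
  shows "P (level R H)" and "P q \<Longrightarrow> q \<subseteq> level R H"
proof -
  interpret S: group "SL2 R" by (rule SL2_group)
  define C where "C = (\<lambda>g. g <#\<^bsub>SL2 R\<^esub> H #>\<^bsub>SL2 R\<^esub> inv\<^bsub>SL2 R\<^esub> g)"
  define S where "S = {r \<in> carrier R. \<forall>g\<in>carrier (SL2 R). transvection R r \<in> C g}"
  define J where "J = {r \<in> carrier R. \<forall>x\<in>carrier R. x \<otimes> r \<in> S}"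
  have C: "subgroup (C g) (SL2 R)" if "g \<in> carrier (SL2 R)" for g
    unfolding C_def using S.subgroup_conjugation_is_surj2[OF that H] .
  have S0: "\<zero> \<in> S"
    using subgroup.one_closed[OF C] by (auto simp: S_def transvection_def SL2_one)
  have Sadd: "r \<oplus> s \<in> S" if "r \<in> S" "s \<in> S" for r s
    using that subgroup.m_closed[OF C] transvection_mult[of r s] by (auto simp: S_def) metis
  have Sneg: "\<ominus> r \<in> S" if "r \<in> S" for r
    using that subgroup.m_inv_closed[OF C] transvection_inv[of r] by (auto simp: S_def) metis
  have J: "ideal J R"
  proof (rule idealI)
    show "ring R" by (rule ring_axioms)
    show "subgroup J (add_monoid R)"
    proof (rule group.subgroupI)
      show "group (add_monoid R)" by (rule add.group_axioms)
      show "J \<subseteq> carrier (add_monoid R)" by (auto simp: J_def)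
      show "J \<noteq> {}" using S0 by (auto simp: J_def intro!: exI[of _ \<zero>])
      fix a assume a: "a \<in> J"
      show "inv\<^bsub>add_monoid R\<^esub> a \<in> J"
        using a Sneg unfolding a_inv_def[symmetric] by (auto simp: J_def r_minus)
      fix b assume "b \<in> J"
      then show "a \<otimes>\<^bsub>add_monoid R\<^esub> b \<in> J"
        using a Sadd by (auto simp: J_def r_distr)
    qed
  next
    fix a x assume "a \<in> J" "x \<in> carrier R"
    then show "x \<otimes> a \<in> J" by (auto simp: J_def m_assoc[symmetric])
    then show "a \<otimes> x \<in> J" using \<open>a \<in> J\<close> \<open>x \<in> carrier R\<close> by (simp add: J_def m_comm)
  qed
  have "r \<in> S" if "r \<in> J" for r
    using that unfolding J_def by (auto dest: bspec[where x = \<one>])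
  then have PJ: "P J" using J by (auto simp: P_def S_def C_def)
  have Jmax: "q \<subseteq> J" if "P q" for q
  proof
    fix r assume r: "r \<in> q"
    interpret q: ideal q R using that by (simp add: P_def)
    have "q \<subseteq> S" using that q.a_subset by (auto simp: P_def S_def C_def)
    then show "r \<in> J" using r q.I_l_closed q.a_subset by (auto simp: J_def)
  qed
  have "level R H = J"
    unfolding level_def P_def[symmetric] by (rule Greatest_equality) (use PJ Jmax in auto)
  then show "P (level R H)" "P q \<Longrightarrow> q \<subseteq> level R H" using PJ Jmax by auto
qed

end

end

theory Submission
  imports Defs "HOL-Combinatorics.Permutations"
begin

text \<open>Let \<open>N\<close> be the core of \<open>H\<close>, let \<open>S\<close> be the additive group of all \<open>r\<close> with \<open>T(r) \<in> N\<close>, and let \<open>q\<close> be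
  the level, which is the largest ideal contained in \<open>S\<close>. If \<open>S = q\<close>, then \<open>D/q\<close> acts faithfully on
  the \<open>n\<close> cosets of \<open>H\<close>, so \<open>|D/q|\<close> divides \<open>n!\<close>; if \<open>H\<close> is normal, \<open>D/q\<close> even embeds in the
  quotient by \<open>H\<close>.

  To see \<open>S = q\<close>, one shows first that \<open>N\<close> contains the principal congruence subgroup of \<open>q\<close>, since
  the quotient by a nonzero ideal has stable range one. Conjugation then makes \<open>S\<close> stable under the
  squares of units modulo \<open>q\<close>. As 2 is a unit modulo \<open>q\<close>, these squares generate additively every
  element that vanishes at all primes over \<open>q\<close> with three-element residue field. By maximality of
  \<open>q\<close>, an \<open>x \<in> S\<close> outside \<open>q\<close> therefore has a multiple \<open>z = y x\<close> outside \<open>q\<close> with \<open>p z \<subseteq> q\<close> for a single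
  such prime \<open>p\<close>. Since \<open>p\<close> does not divide \<open>q\<close> exactly once, \<open>z\<close> and then \<open>x\<close> lie in \<open>p\<close>, and
  commutators of \<open>T(x)\<close> with lower transvections show \<open>2 z y \<in> S\<close>. The additive group spanned by
  \<open>2 z y\<close> and \<open>q\<close> is an ideal because \<open>|D/p| = 3\<close>, a contradiction.\<close>


section \<open>Ideals of a Dedekind domain\<close>

subsection \<open>Noetherian rings\<close>

text \<open>Closure under negation comes from multiplying by \<open>\<ominus> \<one>\<close>,
  absorption on the other side from commutativity.\<close>

lemma (in cring) cring_idealI:
  assumes "I \<subseteq> carrier R" "\<zero> \<in> I"
    and add: "\<And>x y. x \<in> I \<Longrightarrow> y \<in> I \<Longrightarrow> x \<oplus> y \<in> I"
    and mult: "\<And>r x. r \<in> carrier R \<Longrightarrow> x \<in> I \<Longrightarrow> r \<otimes> x \<in> I"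
  shows "ideal I R"
proof (rule idealI)
  show "ring R" by (rule ring_axioms)
  show "subgroup I (add_monoid R)"
  proof (rule group.subgroupI)
    show "group (add_monoid R)" by (rule add.group_axioms)
    show "I \<subseteq> carrier (add_monoid R)" "I \<noteq> {}" using assms(1,2) by auto
    fix a assume a: "a \<in> I"
    have "\<ominus> a = \<ominus> \<one> \<otimes> a" using a assms(1) by (auto simp: l_minus)
    also have "\<dots> \<in> I" using mult a by simp
    finally show "inv\<^bsub>add_monoid R\<^esub> a \<in> I" unfolding a_inv_def .
    fix b assume "b \<in> I"
    then show "a \<otimes>\<^bsub>add_monoid R\<^esub> b \<in> I" using a add by simp
  qed
  fix a x assume *: "a \<in> I" "x \<in> carrier R"
  then show "x \<otimes> a \<in> I" by (simp add: mult)
  then show "a \<otimes> x \<in> I" using * assms(1) m_comm[of x a] by auto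
qed

lemma (in ideal) minus_mem: "a \<in> I \<Longrightarrow> b \<in> I \<Longrightarrow> a \<ominus> b \<in> I"
  unfolding a_minus_def by (simp add: a_closed a_inv_closed)

lemma (in ideal) mem_of_sum:
  assumes "a \<oplus> b \<in> I" "b \<in> I" "a \<in> carrier R"
  shows "a \<in> I"
proof -
  have "a = (a \<oplus> b) \<ominus> b"
    using assms Icarr by (simp add: a_minus_def add.m_assoc r_neg)
  then show ?thesis using minus_mem[OF assms(1,2)] by simp
qed

text \<open>The ideal quotient (I : J). \<open>J\<close> may be any set, so that the annihilator of
  one element modulo \<open>I\<close> is the case of a singleton.\<close>

definition ideal_colon :: "('a, 'm) ring_scheme \<Rightarrow> 'a set \<Rightarrow> 'a set \<Rightarrow> 'a set" where
  "ideal_colon R I J = {d \<in> carrier R. \<forall>j\<in>J. d \<otimes>\<^bsub>R\<^esub> j \<in> I}"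

lemma (in cring) ideal_colon_ideal:
  assumes I: "ideal I R" and J: "J \<subseteq> carrier R"
  shows "ideal (ideal_colon R I J) R"
proof -
  interpret I: ideal I R by fact
  show ?thesis
    using J by (intro cring_idealI) (auto simp: ideal_colon_def l_distr m_assoc subset_iff I.I_l_closed)
qed

lemma (in cring) ideal_colon_self:
  assumes I: "ideal I R" and J: "J \<subseteq> carrier R"
  shows "I \<subseteq> ideal_colon R I J"
proof -
  interpret I: ideal I R by fact
  show ?thesis
  proof
    fix x assume "x \<in> I"
    then show "x \<in> ideal_colon R I J"
      using J I.Icarr[of x] I.I_r_closed[of x] unfolding ideal_colon_def by blast
  qed
qed

section \<open>Noetherian induction and maximal ideals\<close>

context noetherian_ring
begin

text \<open>In a Noetherian ring the union of a nonempty chain of ideals is already a member of the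
  chain, which provides the upper bounds for Zorn's lemma.\<close>

lemma ideal_family_maximal:
  assumes "A \<noteq> {}" "\<And>I. I \<in> A \<Longrightarrow> ideal I R"
  shows "\<exists>M\<in>A. \<forall>I\<in>A. M \<subseteq> I \<longrightarrow> I = M"
proof (rule subset_Zorn_nonempty[OF assms(1)])
  fix C assume C: "C \<noteq> {}" "subset.chain A C"
  then have CA: "C \<subseteq> A" by (simp add: subset_chain_def)
  with C have "subset.chain {I. ideal I R} C"
    using assms(2) by (auto simp: subset_chain_def)
  then show "\<Union>C \<in> A" using ideal_chain_is_trivial[OF C(1)] CA by (auto dest: subsetD)
qed

lemma ideal_noetherian_induct [consumes 1, case_names step]:
  assumes "ideal I R"
    and step: "\<And>I. ideal I R \<Longrightarrow> (\<And>J. ideal J R \<Longrightarrow> I \<subset> J \<Longrightarrow> P J) \<Longrightarrow> P I"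
  shows "P I"
proof (rule ccontr)
  assume "\<not> P I"
  then have "\<exists>M\<in>{I. ideal I R \<and> \<not> P I}. \<forall>I\<in>{I. ideal I R \<and> \<not> P I}. M \<subseteq> I \<longrightarrow> I = M"
    using assms(1) by (intro ideal_family_maximal) auto
  then obtain M where M: "ideal M R" "\<not> P M"
    and max: "\<And>I. ideal I R \<Longrightarrow> \<not> P I \<Longrightarrow> M \<subseteq> I \<Longrightarrow> I = M" by blast
  have "P J" if "ideal J R" "M \<subset> J" for J
    using max[of J] that by blast
  then show False using step[OF M(1)] M(2) by blast
qed

lemma maximalideal_above:
  assumes "ideal I R" "I \<noteq> carrier R"
  obtains M where "maximalideal M R" "I \<subseteq> M"
proof -
  define F where "F = {J. ideal J R \<and> I \<subseteq> J \<and> J \<noteq> carrier R}"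
  have "\<exists>M\<in>F. \<forall>J\<in>F. M \<subseteq> J \<longrightarrow> J = M"
    using assms by (intro ideal_family_maximal) (auto simp: F_def)
  then obtain M where MF: "M \<in> F" and max: "\<And>J. J \<in> F \<Longrightarrow> M \<subseteq> J \<Longrightarrow> J = M" by blast
  have M: "ideal M R" "I \<subseteq> M" "M \<noteq> carrier R" using MF by (auto simp: F_def)
  have "maximalideal M R"
  proof (rule maximalidealI[OF M(1)])
    fix J assume J: "ideal J R" "M \<subseteq> J" "J \<subseteq> carrier R"
    show "J = M \<or> J = carrier R" using max[of J] J M(2) by (auto simp: F_def)
  qed (use M in simp)
  then show ?thesis using that M by blast
qed

end

subsection \<open>Invertibility of primes\<close>

context dedekind_domain
begin

text \<open>Otherwise \<open>J\<close> lies in a maximal ideal \<open>M\<close>, and 0 < p < M is a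
  chain of primes of length two, too long for Krull dimension one.\<close>

lemma nonzero_prime_maximal:
  assumes p: "primeideal p R" "p \<noteq> {\<zero>}" and J: "ideal J R" "p \<subseteq> J" "J \<noteq> carrier R"
  shows "J = p"
proof (rule ccontr)
  assume "J \<noteq> p"
  obtain M where M: "maximalideal M R" "J \<subseteq> M" using maximalideal_above J by blast
  define P where "P = (\<lambda>i::nat. if i = 0 then {\<zero>} else if i = 1 then p else M)"
  have "{\<zero>} \<subset> p"
    using p additive_subgroup.zero_closed[OF ideal.axioms(1)[OF primeideal.axioms(1)[OF p(1)]]]
    by blast
  moreover have "p \<subset> M" using J M \<open>J \<noteq> p\<close> by blast
  ultimately have "(\<forall>i\<le>2. primeideal (P i) R) \<and> (\<forall>i<2. P i \<subset> P (Suc i))"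
    using zeroprimeideal p maximalideal_prime[OF M(1)] by (auto simp: P_def less_2_cases_iff)
  then have "enat 2 \<le> krull_dim R" unfolding krull_dim_def by (intro Sup_upper) blast
  then show False by (simp add: krull_dim_one one_enat_def)
qed

lemma inverse_mod_prime:
  assumes p: "primeideal p R" "p \<noteq> {\<zero>}" and x: "x \<in> carrier R" "x \<notin> p"
  obtains y m where "y \<in> carrier R" "m \<in> p" "x \<otimes> y \<oplus> m = \<one>"
proof -
  interpret p: primeideal p R by fact
  have J: "ideal (PIdl x <+> p) R" by (intro add_ideals cgenideal_ideal x p.ideal_axioms)
  have "PIdl x <+> p = carrier R"
  proof (rule ccontr)
    assume *: "PIdl x <+> p \<noteq> carrier R"
    have "p \<subseteq> PIdl x <+> p"
      using p.Icarr additive_subgroup.zero_closed[OF ideal.axioms(1)[OF cgenideal_ideal[OF x(1)]]]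
      unfolding set_add_def' by force
    then have "PIdl x <+> p = p" using nonzero_prime_maximal[OF p J] * by blast
    moreover have "x \<oplus> \<zero> \<in> PIdl x <+> p"
      using cgenideal_self[OF x(1)] p.zero_closed unfolding set_add_def' by blast
    ultimately show False using x by simp
  qed
  then have "\<one> \<in> PIdl x <+> p" by simp
  then obtain y m where ym: "y \<in> carrier R" "m \<in> p" "y \<otimes> x \<oplus> m = \<one>"
    unfolding set_add_def' cgenideal_def by auto
  show ?thesis by (rule that[OF ym(1,2)]) (use ym x m_comm[of y x] in simp)
qed

text \<open>Among the annihilators of single elements modulo \<open>a\<close> that lie inside
  \<open>p\<close>, a maximal one is prime. It contains \<open>a\<close>, so it is nonzero, hence
  maximal as an ideal and equal to \<open>p\<close>.\<close>

lemma prime_is_colon: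
  assumes p: "primeideal p R" and a: "a \<in> p" "a \<noteq> \<zero>"
  obtains b where "b \<in> carrier R" "b \<notin> PIdl a" "p = ideal_colon R (PIdl a) {b}"
proof -
  interpret p: primeideal p R by fact
  have aR: "a \<in> carrier R" using a p.Icarr by blast
  define C where "C = (\<lambda>b. ideal_colon R (PIdl a) {b})"
  have C_iff: "x \<in> C b \<longleftrightarrow> x \<in> carrier R \<and> x \<otimes> b \<in> PIdl a" for x b
    by (auto simp: C_def ideal_colon_def)
  interpret A: ideal "PIdl a" R by (rule cgenideal_ideal[OF aR])
  have Cid: "ideal (C b) R" if "b \<in> carrier R" for b
    unfolding C_def using that by (intro ideal_colon_ideal A.ideal_axioms) auto
  have C1: "C \<one> \<subseteq> p"
    using a cgenideal_minimal[OF p.ideal_axioms a(1)] by (auto simp: C_iff)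
  define F where "F = {C b | b. b \<in> carrier R \<and> C b \<subseteq> p}"
  have F: "F \<noteq> {}" "\<And>I. I \<in> F \<Longrightarrow> ideal I R"
    using C1 Cid unfolding F_def by auto
  obtain M where M: "M \<in> F" and M_max: "\<And>I. I \<in> F \<Longrightarrow> M \<subseteq> I \<Longrightarrow> I = M"
    using ideal_family_maximal[OF F] by blast
  then obtain b where b: "b \<in> carrier R" "C b \<subseteq> p" "M = C b" unfolding F_def by blast
  have max: "C b' = C b" if "b' \<in> carrier R" "C b' \<subseteq> p" "C b \<subseteq> C b'" for b'
    using M_max[of "C b'"] that b(3) unfolding F_def by blast
  interpret Cb: ideal "C b" R using Cid b by blast
  have ne: "C b \<noteq> carrier R" using b p.I_notcarr p.a_subset by blast
  \<comment> \<open>If \<open>x \<otimes> y\<close> annihilates \<open>b\<close> but neither factor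
    does, the annihilator of \<open>x \<otimes> b\<close> is strictly larger and contains some
    \<open>s\<close> outside \<open>p\<close>. The annihilator of \<open>s \<otimes> b\<close> is
    then strictly larger too and contains some \<open>t\<close> outside \<open>p\<close>; but
    \<open>t \<otimes> s\<close> lies in \<open>C b\<close>, hence in \<open>p\<close>.\<close>
  have prime: "x \<in> C b \<or> y \<in> C b" if xy: "x \<in> carrier R" "y \<in> carrier R" "x \<otimes> y \<in> C b" for x y
  proof (rule ccontr)
    assume n: "\<not> (x \<in> C b \<or> y \<in> C b)"
    have sub: "C b \<subseteq> C (s \<otimes> b)" if "s \<in> carrier R" for s
    proof
      fix x assume x: "x \<in> C b"
      then have "x \<otimes> (s \<otimes> b) = s \<otimes> (x \<otimes> b)" using that b(1) m_lcomm[of x s b] by (simp add: C_iff)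
      then show "x \<in> C (s \<otimes> b)" using x that A.I_l_closed[of "x \<otimes> b" s] by (simp add: C_iff)
    qed
    have "y \<otimes> (x \<otimes> b) = x \<otimes> y \<otimes> b" using xy(1,2) b(1) by (simp add: m_ac)
    then have "y \<in> C (x \<otimes> b)" using xy by (simp add: C_iff)
    then have "C (x \<otimes> b) \<noteq> C b" using n by auto
    then have "\<not> C (x \<otimes> b) \<subseteq> p" using max[OF _ _ sub[OF xy(1)]] xy(1) b(1) by auto
    then obtain s where "s \<in> C (x \<otimes> b)" "s \<notin> p" by blast
    then have s: "s \<in> carrier R" "s \<otimes> (x \<otimes> b) \<in> PIdl a" "s \<notin> p" by (auto simp: C_iff)
    then have "x \<in> C (s \<otimes> b)" using xy(1) b(1) m_lcomm[of x s b] by (simp add: C_iff)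
    then have "C (s \<otimes> b) \<noteq> C b" using n by auto
    then have "\<not> C (s \<otimes> b) \<subseteq> p" using max[OF _ _ sub[OF s(1)]] s(1) b(1) by auto
    then obtain t where "t \<in> C (s \<otimes> b)" "t \<notin> p" by blast
    then have t: "t \<in> carrier R" "t \<otimes> (s \<otimes> b) \<in> PIdl a" "t \<notin> p" by (auto simp: C_iff)
    then have "t \<otimes> s \<in> C b" using s(1) b(1) by (simp add: C_iff m_assoc)
    then have "t \<otimes> s \<in> p" using b(2) by auto
    then show False using p.I_prime[OF t(1) s(1)] s(3) t(3) by simp
  qed
  have "primeideal (C b) R" using ne prime by unfold_locales auto
  moreover have "a \<in> C b" using aR b A.I_r_closed[OF cgenideal_self[OF aR]] by (auto simp: C_iff)
  then have "C b \<noteq> {\<zero>}" using a by auto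
  ultimately have "p = C b"
    using nonzero_prime_maximal[OF _ _ p.ideal_axioms b(2)] p.I_notcarr by blast
  moreover have "b \<notin> PIdl a"
  proof
    assume "b \<in> PIdl a"
    then have "\<one> \<in> C b" using b(1) by (simp add: C_iff)
    then show False using Cb.one_imp_carrier ne by simp
  qed
  ultimately show ?thesis using that[OF b(1)] unfolding C_def by simp
qed

lemma
  assumes "x \<in> carrier R" "y \<in> carrier R"
  shows to_fraction_field_mult: "to_fraction_field R (x \<otimes> y) =
      to_fraction_field R x \<otimes>\<^bsub>fraction_field R\<^esub> to_fraction_field R y"
    and to_fraction_field_add: "to_fraction_field R (x \<oplus> y) =
    to_fraction_field R x \<oplus>\<^bsub>fraction_field R\<^esub> to_fraction_field R y"
  using ring_hom_mult[OF to_fraction_field_hom assms] ring_hom_add[OF to_fraction_field_hom assms] by auto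

text \<open>If \<open>b/a\<close> maps \<open>I\<close> into itself and \<open>c \<in> I\<close> is nonzero, then \<open>x \<mapsto> x c\<close> embeds \<open>R[b/a]\<close>
  into \<open>I\<close>, so that the Noetherian condition makes \<open>b/a\<close> integral.\<close>

lemma multiplier_in_ring:
  assumes I: "ideal I R" "I \<noteq> {\<zero>}" and ab: "a \<in> carrier R" "a \<noteq> \<zero>" "b \<in> carrier R"
    and mult: "\<And>t. t \<in> I \<Longrightarrow> \<exists>t'\<in>I. b \<otimes> t = a \<otimes> t'"
  shows "b \<in> PIdl a"
proof -
  interpret I: ideal I R by fact
  let ?K = "fraction_field R"
  let ?i = "to_fraction_field R"
  interpret K: field ?K by (rule fraction_field_is_field)
  obtain c where c: "c \<in> I" "c \<noteq> \<zero>" using I I.zero_closed by blast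
  obtain f where f: "\<And>t. t \<in> I \<Longrightarrow> f t \<in> I \<and> b \<otimes> t = a \<otimes> f t" using mult by metis
  \<comment> \<open>\<open>s n\<close> stands for (b/a)^n c, which never leaves
    \<open>I\<close>.\<close>
  define s where "s = (\<lambda>n. (f ^^ n) c)"
  have sI: "s n \<in> I" for n by (induction n) (use c f in \<open>auto simp: s_def\<close>)
  have s0: "s 0 = c" by (simp add: s_def)
  have sS: "b \<otimes> s n = a \<otimes> s (Suc n)" for n using f[OF sI[of n]] by (simp add: s_def)
  have sR: "s n \<in> carrier R" for n using sI I.Icarr by blast
  define l where "l = fraction R b a"
  have l: "l \<in> carrier ?K" using ab by (simp add: l_def fraction_in_carrier)
  have i: "?i x \<in> carrier ?K" if "x \<in> carrier R" for x
    using that by (simp add: to_fraction_field_def fraction_in_carrier)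
  have ls: "l [^]\<^bsub>?K\<^esub> n \<otimes>\<^bsub>?K\<^esub> ?i c = ?i (s n)" for n
  proof (induction n)
    case 0
    then show ?case using i c(1) I.Icarr by (simp add: s0)
  next
    case (Suc n)
    have "l [^]\<^bsub>?K\<^esub> Suc n \<otimes>\<^bsub>?K\<^esub> ?i c = l \<otimes>\<^bsub>?K\<^esub> (l [^]\<^bsub>?K\<^esub> n \<otimes>\<^bsub>?K\<^esub> ?i c)"
      using l i c(1) I.Icarr by (simp add: K.m_ac)
    also have "\<dots> = fraction R (b \<otimes> s n) (a \<otimes> \<one>)"
      using ab sR by (simp only: Suc) (simp add: l_def to_fraction_field_def fraction_field_mult)
    also have "\<dots> = ?i (s (Suc n))"
      using ab sR by (simp add: to_fraction_field_def fraction_eq_iff sS m_comm)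
    finally show ?case .
  qed
  \<comment> \<open>\<open>J n\<close> is the ideal generated by \<open>s 0\<close>, ...,
    \<open>s (n - 1)\<close>. Once this ascending chain stops, \<open>s n\<close> is a linear
    combination of the earlier terms, and this is an integral equation for b/a, multiplied by
    \<open>c\<close>.\<close>
  define J where "J = rec_nat {\<zero>} (\<lambda>n A. {d \<otimes> s n \<oplus> y | d y. d \<in> carrier R \<and> y \<in> A})"
  have J0: "J 0 = {\<zero>}" and JS: "J (Suc n) = {d \<otimes> s n \<oplus> y | d y. d \<in> carrier R \<and> y \<in> J n}" for n
    by (simp_all add: J_def)
  have J: "ideal (J n) R" for n
  proof (induction n)
    case 0
    then show ?case by (simp add: J0 zeroideal)
  next
    case (Suc n)
    interpret Jn: ideal "J n" R by fact
    show ?case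
    proof (rule cring_idealI)
      show "J (Suc n) \<subseteq> carrier R" using sR by (auto simp: JS)
      show "\<zero> \<in> J (Suc n)" using sR by (auto simp: JS intro!: exI[of _ \<zero>])
    next
      fix x y assume "x \<in> J (Suc n)" "y \<in> J (Suc n)"
      then obtain d x' e y' where *: "x = d \<otimes> s n \<oplus> x'" "y = e \<otimes> s n \<oplus> y'"
        "d \<in> carrier R" "e \<in> carrier R" "x' \<in> J n" "y' \<in> J n" by (auto simp: JS)
      have "x \<oplus> y = (d \<oplus> e) \<otimes> s n \<oplus> (x' \<oplus> y')"
        using * sR[of n] Jn.Icarr[OF *(5)] Jn.Icarr[OF *(6)] by (simp add: l_distr a_ac)
      then show "x \<oplus> y \<in> J (Suc n)" using * by (auto simp: JS)
    next
      fix r x assume r: "r \<in> carrier R" "x \<in> J (Suc n)"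
      then obtain d x' where *: "x = d \<otimes> s n \<oplus> x'" "d \<in> carrier R" "x' \<in> J n" by (auto simp: JS)
      have "r \<otimes> x = (r \<otimes> d) \<otimes> s n \<oplus> r \<otimes> x'"
        using * r sR[of n] Jn.Icarr[OF *(3)] by (simp add: r_distr m_assoc)
      then show "r \<otimes> x \<in> J (Suc n)" using * r Jn.I_l_closed[OF *(3) r(1)] by (auto simp: JS)
    qed
  qed
  have Jmono: "J n \<subseteq> J (Suc n)" for n
  proof
    fix x assume "x \<in> J n"
    moreover from this have "x = \<zero> \<otimes> s n \<oplus> x" using sR ideal.Icarr[OF J] by simp
    ultimately show "x \<in> J (Suc n)" unfolding JS by blast
  qed
  then have Jmono': "m \<le> n \<Longrightarrow> J m \<subseteq> J n" for m n by (rule lift_Suc_mono_le)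
  have "J m \<subseteq> J n \<or> J n \<subseteq> J m" for m n using Jmono' nat_le_linear by blast
  then have "subset.chain {I. ideal I R} (range J)"
    using J by (auto simp: subset_chain_def)
  then have "\<Union>(range J) \<in> range J" using ideal_chain_is_trivial by blast
  then obtain n where "\<Union>(range J) = J n" by auto
  then have "J (Suc n) \<subseteq> J n" by blast
  moreover have "s n = \<one> \<otimes> s n \<oplus> \<zero>" using sR by simp
  then have "s n \<in> J (Suc n)" 
    using additive_subgroup.zero_closed[OF ideal.axioms(1)[OF J]] one_closed unfolding JS by blast
  ultimately have "s n \<in> J n" by blast
  \<comment> \<open>The negative is expanded because its coefficients, preceded by a leading one,
    form a monic polynomial with root \<open>l\<close>. For this to have degree \<open>n\<close>,
    the list supplied by \<open>poly\<close> must have length exactly \<open>n\<close>.\<close>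
  then have neg: "\<ominus> s n \<in> J n"
    using additive_subgroup.a_inv_closed[OF ideal.axioms(1)[OF J]] by blast
  have poly: "\<exists>ds. length ds = n \<and> set ds \<subseteq> ?i ` carrier R \<and> K.eval ds l \<otimes>\<^bsub>?K\<^esub> ?i c = ?i x"
    if "x \<in> J n" for x n
    using that
  proof (induction n arbitrary: x)
    case 0
    have "?i x = \<zero>\<^bsub>?K\<^esub>" using 0 by (simp add: J0 to_fraction_field_def fraction_field_zero)
    then show ?case using i[of c] c(1) I.Icarr by simp
  next
    case (Suc n)
    then obtain d y where x: "x = d \<otimes> s n \<oplus> y" "d \<in> carrier R" "y \<in> J n" by (auto simp: JS)
    obtain ds where ds: "length ds = n" "set ds \<subseteq> ?i ` carrier R"
      "K.eval ds l \<otimes>\<^bsub>?K\<^esub> ?i c = ?i y" using Suc.IH[OF x(3)] by blast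
    have yR: "y \<in> carrier R" by (rule ideal.Icarr[OF J x(3)])
    have ev: "K.eval ds l \<in> carrier ?K"
      using ds(2) i l by (intro K.eval_in_carrier) auto
    have "K.eval (?i d # ds) l \<otimes>\<^bsub>?K\<^esub> ?i c
        = ?i d \<otimes>\<^bsub>?K\<^esub> (l [^]\<^bsub>?K\<^esub> n \<otimes>\<^bsub>?K\<^esub> ?i c) \<oplus>\<^bsub>?K\<^esub> K.eval ds l \<otimes>\<^bsub>?K\<^esub> ?i c"
      using x(2) c(1) i l ev I.Icarr ds(1) by (simp add: K.l_distr K.m_assoc)
    also have "\<dots> = ?i x"
      using x yR sR by (simp add: ls ds to_fraction_field_mult to_fraction_field_add)
    finally show ?case using ds x by (intro exI[of _ "?i d # ds"]) auto
  qed
  obtain ds where ds: "length ds = n" "set ds \<subseteq> ?i ` carrier R"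
    "K.eval ds l \<otimes>\<^bsub>?K\<^esub> ?i c = ?i (\<ominus> s n)" using poly[OF neg] by blast
  have ev: "K.eval ds l \<in> carrier ?K"
    using ds(2) i l by (intro K.eval_in_carrier) auto
  let ?p = "\<one>\<^bsub>?K\<^esub> # ds"
  have evp: "K.eval ?p l = l [^]\<^bsub>?K\<^esub> n \<oplus>\<^bsub>?K\<^esub> K.eval ds l" using l ds by simp
  have "K.eval ?p l \<otimes>\<^bsub>?K\<^esub> ?i c = ?i (s n) \<oplus>\<^bsub>?K\<^esub> ?i (\<ominus> s n)"
    unfolding evp using l ev i c(1) I.Icarr ds(3) by (simp add: K.l_distr ls)
  also have "\<dots> = ?i \<zero>" using sR by (simp add: to_fraction_field_add[symmetric] r_neg)
  also have "\<dots> = \<zero>\<^bsub>?K\<^esub>" by (simp add: to_fraction_field_def fraction_field_zero)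
  finally have "K.eval ?p l = \<zero>\<^bsub>?K\<^esub> \<or> ?i c = \<zero>\<^bsub>?K\<^esub>"
    by (subst (asm) K.integral_iff) (use ev l i c I.Icarr evp in auto)
  moreover have "?i c \<noteq> \<zero>\<^bsub>?K\<^esub>"
    using c I.Icarr by (auto simp: to_fraction_field_def fraction_field_zero fraction_eq_iff)
  ultimately have root: "K.eval ?p l = \<zero>\<^bsub>?K\<^esub>" by simp
  have "\<one>\<^bsub>?K\<^esub> \<in> ?i ` carrier R" by (auto simp: to_fraction_field_def fraction_field_one)
  then have "?p \<in> carrier ((?i ` carrier R)[X]\<^bsub>?K\<^esub>)"
    using ds(2) by (simp add: univ_poly_def polynomial_def)
  then have "integral_over ?K (?i ` carrier R) l"
    unfolding integral_over_def using root by (intro bexI[of _ ?p]) auto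
  then have "l \<in> ?i ` carrier R" using integrally_closed l by (simp add: integrally_closed_def)
  then obtain d where d: "d \<in> carrier R" "fraction R b a = fraction R d \<one>"
    by (auto simp: l_def to_fraction_field_def)
  then have "b = d \<otimes> a" using ab by (simp add: fraction_eq_iff)
  then show ?thesis using d by (auto simp: cgenideal_def)
qed

text \<open>The fraction \<open>b/a\<close> lies in the inverse of \<open>p\<close>, and \<open>1 = (b/a) x + m\<close> witnesses
  \<open>p\<inverse> p = R\<close>.\<close>

lemma prime_invertible:
  assumes p: "primeideal p R" "p \<noteq> {\<zero>}"
  obtains a b x m where "a \<in> carrier R" "a \<noteq> \<zero>" "b \<in> carrier R" "b \<notin> PIdl a"
    "x \<in> p" "m \<in> p" "a = b \<otimes> x \<oplus> a \<otimes> m"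
    "\<And>t. t \<in> p \<Longrightarrow> \<exists>t'\<in>carrier R. b \<otimes> t = a \<otimes> t'"
proof -
  interpret p: primeideal p R by fact
  obtain a where a: "a \<in> p" "a \<noteq> \<zero>" using p p.zero_closed by blast
  have aR: "a \<in> carrier R" using a p.Icarr by blast
  obtain b where b: "b \<in> carrier R" "b \<notin> PIdl a" "p = ideal_colon R (PIdl a) {b}"
    using prime_is_colon[OF p(1) a] by blast
  have quot: "\<exists>t'\<in>carrier R. b \<otimes> t = a \<otimes> t'" if t: "t \<in> p" for t
  proof -
    have "t \<in> ideal_colon R (PIdl a) {b}" using t unfolding b(3)[symmetric] .
    then have "t \<otimes> b \<in> PIdl a" by (simp add: ideal_colon_def)
    then show ?thesis using t b(1) aR p.Icarr by (auto simp: cgenideal_def m_comm)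
  qed
  \<comment> \<open>If b/a mapped \<open>p\<close> into itself, it would lie in the ring, contrary
    to the choice of \<open>b\<close>. So some d = (b/a) x0 is outside \<open>p\<close>, and an
    inverse of \<open>d\<close> modulo \<open>p\<close> scales \<open>x0\<close> to the required
    \<open>x\<close>.\<close>
  have "\<not> (\<forall>t\<in>p. \<exists>t'\<in>p. b \<otimes> t = a \<otimes> t')"
    using multiplier_in_ring[OF p.ideal_axioms p(2) aR a(2) b(1)] b(2) by blast
  then obtain x0 where x0: "x0 \<in> p" "\<And>t'. t' \<in> p \<Longrightarrow> b \<otimes> x0 \<noteq> a \<otimes> t'" by blast
  obtain d where d: "d \<in> carrier R" "b \<otimes> x0 = a \<otimes> d" using quot[OF x0(1)] by blast
  then have "d \<notin> p" using x0 by blast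
  then obtain y m where ym: "y \<in> carrier R" "m \<in> p" "d \<otimes> y \<oplus> m = \<one>"
    using inverse_mod_prime[OF p d(1)] by blast
  have x0R: "x0 \<in> carrier R" and mR: "m \<in> carrier R" using x0 ym p.Icarr by auto
  have "a = a \<otimes> (d \<otimes> y \<oplus> m)" using ym aR by simp
  also have "\<dots> = (a \<otimes> d) \<otimes> y \<oplus> a \<otimes> m"
    using aR d(1) ym(1) mR by (simp add: r_distr m_assoc)
  also have "\<dots> = b \<otimes> (x0 \<otimes> y) \<oplus> a \<otimes> m"
    using d(2)[symmetric] b(1) x0R ym(1) by (simp add: m_assoc)
  finally have "a = b \<otimes> (x0 \<otimes> y) \<oplus> a \<otimes> m" .
  then show ?thesis
    using that[OF aR a(2) b(1,2) p.I_r_closed[OF x0(1) ym(1)] ym(2)] quot by blast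
qed

text \<open>This is multiplication by the inverse of \<open>p\<close>: from 1 = (b/a) x + m, every
  \<open>i\<close> equals (b/a) (x i) + m i. Both x i and m i lie in \<open>p \<cdot> J\<close>, and
  b/a maps \<open>p \<cdot> J\<close> into \<open>J\<close>.\<close>

lemma ideal_prod_prime_cancel:
  assumes p: "primeideal p R" "p \<noteq> {\<zero>}" and I: "ideal I R" and J: "ideal J R"
    and sub: "p \<cdot> I \<subseteq> p \<cdot> J"
  shows "I \<subseteq> J"
proof
  fix i assume i: "i \<in> I"
  interpret p: primeideal p R by fact
  interpret I: ideal I R by fact
  interpret J: ideal J R by fact
  obtain a b x m where ab: "a \<in> carrier R" "a \<noteq> \<zero>" "b \<in> carrier R" "b \<notin> PIdl a"
    and xm: "x \<in> p" "m \<in> p" "a = b \<otimes> x \<oplus> a \<otimes> m"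
    and quot: "\<And>t. t \<in> p \<Longrightarrow> \<exists>t'\<in>carrier R. b \<otimes> t = a \<otimes> t'"
    using prime_invertible[OF p] by blast
  have q: "\<exists>j\<in>J. b \<otimes> y = a \<otimes> j" if "y \<in> p \<cdot> J" for y
    using that
  proof (induction y rule: ideal_prod.induct)
    case (prod t j)
    then obtain t' where t': "t' \<in> carrier R" "b \<otimes> t = a \<otimes> t'" using quot by blast
    have "b \<otimes> (t \<otimes> j) = (b \<otimes> t) \<otimes> j" using prod ab p.Icarr J.Icarr by (simp add: m_assoc)
    also have "\<dots> = a \<otimes> (t' \<otimes> j)" using t' ab prod J.Icarr by (simp add: m_assoc)
    finally show ?case using J.I_l_closed[OF prod(2) t'(1)] by blast
  next
    case (sum s1 s2)
    then obtain j1 j2 where "j1 \<in> J" "b \<otimes> s1 = a \<otimes> j1" "j2 \<in> J" "b \<otimes> s2 = a \<otimes> j2" by blast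
    moreover have "s1 \<in> carrier R" "s2 \<in> carrier R"
      using sum ideal_prod_in_carrier[OF p.ideal_axioms J] by auto
    ultimately have "b \<otimes> (s1 \<oplus> s2) = a \<otimes> (j1 \<oplus> j2)" "j1 \<oplus> j2 \<in> J"
      using ab J.Icarr by (auto simp: r_distr)
    then show ?case by blast
  qed
  have "x \<otimes> i \<in> p \<cdot> J" "m \<otimes> i \<in> p \<cdot> J" using sub xm i ideal_prod.prod[of _ p _ I R] by blast+
  then obtain j where j: "j \<in> J" "b \<otimes> (x \<otimes> i) = a \<otimes> j" using q by blast
  have mi: "m \<otimes> i \<in> J" using \<open>m \<otimes> i \<in> p \<cdot> J\<close> ideal_prod_inter[OF p.ideal_axioms J] by blast
  have c: "i \<in> carrier R" "x \<in> carrier R" "m \<in> carrier R" "j \<in> carrier R"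
    using i xm j p.Icarr I.Icarr J.Icarr by auto
  have "a \<otimes> i = (b \<otimes> x \<oplus> a \<otimes> m) \<otimes> i" using xm by simp
  also have "\<dots> = b \<otimes> (x \<otimes> i) \<oplus> a \<otimes> (m \<otimes> i)" using c ab by (simp add: l_distr m_assoc)
  also have "\<dots> = a \<otimes> (j \<oplus> m \<otimes> i)" using c ab j by (simp add: r_distr)
  finally have "i = j \<oplus> m \<otimes> i" using m_lcancel[of a i "j \<oplus> m \<otimes> i"] ab c by simp
  then show "i \<in> J" using j mi by (metis J.a_closed)
qed

text \<open>The cofactor is the ideal quotient (q : p), which plays the role of the inverse of
  \<open>p\<close> times \<open>q\<close>. Were it equal to \<open>q\<close>, then b/a would map
  \<open>q\<close> into itself and lie in the ring. From t = x ((b/a) t) + m t one sees that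
  \<open>q\<close> is contained in \<open>p \<cdot> q'\<close>.\<close>

lemma prime_contains_divides:
  assumes p: "primeideal p R" and q: "ideal q R" "q \<noteq> {\<zero>}" "q \<subseteq> p"
  obtains q' where "ideal q' R" "q = p \<cdot> q'" "q \<subset> q'"
proof -
  interpret p: primeideal p R by fact
  interpret q: ideal q R by fact
  have p0: "p \<noteq> {\<zero>}" using q q.zero_closed by blast
  obtain a b x m where ab: "a \<in> carrier R" "a \<noteq> \<zero>" "b \<in> carrier R" "b \<notin> PIdl a"
    and xm: "x \<in> p" "m \<in> p" "a = b \<otimes> x \<oplus> a \<otimes> m"
    and quot: "\<And>t. t \<in> p \<Longrightarrow> \<exists>t'\<in>carrier R. b \<otimes> t = a \<otimes> t'"
    using prime_invertible[OF p p0] by blast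
  define q' where "q' = ideal_colon R q p"
  have xmR: "x \<in> carrier R" "m \<in> carrier R" using xm p.Icarr by auto
  have q': "ideal q' R" "q \<subseteq> q'"
    unfolding q'_def using ideal_colon_ideal[OF q(1) p.a_subset] ideal_colon_self[OF q(1) p.a_subset] by auto
  interpret q': ideal q' R by fact
  have move: "\<exists>t'\<in>q'. b \<otimes> t = a \<otimes> t'" if t: "t \<in> q" for t
  proof -
    obtain t' where t': "t' \<in> carrier R" "b \<otimes> t = a \<otimes> t'" using quot t q by blast
    have "t' \<otimes> y \<in> q" if y: "y \<in> p" for y
    proof -
      obtain y' where y': "y' \<in> carrier R" "b \<otimes> y = a \<otimes> y'" using quot y by blast
      have c: "t \<in> carrier R" "y \<in> carrier R" using t y q.Icarr p.Icarr by auto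
      have "a \<otimes> (t' \<otimes> y) = (b \<otimes> t) \<otimes> y" using t' ab c by (simp add: m_assoc)
      also have "\<dots> = t \<otimes> (b \<otimes> y)" using ab c by (simp add: m_ac)
      also have "\<dots> = a \<otimes> (t \<otimes> y')" using y' ab c by (simp add: m_lcomm)
      finally have "t' \<otimes> y = t \<otimes> y'"
        using m_lcancel[of a "t' \<otimes> y" "t \<otimes> y'"] ab c t' y' by simp
      then show ?thesis using q.I_r_closed[OF t y'(1)] by simp
    qed
    then have "t' \<in> q'" using t'(1) unfolding q'_def ideal_colon_def by blast
    then show ?thesis using t'(2) by blast
  qed
  have "q \<noteq> q'" using move multiplier_in_ring[OF q(1,2) ab(1-3)] ab(4) by auto
  moreover have "p \<cdot> q' = q"
  proof
    show "p \<cdot> q' \<subseteq> q"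
    proof
      fix y assume "y \<in> p \<cdot> q'"
      then show "y \<in> q"
      proof (induction y rule: ideal_prod.induct)
        case (prod t d)
        then have "d \<otimes> t \<in> q" unfolding q'_def ideal_colon_def by blast
        moreover have "t \<otimes> d = d \<otimes> t" using m_comm[OF p.Icarr[OF prod(1)] q'.Icarr[OF prod(2)]] .
        ultimately show ?case by simp
      qed simp
    qed
    show "q \<subseteq> p \<cdot> q'"
    proof
      fix t assume t: "t \<in> q"
      obtain t' where t': "t' \<in> q'" "b \<otimes> t = a \<otimes> t'" using move[OF t] by blast
      have c: "t \<in> carrier R" "t' \<in> carrier R" using t t' q.Icarr q'.Icarr by auto
      have "a \<otimes> t = (b \<otimes> x \<oplus> a \<otimes> m) \<otimes> t" using xm by simp
      also have "\<dots> = x \<otimes> (b \<otimes> t) \<oplus> a \<otimes> (m \<otimes> t)" 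
        using c ab xmR by (simp add: l_distr m_assoc m_lcomm)
      also have "\<dots> = a \<otimes> (x \<otimes> t' \<oplus> m \<otimes> t)" using c ab xmR t' by (simp add: r_distr m_lcomm)
      finally have "t = x \<otimes> t' \<oplus> m \<otimes> t"
        using m_lcancel[of a t "x \<otimes> t' \<oplus> m \<otimes> t"] ab c xmR by simp
      moreover have "x \<otimes> t' \<in> p \<cdot> q'" "m \<otimes> t \<in> p \<cdot> q'"
        using xm t' t q'(2) by (auto intro: ideal_prod.prod)
      ultimately show "t \<in> p \<cdot> q'" by (metis ideal_prod.sum)
    qed
  qed
  ultimately show ?thesis using that q' by blast
qed


subsection \<open>Prime factorization\<close>

lemma ideals_set_simps:
  "carrier (ideals_set R) = {I. ideal I R}" "I \<otimes>\<^bsub>ideals_set R\<^esub> J = I \<cdot> J"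
  "\<one>\<^bsub>ideals_set R\<^esub> = carrier R"
  by (simp_all add: ideals_set_def)

lemma ideal_pow_ideal: "ideal p R \<Longrightarrow> ideal (p [^]\<^bsub>ideals_set R\<^esub> (k::nat)) R"
  using monoid.nat_pow_closed[OF comm_monoid.axioms(1)[OF ideals_set_is_comm_monoid], of p k]
  by (simp add: ideals_set_simps)

lemma ideal_pow_Suc:
  assumes "ideal p R"
  shows "p [^]\<^bsub>ideals_set R\<^esub> (Suc k) = p \<cdot> (p [^]\<^bsub>ideals_set R\<^esub> (k::nat))"
proof -
  interpret M: comm_monoid "ideals_set R" by (rule ideals_set_is_comm_monoid)
  have "p [^]\<^bsub>ideals_set R\<^esub> (Suc k) = (p [^]\<^bsub>ideals_set R\<^esub> k) \<cdot> p"
    by (simp add: ideals_set_simps)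
  then show ?thesis
    using ideal_prod_commute[OF assms ideal_pow_ideal[OF assms]] by simp
qed

lemma prime_contains_pow:
  assumes P: "primeideal P R" and p: "ideal p R" and "p [^]\<^bsub>ideals_set R\<^esub> (k::nat) \<subseteq> P"
  shows "p \<subseteq> P"
  using assms(3)
proof (induction k)
  case 0
  interpret M: comm_monoid "ideals_set R" by (rule ideals_set_is_comm_monoid)
  have "carrier R \<subseteq> P" using 0 by (simp add: ideals_set_simps)
  then show ?case
    using primeideal.I_notcarr[OF P] additive_subgroup.a_subset[OF ideal.axioms(1)[OF primeideal.axioms(1)[OF P]]]
    by simp
next
  case (Suc k)
  then have "p \<cdot> (p [^]\<^bsub>ideals_set R\<^esub> k) \<subseteq> P" by (simp only: ideal_pow_Suc[OF p])
  then show ?case using primeideal_divides_ideal_prod[OF P p ideal_pow_ideal[OF p]] Suc.IH by blast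
qed

lemma prime_contains_finprod:
  assumes P: "primeideal P R" and "finite A" "\<And>p. p \<in> A \<Longrightarrow> ideal p R"
    and "finprod (ideals_set R) (\<lambda>p. p [^]\<^bsub>ideals_set R\<^esub> (e p :: nat)) A \<subseteq> P"
  shows "\<exists>p\<in>A. p \<subseteq> P"
  using assms(2-)
proof (induction A rule: finite_induct)
  case empty
  interpret M: comm_monoid "ideals_set R" by (rule ideals_set_is_comm_monoid)
  have "carrier R \<subseteq> P" using empty by (simp add: ideals_set_simps)
  then show ?case
    using primeideal.I_notcarr[OF P] additive_subgroup.a_subset[OF ideal.axioms(1)[OF primeideal.axioms(1)[OF P]]]
    by simp
next
  case (insert p A)
  interpret M: comm_monoid "ideals_set R" by (rule ideals_set_is_comm_monoid)
  let ?f = "\<lambda>p. (p [^]\<^bsub>ideals_set R\<^esub> e p)"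
  have f: "?f \<in> A \<rightarrow> carrier (ideals_set R)" "?f p \<in> carrier (ideals_set R)"
    using insert.prems(1) ideal_pow_ideal by (auto simp: ideals_set_simps)
  have fi: "ideal (finprod (ideals_set R) ?f A) R"
    using M.finprod_closed[OF f(1)] by (simp add: ideals_set_simps)
  have "?f p \<cdot> finprod (ideals_set R) ?f A \<subseteq> P"
    using insert.prems(2) M.finprod_insert[OF insert.hyps f] by (simp add: ideals_set_simps)
  then have "?f p \<subseteq> P \<or> finprod (ideals_set R) ?f A \<subseteq> P"
    using primeideal_divides_ideal_prod[OF P _ fi] f(2) by (simp add: ideals_set_simps)
  then show ?case
  proof
    assume "?f p \<subseteq> P"
    then have "p \<subseteq> P" using prime_contains_pow[OF P insert.prems(1)[of p]] by simp
    then show ?thesis by blast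
  next
    assume "finprod (ideals_set R) ?f A \<subseteq> P"
    then show ?thesis using insert.IH insert.prems(1) by blast
  qed
qed

text \<open>Separates the \<open>p\<close>-part from the rest. A \<open>p\<close> that does not
  occur has exponent zero, and its power is then the whole ring.\<close>

lemma prime_factorization_split:
  assumes e: "is_prime_factorization R q e" and p: "ideal p R"
  defines "m \<equiv> finprod (ideals_set R) (\<lambda>p. p [^]\<^bsub>ideals_set R\<^esub> e p) ({p. e p \<noteq> 0} - {p})"
  shows "q = (p [^]\<^bsub>ideals_set R\<^esub> e p) \<cdot> m" "ideal m R"
proof -
  interpret M: comm_monoid "ideals_set R" by (rule ideals_set_is_comm_monoid)
  let ?f = "\<lambda>p. (p [^]\<^bsub>ideals_set R\<^esub> e p)"
  let ?A = "{p. e p \<noteq> 0}"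
  have fin: "finite ?A" and id: "\<And>p. e p \<noteq> 0 \<Longrightarrow> ideal p R"
    and q: "q = finprod (ideals_set R) ?f ?A"
    using e primeideal.axioms(1) by (auto simp: is_prime_factorization_def)
  have f: "?f \<in> ?A - {p} \<rightarrow> carrier (ideals_set R)" "?f p \<in> carrier (ideals_set R)"
    using id p ideal_pow_ideal by (auto simp: ideals_set_simps)
  show m: "ideal m R" using M.finprod_closed[OF f(1)] by (simp add: m_def ideals_set_simps)
  show "q = ?f p \<cdot> m"
  proof (cases "e p = 0")
    case True
    have "?f p = carrier R" using True by (simp add: ideals_set_simps)
    moreover have "?A - {p} = ?A" using True by auto
    ultimately show ?thesis
      using q m ideal_prod_one[OF m] ideal_prod_commute[OF m oneideal] by (simp add: m_def)
  next
    case False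
    then have "?A = insert p (?A - {p})" by auto
    then have "q = finprod (ideals_set R) ?f (insert p (?A - {p}))" using q by simp
    also have "\<dots> = ?f p \<otimes>\<^bsub>ideals_set R\<^esub> m"
      unfolding m_def by (rule M.finprod_insert) (use fin f in auto)
    finally show ?thesis by (simp add: ideals_set_simps)
  qed
qed

text \<open>Noetherian induction: dividing a proper \<open>q\<close> by a maximal ideal above it
  gives a strictly larger ideal, whose factorization needs one more factor \<open>p\<close>.\<close>

lemma is_prime_factorization_exists:
  assumes "ideal q R" "q \<noteq> {\<zero>}"
  shows "\<exists>e. is_prime_factorization R q e"
  using assms
proof (induction q rule: ideal_noetherian_induct)
  case (step q)
  interpret M: comm_monoid "ideals_set R" by (rule ideals_set_is_comm_monoid)
  show ?case
  proof (cases "q = carrier R")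
    case True
    have "is_prime_factorization R q (\<lambda>_. 0)"
      using True by (simp add: is_prime_factorization_def ideals_set_simps)
    then show ?thesis by blast
  next
    case False
    obtain p where p: "maximalideal p R" "q \<subseteq> p" using maximalideal_above[OF step(1) False] by blast
    have pp: "primeideal p R" by (rule maximalideal_prime[OF p(1)])
    have pid: "ideal p R" by (rule primeideal.axioms(1)[OF pp])
    obtain q' where q': "ideal q' R" "q = p \<cdot> q'" "q \<subset> q'"
      using prime_contains_divides[OF pp step(1) step(3) p(2)] by blast
    have "q' \<noteq> {\<zero>}"
      using q'(3) additive_subgroup.zero_closed[OF ideal.axioms(1)[OF step(1)]] by auto
    then obtain e where e: "is_prime_factorization R q' e" using step(2)[OF q'(1,3)] by blast
    let ?f = "\<lambda>p. (p [^]\<^bsub>ideals_set R\<^esub> e p)"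
    define e' where "e' = e(p := Suc (e p))"
    let ?f' = "\<lambda>p. p [^]\<^bsub>ideals_set R\<^esub> e' p"
    let ?A = "{p. e p \<noteq> 0} - {p}"
    define m where "m = finprod (ideals_set R) ?f ?A"
    have split: "q' = ?f p \<cdot> m" "ideal m R"
      unfolding m_def using prime_factorization_split[OF e pid] by auto
    have fin: "finite {p. e p \<noteq> 0}" and id: "\<And>p. e p \<noteq> 0 \<Longrightarrow> primeideal p R"
      using e by (auto simp: is_prime_factorization_def)
    have A': "{p. e' p \<noteq> 0} = insert p ?A" by (auto simp: e'_def)
    have f: "?f \<in> ?A \<rightarrow> carrier (ideals_set R)"
      using ideal_pow_ideal[OF primeideal.axioms(1)[OF id]] by (simp add: ideals_set_simps Pi_def)
    have f': "?f' \<in> ?A \<rightarrow> carrier (ideals_set R)" "?f' p \<in> carrier (ideals_set R)"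
      using ideal_pow_ideal[OF primeideal.axioms(1)[OF id]] ideal_pow_ideal[OF pid]
      by (simp_all add: ideals_set_simps Pi_def)
    have "finprod (ideals_set R) ?f' (insert p ?A) = ?f' p \<otimes>\<^bsub>ideals_set R\<^esub> finprod (ideals_set R) ?f' ?A"
      by (rule M.finprod_insert) (use fin f' in auto)
    also have "finprod (ideals_set R) ?f' ?A = m"
      unfolding m_def by (rule M.finprod_cong') (use f in \<open>auto simp: e'_def\<close>)
    also have "?f' p = p \<cdot> ?f p" using ideal_pow_Suc[OF pid] by (simp add: e'_def)
    also have "(p \<cdot> ?f p) \<otimes>\<^bsub>ideals_set R\<^esub> m = p \<cdot> (?f p \<cdot> m)"
      using ideal_prod_assoc[OF pid ideal_pow_ideal[OF pid] split(2)] by (simp add: ideals_set_simps)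
    also have "\<dots> = q" using split q' by simp
    finally have "q = finprod (ideals_set R) ?f' {p. e' p \<noteq> 0}" using A' by simp
    moreover have "finite {p. e' p \<noteq> 0}" using A' fin by simp
    moreover have "primeideal P R" if "e' P \<noteq> 0" for P
      using that id pp by (cases "P = p") (auto simp: e'_def)
    ultimately have "is_prime_factorization R q e'" by (simp add: is_prime_factorization_def)
    then show ?thesis by blast
  qed
qed

text \<open>In a domain the zero ideal is itself prime, so it has to be ruled out as a factor: it
  would make the whole product zero.\<close>

lemma prime_factorization_zero_ideal:
  assumes e: "is_prime_factorization R q e" and q: "q \<noteq> {\<zero>}"
  shows "e {\<zero>} = 0"
proof (rule ccontr)
  assume "e {\<zero>} \<noteq> 0"
  then obtain k where k: "e {\<zero>} = Suc k" by (cases "e {\<zero>}") auto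
  have z: "{\<zero>} \<cdot> I = {\<zero>}" if "ideal I R" for I
    using ideal_prod_zero[OF that] ideal_prod_commute[OF that zeroideal] by simp
  have "{\<zero>} [^]\<^bsub>ideals_set R\<^esub> (e {\<zero>}) = {\<zero>}"
    unfolding k ideal_pow_Suc[OF zeroideal] by (rule z[OF ideal_pow_ideal[OF zeroideal]])
  then show False
    using prime_factorization_split[OF e zeroideal] z q by simp
qed

text \<open>Identifies the exponent as the largest power of \<open>p\<close> containing
  \<open>q\<close>. Cancelling the \<open>p\<close>-part from a containment in the next power would
  leave the complementary factor inside \<open>p\<close>; then \<open>p\<close> would contain a
  different nonzero prime, although such primes are maximal.\<close>

lemma prime_factorization_le:
  assumes e: "is_prime_factorization R q e" and q: "q \<noteq> {\<zero>}"
    and p: "primeideal p R" "p \<noteq> {\<zero>}"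
  shows "q \<subseteq> p [^]\<^bsub>ideals_set R\<^esub> e p" "\<not> q \<subseteq> p [^]\<^bsub>ideals_set R\<^esub> Suc (e p)"
proof -
  let ?pow = "\<lambda>k::nat. p [^]\<^bsub>ideals_set R\<^esub> k"
  have pid: "ideal p R" by (rule primeideal.axioms(1)[OF p(1)])
  define m where "m = finprod (ideals_set R) (\<lambda>p. p [^]\<^bsub>ideals_set R\<^esub> e p) ({p. e p \<noteq> 0} - {p})"
  have split: "q = ?pow (e p) \<cdot> m" and m: "ideal m R"
    unfolding m_def using prime_factorization_split[OF e pid] by auto
  have fin: "finite {p. e p \<noteq> 0}" and id: "\<And>p. e p \<noteq> 0 \<Longrightarrow> primeideal p R"
    using e by (auto simp: is_prime_factorization_def)
  show "q \<subseteq> ?pow (e p)"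
    using split ideal_prod_inter[OF ideal_pow_ideal[OF pid] m] by blast
  have nm: "\<not> m \<subseteq> p"
  proof
    assume "m \<subseteq> p"
    then have "\<exists>P\<in>{p. e p \<noteq> 0} - {p}. P \<subseteq> p"
      unfolding m_def using fin id primeideal.axioms(1)
      by (intro prime_contains_finprod[OF p(1)]) auto
    then obtain P where P: "e P \<noteq> 0" "P \<noteq> p" "P \<subseteq> p" by blast
    have "P \<noteq> {\<zero>}" using prime_factorization_zero_ideal[OF e q] P(1) by auto
    then show False
      using nonzero_prime_maximal[OF id[OF P(1)] _ pid P(3)] P(2) primeideal.I_notcarr[OF p(1)] by blast
  qed
  have cancel: "?pow k \<cdot> m \<subseteq> ?pow (k + j) \<Longrightarrow> m \<subseteq> ?pow j" for k j
  proof (induction k)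
    case 0
    interpret M: comm_monoid "ideals_set R" by (rule ideals_set_is_comm_monoid)
    have "?pow 0 \<cdot> m = m"
      using ideal_prod_one[OF m] ideal_prod_commute[OF m oneideal] by (simp add: ideals_set_simps)
    then show ?case using 0 by simp
  next
    case (Suc k)
    have "p \<cdot> (?pow k \<cdot> m) \<subseteq> p \<cdot> ?pow (k + j)"
      using Suc.prems ideal_prod_assoc[OF pid ideal_pow_ideal[OF pid] m]
      by (simp only: add_Suc ideal_pow_Suc[OF pid])
    then have "?pow k \<cdot> m \<subseteq> ?pow (k + j)"
      by (rule ideal_prod_prime_cancel[OF p ideal_prod_is_ideal[OF ideal_pow_ideal[OF pid] m] ideal_pow_ideal[OF pid]])
    then show ?case by (rule Suc.IH)
  qed
  interpret M: comm_monoid "ideals_set R" by (rule ideals_set_is_comm_monoid)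
  have "?pow 1 = p" using pid M.nat_pow_eone[of p] by (simp add: ideals_set_simps)
  then show "\<not> q \<subseteq> ?pow (Suc (e p))"
    using cancel[of "e p" 1] nm split by auto
qed

lemma ideal_pow_antimono:
  assumes "ideal p R" "j \<le> k"
  shows "p [^]\<^bsub>ideals_set R\<^esub> (k::nat) \<subseteq> p [^]\<^bsub>ideals_set R\<^esub> j"
proof -
  have "p [^]\<^bsub>ideals_set R\<^esub> (Suc n) \<subseteq> p [^]\<^bsub>ideals_set R\<^esub> (n::nat)" for n
    unfolding ideal_pow_Suc[OF assms(1)]
    using ideal_prod_inter[OF assms(1) ideal_pow_ideal[OF assms(1), of n]] by blast
  then show ?thesis by (rule lift_Suc_antimono_le[OF _ assms(2)])
qed

text \<open>The two bounds in \<open>prime_factorization_le\<close> pin down the exponent at each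
  nonzero prime, and everywhere else it is zero.\<close>

lemma is_prime_factorization_unique:
  assumes e: "is_prime_factorization R q e" "is_prime_factorization R q e'" and q: "q \<noteq> {\<zero>}"
  shows "e = e'"
proof
  fix p
  show "e p = e' p"
  proof (cases "primeideal p R \<and> p \<noteq> {\<zero>}")
    case False
    then show ?thesis
      using e prime_factorization_zero_ideal[OF e(1) q] prime_factorization_zero_ideal[OF e(2) q]
      unfolding is_prime_factorization_def by metis
  next
    case True
    then have p: "primeideal p R" "p \<noteq> {\<zero>}" by auto
    note anti = ideal_pow_antimono[OF primeideal.axioms(1)[OF p(1)]]
    have "\<not> Suc (e p) \<le> e' p"
      using prime_factorization_le[OF e(1) q p] prime_factorization_le[OF e(2) q p]
        anti[of "Suc (e p)" "e' p"] by blast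
    moreover have "\<not> Suc (e' p) \<le> e p"
      using prime_factorization_le[OF e(1) q p] prime_factorization_le[OF e(2) q p]
        anti[of "Suc (e' p)" "e p"] by blast
    ultimately show ?thesis by simp
  qed
qed

text \<open>Existence and uniqueness discharge the definite description in
  \<open>ideal_ord\<close>.\<close>

lemma is_prime_factorization_ideal_ord:
  assumes "ideal q R" "q \<noteq> {\<zero>}"
  shows "is_prime_factorization R q (\<lambda>p. ideal_ord R p q)"
proof -
  obtain e where e: "is_prime_factorization R q e"
    using is_prime_factorization_exists[OF assms] by blast
  then have "(THE e. is_prime_factorization R q e) = e"
    using is_prime_factorization_unique[OF _ _ assms(2)] by (intro the_equality) auto
  then have "(\<lambda>p. ideal_ord R p q) = e" by (simp add: ideal_ord_def)
  then show ?thesis using e by simp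
qed

text \<open>A prime above \<open>q\<close> contains one of the finitely many prime factors of
  \<open>q\<close>, and equals it because nonzero primes are maximal.\<close>

lemma finite_primes_above:
  assumes q: "ideal q R" "q \<noteq> {\<zero>}"
  shows "finite {p. primeideal p R \<and> q \<subseteq> p}"
proof -
  let ?e = "\<lambda>p. ideal_ord R p q"
  have e: "is_prime_factorization R q ?e" by (rule is_prime_factorization_ideal_ord[OF q])
  have fin: "finite {p. ?e p \<noteq> 0}" and id: "\<And>p. ?e p \<noteq> 0 \<Longrightarrow> primeideal p R"
    and fp: "q = finprod (ideals_set R) (\<lambda>p. p [^]\<^bsub>ideals_set R\<^esub> ?e p) {p. ?e p \<noteq> 0}"
    using e by (auto simp: is_prime_factorization_def)
  have "{p. primeideal p R \<and> q \<subseteq> p} \<subseteq> {p. ?e p \<noteq> 0}"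
  proof
    fix p assume "p \<in> {p. primeideal p R \<and> q \<subseteq> p}"
    then have p: "primeideal p R" "q \<subseteq> p" by auto
    have sub: "finprod (ideals_set R) (\<lambda>p. p [^]\<^bsub>ideals_set R\<^esub> ?e p) {p. ?e p \<noteq> 0} \<subseteq> p"
      using p(2) fp by simp
    have "ideal P R" if "P \<in> {p. ?e p \<noteq> 0}" for P
      using that id primeideal.axioms(1) by blast
    from prime_contains_finprod[OF p(1) fin this sub] obtain P where P: "?e P \<noteq> 0" "P \<subseteq> p" by blast
    have "P \<noteq> {\<zero>}" using prime_factorization_zero_ideal[OF e q(2)] P(1) by auto
    then have "p = P"
      using nonzero_prime_maximal[OF id[OF P(1)] _ primeideal.axioms(1)[OF p(1)] P(2)]
        primeideal.I_notcarr[OF p(1)] by blast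
    then show "p \<in> {p. ?e p \<noteq> 0}" using P(1) by simp
  qed
  then show ?thesis using fin by (rule finite_subset)
qed

text \<open>Recognizes the situation that part (ii) of Condition L forbids. If the exponent were at
  least two, \<open>q\<close> would lie in \<open>p \<cdot> p\<close>, and cancelling
  \<open>p\<close> from \<open>p \<cdot> PIdl z \<subseteq> p \<cdot> p\<close> would put
  \<open>z\<close> into \<open>p\<close>.\<close>

lemma ideal_ord_eq_1:
  assumes q: "ideal q R" "q \<noteq> {\<zero>}" and p: "primeideal p R" "q \<subseteq> p"
    and z: "z \<in> carrier R" "z \<notin> p" "\<And>t. t \<in> p \<Longrightarrow> t \<otimes> z \<in> q"
  shows "ideal_ord R p q = 1"
proof -
  have pid: "ideal p R" by (rule primeideal.axioms(1)[OF p(1)])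
  interpret p: ideal p R by (rule pid)
  interpret M: comm_monoid "ideals_set R" by (rule ideals_set_is_comm_monoid)
  have p0: "p \<noteq> {\<zero>}"
    using q p(2) additive_subgroup.zero_closed[OF ideal.axioms(1)[OF q(1)]] by blast
  let ?k = "ideal_ord R p q"
  have e: "is_prime_factorization R q (\<lambda>p. ideal_ord R p q)"
    by (rule is_prime_factorization_ideal_ord[OF q])
  note le = prime_factorization_le[OF e q(2) p(1) p0]
  have pow1: "p [^]\<^bsub>ideals_set R\<^esub> (1::nat) = p" using pid M.nat_pow_eone[of p] by (simp add: ideals_set_simps)
  have "?k \<noteq> 0" using le(2) p(2) pow1 by auto
  moreover have "\<not> 2 \<le> ?k"
  proof
    assume "2 \<le> ?k"
    then have "q \<subseteq> p [^]\<^bsub>ideals_set R\<^esub> Suc 1"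
      using le(1) ideal_pow_antimono[OF pid, of 2 ?k] by (simp add: numeral_2_eq_2)
    then have qpp: "q \<subseteq> p \<cdot> p" using ideal_pow_Suc[OF pid, of 1] pow1 by simp
    have Z: "ideal (PIdl z) R" by (rule cgenideal_ideal[OF z(1)])
    have "p \<cdot> (PIdl z) \<subseteq> q"
    proof
      fix y assume "y \<in> p \<cdot> (PIdl z)"
      then show "y \<in> q"
      proof (induction y rule: ideal_prod.induct)
        case (prod t w)
        then obtain r where r: "r \<in> carrier R" "w = r \<otimes> z" by (auto simp: cgenideal_def)
        have "t \<otimes> w = (t \<otimes> r) \<otimes> z" using r z(1) p.Icarr[OF prod(1)] by (simp add: m_assoc)
        then show ?case using z(3)[OF p.I_r_closed[OF prod(1) r(1)]] by simp
      next
        case (sum s1 s2)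
        then show ?case using additive_subgroup.a_closed[OF ideal.axioms(1)[OF q(1)]] by blast
      qed
    qed
    then have "PIdl z \<subseteq> p" using ideal_prod_prime_cancel[OF p(1) p0 Z pid] qpp by blast
    then show False using cgenideal_self[OF z(1)] z(2) by blast
  qed
  ultimately show ?thesis by simp
qed


subsection \<open>Units modulo an ideal\<close>

text \<open>If \<open>u\<close> and \<open>q\<close> did not generate the ring, a maximal ideal
  above both would be a prime over \<open>q\<close> containing \<open>u\<close>.\<close>

lemma unit_modulo_ideal:
  assumes q: "ideal q R" and u: "u \<in> carrier R"
    and np: "\<And>p. primeideal p R \<Longrightarrow> q \<subseteq> p \<Longrightarrow> u \<notin> p"
  shows "\<exists>v\<in>carrier R. \<one> \<ominus> u \<otimes> v \<in> q"
proof -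
  interpret q: ideal q R by (rule q)
  interpret U: ideal "PIdl u" R by (rule cgenideal_ideal[OF u])
  define J where "J = (PIdl u) <+>\<^bsub>R\<^esub> q"
  have J: "ideal J R" unfolding J_def by (intro add_ideals U.ideal_axioms q)
  have uJ: "u \<in> J"
  proof -
    have "u \<oplus> \<zero> \<in> J" using cgenideal_self[OF u] q.zero_closed unfolding J_def set_add_def' by blast
    then show ?thesis using u by simp
  qed
  have qJ: "q \<subseteq> J"
  proof
    fix t assume t: "t \<in> q"
    have "\<zero> \<oplus> t \<in> J" using t U.zero_closed unfolding J_def set_add_def' by blast
    then show "t \<in> J" using q.Icarr[OF t] by simp
  qed
  have "J = carrier R"
  proof (rule ccontr)
    assume ne: "J \<noteq> carrier R"
    obtain M where M: "maximalideal M R" "J \<subseteq> M" using maximalideal_above[OF J ne] .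
    have "q \<subseteq> M" "u \<in> M" using qJ uJ M(2) by auto
    then show False using np[OF maximalideal_prime[OF M(1)]] by simp
  qed
  then have "\<one> \<in> J" by simp
  then obtain w t where w: "w \<in> PIdl u" and t: "t \<in> q" and one: "\<one> = w \<oplus> t"
    unfolding J_def set_add_def' by auto
  obtain v where v: "v \<in> carrier R" "w = v \<otimes> u" using w unfolding cgenideal_def by blast
  have "(v \<otimes> u \<oplus> t) \<ominus> u \<otimes> v = t"
    using u v(1) q.Icarr[OF t] by algebra
  then have "\<one> \<ominus> u \<otimes> v = t" by (simp only: one[symmetric] v(2)[symmetric])
  then show ?thesis using v(1) t by blast
qed

section \<open>Chinese remaindering and stable range one\<close>

lemma prime_avoidance:
  assumes p0: "primeideal p0 R"
    and "finite P" "p0 \<notin> P" "\<And>p. p \<in> P \<Longrightarrow> primeideal p R \<and> p \<noteq> {\<zero>}"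
  shows "\<exists>e\<in>carrier R. e \<notin> p0 \<and> (\<forall>p\<in>P. e \<in> p)"
  using assms(2-)
proof (induction P rule: finite_induct)
  case empty
  interpret p0: primeideal p0 R by (rule p0)
  show ?case using p0.one_imp_carrier p0.I_notcarr by (intro bexI[of _ \<one>]) auto
next
  case (insert p P)
  interpret p0: primeideal p0 R by (rule p0)
  obtain e where e: "e \<in> carrier R" "e \<notin> p0" "\<And>P'. P' \<in> P \<Longrightarrow> e \<in> P'"
    using insert.IH insert.prems by blast
  have p: "primeideal p R" "p \<noteq> {\<zero>}" and "p \<noteq> p0" using insert.prems by auto
  interpret p: primeideal p R by (rule p(1))
  \<comment> \<open>A nonzero prime is maximal and so lies in no other prime. Each \<open>p\<close>
    thus contributes a factor outside \<open>p0\<close>, and the product of these factors lies in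
    every \<open>p\<close>.\<close>
  have "\<not> p \<subseteq> p0"
    using nonzero_prime_maximal[OF p p0.ideal_axioms] p0.I_notcarr \<open>p \<noteq> p0\<close> by auto
  then obtain f where f: "f \<in> p" "f \<notin> p0" by blast
  have fR: "f \<in> carrier R" by (rule p.Icarr[OF f(1)])
  have "e \<otimes> f \<notin> p0" using p0.I_prime[OF e(1) fR] e(2) f(2) by blast
  moreover have "e \<otimes> f \<in> P'" if "P' \<in> insert p P" for P'
  proof (cases "P' = p")
    case True
    then show ?thesis using p.I_l_closed[OF f(1) e(1)] by simp
  next
    case False
    then have P': "P' \<in> P" using that by simp
    then have "ideal P' R" using insert.prems(2)[of P'] primeideal.axioms(1) by auto
    then show ?thesis using ideal.I_r_closed[OF _ e(3)[OF P'] fR] by simp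
  qed
  ultimately show ?case using e(1) fR by (intro bexI[of _ "e \<otimes> f"]) auto
qed

lemma chinese_remainder_primes:
  assumes "finite P" "\<And>p. p \<in> P \<Longrightarrow> primeideal p R \<and> p \<noteq> {\<zero>}"
    and "\<And>p. p \<in> P \<Longrightarrow> f p \<in> carrier R"
  shows "\<exists>c\<in>carrier R. \<forall>p\<in>P. c \<ominus> f p \<in> p"
  using assms
proof (induction P rule: finite_induct)
  case empty
  then show ?case by auto
next
  case (insert p0 P)
  have "\<exists>c\<in>carrier R. \<forall>p\<in>P. c \<ominus> f p \<in> p" by (rule insert.IH) (use insert.prems in auto)
  then obtain c where c: "c \<in> carrier R" "\<And>p. p \<in> P \<Longrightarrow> c \<ominus> f p \<in> p" by blast
  have p0: "primeideal p0 R" "p0 \<noteq> {\<zero>}" and f0: "f p0 \<in> carrier R" using insert.prems by auto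
  interpret p0: primeideal p0 R by (rule p0(1))
  obtain e where e: "e \<in> carrier R" "e \<notin> p0" "\<And>p. p \<in> P \<Longrightarrow> e \<in> p"
    using prime_avoidance[OF p0(1) insert.hyps] insert.prems(1) by auto
  obtain y m where ym: "y \<in> carrier R" "m \<in> p0" "e \<otimes> y \<oplus> m = \<one>"
    using inverse_mod_prime[OF p0 e(1,2)] .
  have mR: "m \<in> carrier R" by (rule p0.Icarr[OF ym(2)])
  \<comment> \<open>The correction term lies in every older prime because \<open>e\<close> does;
    modulo \<open>p0\<close> it is \<open>f p0 \<ominus> c\<close>, since
    \<open>e \<otimes> y\<close> is congruent to one there.\<close>
  define c' where "c' = c \<oplus> e \<otimes> (y \<otimes> (f p0 \<ominus> c))"
  have c'R: "c' \<in> carrier R" using c(1) e(1) ym(1) f0 by (simp add: c'_def)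
  moreover have "c' \<ominus> f p \<in> p" if "p \<in> insert p0 P" for p
  proof (cases "p = p0")
    case True
    \<comment> \<open>This form is a polynomial identity valid for any \<open>m\<close>; only
      afterwards is \<open>e \<otimes> y \<oplus> m\<close> replaced by one.\<close>
    have "c' \<ominus> f p0 = (c \<ominus> f p0) \<otimes> ((e \<otimes> y \<oplus> m) \<ominus> e \<otimes> y) \<oplus> (c \<ominus> f p0) \<otimes> (\<one> \<ominus> (e \<otimes> y \<oplus> m))"
      unfolding c'_def using c(1) e(1) ym(1) f0 mR by algebra
    also have "\<dots> = (c \<ominus> f p0) \<otimes> m"
      unfolding ym(3) using c(1) f0 e(1) mR ym(1) ym(3)[symmetric] by algebra
    also have "\<dots> \<in> p0" using p0.I_l_closed[OF ym(2)] c(1) f0 by simp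
    finally show ?thesis using True by simp
  next
    case False
    then have p: "p \<in> P" using that by simp
    then have "ideal p R" "f p \<in> carrier R" using insert.prems primeideal.axioms(1) by auto
    then interpret p: ideal p R by simp
    have "c' \<ominus> f p = (c \<ominus> f p) \<oplus> e \<otimes> (y \<otimes> (f p0 \<ominus> c))"
      unfolding c'_def using c(1) e(1) ym(1) f0 \<open>f p \<in> carrier R\<close> by algebra
    also have "\<dots> \<in> p"
      using c(2)[OF p] p.I_r_closed[OF e(3)[OF p]] ym(1) f0 c(1) by simp
    finally show ?thesis .
  qed
  ultimately show ?case by blast
qed

lemma nonzero_of_supset: "q \<noteq> {\<zero>} \<Longrightarrow> ideal q R \<Longrightarrow> q \<subseteq> p \<Longrightarrow> p \<noteq> {\<zero>}"
  using additive_subgroup.zero_closed[OF ideal.axioms(1)] by blast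

text \<open>Choose \<open>t\<close> congruent to one at the primes over \<open>q\<close> that
  contain \<open>a\<close>, and to zero at the others. At the former \<open>b\<close> is a unit
  because \<open>a\<close> and \<open>b\<close> are coprime, so
  \<open>a \<oplus> b \<otimes> t\<close> avoids all primes over \<open>q\<close>.\<close>

lemma stable_range_modulo_ideal:
  assumes q: "ideal q R" "q \<noteq> {\<zero>}" and ab: "a \<in> carrier R" "b \<in> carrier R"
    and rs: "r \<in> carrier R" "s \<in> carrier R" "a \<otimes> r \<oplus> b \<otimes> s = \<one>"
  shows "\<exists>t\<in>carrier R. \<exists>v\<in>carrier R. \<one> \<ominus> (a \<oplus> b \<otimes> t) \<otimes> v \<in> q"
proof -
  define P where "P = {p. primeideal p R \<and> q \<subseteq> p}"
  have "\<exists>c\<in>carrier R. \<forall>p\<in>P. c \<ominus> (if a \<in> p then \<one> else \<zero>) \<in> p"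
    using finite_primes_above[OF q] nonzero_of_supset[OF q(2,1)]
    by (intro chinese_remainder_primes) (auto simp: P_def)
  then obtain t where t: "t \<in> carrier R" "\<And>p. p \<in> P \<Longrightarrow> t \<ominus> (if a \<in> p then \<one> else \<zero>) \<in> p"
    by blast
  have "\<exists>v\<in>carrier R. \<one> \<ominus> (a \<oplus> b \<otimes> t) \<otimes> v \<in> q"
  proof (rule unit_modulo_ideal[OF q(1)])
    show "a \<oplus> b \<otimes> t \<in> carrier R" using ab t(1) by simp
    fix p assume p: "primeideal p R" "q \<subseteq> p"
    interpret p: primeideal p R by (rule p(1))
    have tp: "t \<ominus> (if a \<in> p then \<one> else \<zero>) \<in> p" using t(2)[of p] p by (simp add: P_def)
    have one: "\<one> \<notin> p" using p.one_imp_carrier p.I_notcarr by blast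
    show "a \<oplus> b \<otimes> t \<notin> p"
    proof
      assume u: "a \<oplus> b \<otimes> t \<in> p"
      show False
      proof (cases "a \<in> p")
        case True
        have "b \<otimes> t \<oplus> a \<in> p" using u ab t(1) by (simp add: a_comm)
        then have "b \<otimes> t \<in> p" by (rule p.mem_of_sum) (use True ab t(1) in auto)
        then have "b \<in> p \<or> t \<in> p" using p.I_prime[OF ab(2) t(1)] by simp
        then show False
        proof
          assume "b \<in> p"
          then have "a \<otimes> r \<oplus> b \<otimes> s \<in> p"
            using p.I_r_closed[OF True rs(1)] p.I_r_closed[OF _ rs(2)] by simp
          then show False using rs(3) one by simp
        next
          assume "t \<in> p"
          then have "t \<ominus> (t \<ominus> \<one>) \<in> p" using tp True p.minus_mem by simp
          moreover have "t \<ominus> (t \<ominus> \<one>) = \<one>" using t(1) by algebra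
          ultimately show False using one by simp
        qed
      next
        case False
        then have "t \<in> p" using tp t(1) by (simp add: a_minus_def)
        then have "a \<in> p" using p.mem_of_sum[OF u p.I_l_closed[OF _ ab(2)] ab(1)] by simp
        then show False using False by simp
      qed
    qed
  qed
  then show ?thesis using t(1) by blast
qed

end


section \<open>Normal subgroups of $SL_2$\<close>

definition lower_transvection :: "('a, 'm) ring_scheme \<Rightarrow> 'a \<Rightarrow> 'a mat2" where
  "lower_transvection R r = Mat2 \<one>\<^bsub>R\<^esub> \<zero>\<^bsub>R\<^esub> r \<one>\<^bsub>R\<^esub>"

section \<open>Conjugates and products of elementary matrices\<close>

context cring
begin

lemma lower_transvection_in_SL2: "r \<in> carrier R \<Longrightarrow> lower_transvection R r \<in> carrier (SL2 R)"
  by (simp add: lower_transvection_def SL2_carrier_iff a_minus_def)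

lemma lower_transvection_mult:
  "r \<in> carrier R \<Longrightarrow> s \<in> carrier R \<Longrightarrow>
     lower_transvection R r \<otimes>\<^bsub>SL2 R\<^esub> lower_transvection R s = lower_transvection R (r \<oplus> s)"
  by (simp add: lower_transvection_def SL2_mult)

lemma SL2_inv:
  assumes M: "Mat2 a b c d \<in> carrier (SL2 R)"
  shows "inv\<^bsub>SL2 R\<^esub> Mat2 a b c d = Mat2 d (\<ominus> b) (\<ominus> c) a"
proof -
  interpret S: group "SL2 R" by (rule SL2_group)
  have car: "a \<in> carrier R" "b \<in> carrier R" "c \<in> carrier R" "d \<in> carrier R"
    and det: "a \<otimes> d \<ominus> b \<otimes> c = \<one>" using M by (auto simp: SL2_carrier_iff)
  have "d \<otimes> a \<ominus> (\<ominus> b) \<otimes> (\<ominus> c) = a \<otimes> d \<ominus> b \<otimes> c" "d \<otimes> a \<oplus> (\<ominus> b) \<otimes> c = a \<otimes> d \<ominus> b \<otimes> c"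
    "d \<otimes> b \<oplus> (\<ominus> b) \<otimes> d = \<zero>" "(\<ominus> c) \<otimes> a \<oplus> a \<otimes> c = \<zero>" "(\<ominus> c) \<otimes> b \<oplus> a \<otimes> d = a \<otimes> d \<ominus> b \<otimes> c"
    using car by algebra+
  then have "Mat2 d (\<ominus> b) (\<ominus> c) a \<in> carrier (SL2 R)"
    "Mat2 d (\<ominus> b) (\<ominus> c) a \<otimes>\<^bsub>SL2 R\<^esub> Mat2 a b c d = \<one>\<^bsub>SL2 R\<^esub>"
    using car det by (simp_all add: SL2_carrier_iff SL2_mult SL2_one)
  then show ?thesis using M by (intro S.inv_equality)
qed

text \<open>The quotient of the two matrices is congruent to the identity modulo \<open>q\<close>,
  hence lies in \<open>N\<close>.\<close>

lemma subgroup_congruent_mem: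
  assumes N: "subgroup N (SL2 R)" and q: "ideal q R" "principal_congruence_subgroup R q \<subseteq> N"
    and M: "Mat2 a b c d \<in> N" and M': "Mat2 a' b' c' d' \<in> carrier (SL2 R)"
    and cong: "a' \<ominus> a \<in> q" "b' \<ominus> b \<in> q" "c' \<ominus> c \<in> q" "d' \<ominus> d \<in> q"
  shows "Mat2 a' b' c' d' \<in> N"
proof -
  interpret S: group "SL2 R" by (rule SL2_group)
  interpret q: ideal q R by (rule q(1))
  have MS: "Mat2 a b c d \<in> carrier (SL2 R)" using subgroup.subset[OF N] M by auto
  have car: "a \<in> carrier R" "b \<in> carrier R" "c \<in> carrier R" "d \<in> carrier R"
    and det: "a \<otimes> d \<ominus> b \<otimes> c = \<one>" using MS by (auto simp: SL2_carrier_iff)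
  have car': "a' \<in> carrier R" "b' \<in> carrier R" "c' \<in> carrier R" "d' \<in> carrier R"
    using M' by (auto simp: SL2_carrier_iff)
  let ?Y = "inv\<^bsub>SL2 R\<^esub> Mat2 a b c d \<otimes>\<^bsub>SL2 R\<^esub> Mat2 a' b' c' d'"
  have Y: "?Y = Mat2 (d \<otimes> a' \<oplus> (\<ominus> b) \<otimes> c') (d \<otimes> b' \<oplus> (\<ominus> b) \<otimes> d')
      ((\<ominus> c) \<otimes> a' \<oplus> a \<otimes> c') ((\<ominus> c) \<otimes> b' \<oplus> a \<otimes> d')"
    by (simp add: SL2_inv[OF MS] SL2_mult)
  \<comment> \<open>On the diagonal the determinant is subtracted instead of one, which makes these
    polynomial identities.\<close>
  have "d \<otimes> a' \<oplus> (\<ominus> b) \<otimes> c' \<ominus> (a \<otimes> d \<ominus> b \<otimes> c) = d \<otimes> (a' \<ominus> a) \<ominus> b \<otimes> (c' \<ominus> c)"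
    "d \<otimes> b' \<oplus> (\<ominus> b) \<otimes> d' = d \<otimes> (b' \<ominus> b) \<ominus> b \<otimes> (d' \<ominus> d)"
    "(\<ominus> c) \<otimes> a' \<oplus> a \<otimes> c' = a \<otimes> (c' \<ominus> c) \<ominus> c \<otimes> (a' \<ominus> a)"
    "(\<ominus> c) \<otimes> b' \<oplus> a \<otimes> d' \<ominus> (a \<otimes> d \<ominus> b \<otimes> c) = a \<otimes> (d' \<ominus> d) \<ominus> c \<otimes> (b' \<ominus> b)"
    using car car' by algebra+
  then have "e11 ?Y \<ominus> \<one> \<in> q" "e12 ?Y \<in> q" "e21 ?Y \<in> q" "e22 ?Y \<ominus> \<one> \<in> q"
    unfolding Y det using cong car by (simp_all add: q.minus_mem q.I_l_closed)
  moreover have "?Y \<in> carrier (SL2 R)" using MS M' by simp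
  ultimately have "?Y \<in> N" using q(2) by (auto simp: principal_congruence_subgroup_def)
  then have "Mat2 a b c d \<otimes>\<^bsub>SL2 R\<^esub> ?Y \<in> N" using subgroup.m_closed[OF N M] by simp
  then show ?thesis using MS M' by (simp add: S.m_assoc[symmetric])
qed

text \<open>The conjugate of T(x) by g is I + x v w, where the column v = (a, c) is the first column
  of g and w is the row (-c, a).\<close>

lemma normal_conj_transvection:
  assumes N: "N \<lhd> SL2 R" and x: "transvection R x \<in> N" "x \<in> carrier R"
    and g: "Mat2 a b c d \<in> carrier (SL2 R)"
  shows "Mat2 (\<one> \<ominus> x \<otimes> a \<otimes> c) (x \<otimes> a \<otimes> a) (\<ominus> (x \<otimes> c \<otimes> c)) (\<one> \<oplus> x \<otimes> a \<otimes> c) \<in> N"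
proof -
  have car: "a \<in> carrier R" "b \<in> carrier R" "c \<in> carrier R" "d \<in> carrier R"
    and det: "a \<otimes> d \<ominus> b \<otimes> c = \<one>" using g by (auto simp: SL2_carrier_iff)
  have eqs: "(a \<otimes> \<one> \<oplus> b \<otimes> \<zero>) \<otimes> d \<oplus> (a \<otimes> x \<oplus> b \<otimes> \<one>) \<otimes> (\<ominus> c) = (a \<otimes> d \<ominus> b \<otimes> c) \<ominus> x \<otimes> a \<otimes> c"
    "(a \<otimes> \<one> \<oplus> b \<otimes> \<zero>) \<otimes> (\<ominus> b) \<oplus> (a \<otimes> x \<oplus> b \<otimes> \<one>) \<otimes> a = x \<otimes> a \<otimes> a"
    "(c \<otimes> \<one> \<oplus> d \<otimes> \<zero>) \<otimes> d \<oplus> (c \<otimes> x \<oplus> d \<otimes> \<one>) \<otimes> (\<ominus> c) = \<ominus> (x \<otimes> c \<otimes> c)"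
    "(c \<otimes> \<one> \<oplus> d \<otimes> \<zero>) \<otimes> (\<ominus> b) \<oplus> (c \<otimes> x \<oplus> d \<otimes> \<one>) \<otimes> a = (a \<otimes> d \<ominus> b \<otimes> c) \<oplus> x \<otimes> a \<otimes> c"
    using car x(2) by algebra+
  have "Mat2 a b c d \<otimes>\<^bsub>SL2 R\<^esub> transvection R x \<otimes>\<^bsub>SL2 R\<^esub> inv\<^bsub>SL2 R\<^esub> Mat2 a b c d \<in> N"
    by (rule normal.inv_op_closed2[OF N g x(1)])
  then show ?thesis
    unfolding SL2_inv[OF g] transvection_def SL2_mult eqs det .
qed

text \<open>Conjugation by the Weyl element with rows (0, -1) and (1, 0) exchanges upper and lower
  transvections up to sign.\<close>

lemma normal_transvection_swap:
  assumes N: "N \<lhd> SL2 R" and r: "r \<in> carrier R"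
  shows "transvection R r \<in> N \<Longrightarrow> lower_transvection R (\<ominus> r) \<in> N"
    and "lower_transvection R r \<in> N \<Longrightarrow> transvection R (\<ominus> r) \<in> N"
proof -
  have W: "Mat2 \<zero> (\<ominus> \<one>) \<one> \<zero> \<in> carrier (SL2 R)"
    by (simp add: SL2_carrier_iff a_minus_def)
  show "transvection R r \<in> N \<Longrightarrow> lower_transvection R (\<ominus> r) \<in> N"
    using normal_conj_transvection[OF N _ r W] r by (simp add: lower_transvection_def a_minus_def)
  assume "lower_transvection R r \<in> N"
  then have "Mat2 \<zero> (\<ominus> \<one>) \<one> \<zero> \<otimes>\<^bsub>SL2 R\<^esub> lower_transvection R r \<otimes>\<^bsub>SL2 R\<^esub> inv\<^bsub>SL2 R\<^esub> Mat2 \<zero> (\<ominus> \<one>) \<one> \<zero> \<in> N"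
    by (rule normal.inv_op_closed2[OF N W])
  then show "transvection R (\<ominus> r) \<in> N"
    unfolding SL2_inv[OF W] lower_transvection_def transvection_def SL2_mult
    using r by (simp add: l_minus r_minus)
qed

text \<open>Whitehead's matrix, congruent to \<open>diag(u, v)\<close> modulo \<open>1 - u v\<close>.\<close>

lemma whitehead_matrix:
  assumes u: "u \<in> carrier R" and v: "v \<in> carrier R" and m: "m = \<one> \<ominus> u \<otimes> v"
  shows "Mat2 (u \<otimes> (\<one> \<oplus> m)) (\<ominus> m) m v \<in> carrier (SL2 R)"
    and "Mat2 (u \<otimes> (\<one> \<oplus> m)) (\<ominus> m) m v =
      transvection R u \<otimes>\<^bsub>SL2 R\<^esub> lower_transvection R (\<ominus> v) \<otimes>\<^bsub>SL2 R\<^esub> transvection R u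
        \<otimes>\<^bsub>SL2 R\<^esub> Mat2 \<zero> (\<ominus> \<one>) \<one> \<zero>"
proof -
  have mR: "m \<in> carrier R" using u v m by simp
  have "u \<otimes> (\<one> \<oplus> (\<one> \<ominus> u \<otimes> v)) \<otimes> v \<ominus> (\<ominus> (\<one> \<ominus> u \<otimes> v)) \<otimes> (\<one> \<ominus> u \<otimes> v) = \<one>"
    using u v by algebra
  then show "Mat2 (u \<otimes> (\<one> \<oplus> m)) (\<ominus> m) m v \<in> carrier (SL2 R)"
    using u v mR by (simp add: SL2_carrier_iff m[symmetric])
  \<comment> \<open>The right-hand sides are the entries of the fourfold product exactly as
    \<open>SL2_mult\<close> produces them.\<close>
  have "u \<otimes> (\<one> \<oplus> (\<one> \<ominus> u \<otimes> v)) =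
      ((\<one> \<otimes> \<one> \<oplus> u \<otimes> \<ominus> v) \<otimes> \<one> \<oplus> (\<one> \<otimes> \<zero> \<oplus> u \<otimes> \<one>) \<otimes> \<zero>) \<otimes> \<zero> \<oplus>
      ((\<one> \<otimes> \<one> \<oplus> u \<otimes> \<ominus> v) \<otimes> u \<oplus> (\<one> \<otimes> \<zero> \<oplus> u \<otimes> \<one>) \<otimes> \<one>) \<otimes> \<one>"
    "\<ominus> (\<one> \<ominus> u \<otimes> v) =
      ((\<one> \<otimes> \<one> \<oplus> u \<otimes> \<ominus> v) \<otimes> \<one> \<oplus> (\<one> \<otimes> \<zero> \<oplus> u \<otimes> \<one>) \<otimes> \<zero>) \<otimes> (\<ominus> \<one>) \<oplus>
      ((\<one> \<otimes> \<one> \<oplus> u \<otimes> \<ominus> v) \<otimes> u \<oplus> (\<one> \<otimes> \<zero> \<oplus> u \<otimes> \<one>) \<otimes> \<one>) \<otimes> \<zero>"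
    "\<one> \<ominus> u \<otimes> v =
      ((\<zero> \<otimes> \<one> \<oplus> \<one> \<otimes> \<ominus> v) \<otimes> \<one> \<oplus> (\<zero> \<otimes> \<zero> \<oplus> \<one> \<otimes> \<one>) \<otimes> \<zero>) \<otimes> \<zero> \<oplus>
      ((\<zero> \<otimes> \<one> \<oplus> \<one> \<otimes> \<ominus> v) \<otimes> u \<oplus> (\<zero> \<otimes> \<zero> \<oplus> \<one> \<otimes> \<one>) \<otimes> \<one>) \<otimes> \<one>"
    "v =
      ((\<zero> \<otimes> \<one> \<oplus> \<one> \<otimes> \<ominus> v) \<otimes> \<one> \<oplus> (\<zero> \<otimes> \<zero> \<oplus> \<one> \<otimes> \<one>) \<otimes> \<zero>) \<otimes> (\<ominus> \<one>) \<oplus>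
      ((\<zero> \<otimes> \<one> \<oplus> \<one> \<otimes> \<ominus> v) \<otimes> u \<oplus> (\<zero> \<otimes> \<zero> \<oplus> \<one> \<otimes> \<one>) \<otimes> \<one>) \<otimes> \<zero>"
    using u v by algebra+
  then show "Mat2 (u \<otimes> (\<one> \<oplus> m)) (\<ominus> m) m v =
      transvection R u \<otimes>\<^bsub>SL2 R\<^esub> lower_transvection R (\<ominus> v) \<otimes>\<^bsub>SL2 R\<^esub> transvection R u
        \<otimes>\<^bsub>SL2 R\<^esub> Mat2 \<zero> (\<ominus> \<one>) \<one> \<zero>"
    unfolding transvection_def lower_transvection_def SL2_mult m mat2.inject by (intro conjI)
qed

text \<open>Modulo \<open>q\<close> Whitehead's matrix is diag(u, v), and conjugating T(x) by
  diag(u, v) with u v = 1 gives T(u^2 x).\<close>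

lemma normal_square_mult:
  assumes N: "N \<lhd> SL2 R" and q: "ideal q R" "principal_congruence_subgroup R q \<subseteq> N"
    and x: "transvection R x \<in> N" "x \<in> carrier R"
    and uv: "u \<in> carrier R" "v \<in> carrier R" "\<one> \<ominus> u \<otimes> v \<in> q"
  shows "transvection R (u \<otimes> u \<otimes> x) \<in> N"
proof -
  interpret q: ideal q R by (rule q(1))
  define m where "m = \<one> \<ominus> u \<otimes> v"
  define a where "a = u \<otimes> (\<one> \<oplus> m)"
  have m: "m \<in> q" using uv by (simp add: m_def)
  have mR: "m \<in> carrier R" by (rule q.Icarr[OF m])
  have aR: "a \<in> carrier R" using uv mR by (simp add: a_def)
  have g: "Mat2 a (\<ominus> m) m v \<in> carrier (SL2 R)"
    unfolding a_def by (rule whitehead_matrix[OF uv(1,2) m_def])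
  have M: "Mat2 (\<one> \<ominus> x \<otimes> a \<otimes> m) (x \<otimes> a \<otimes> a) (\<ominus> (x \<otimes> m \<otimes> m)) (\<one> \<oplus> x \<otimes> a \<otimes> m) \<in> N"
    by (rule normal_conj_transvection[OF N x g])
  have T: "Mat2 \<one> (u \<otimes> u \<otimes> x) \<zero> \<one> \<in> carrier (SL2 R)"
    using transvection_in_SL2[of "u \<otimes> u \<otimes> x"] uv x(2) by (simp add: transvection_def)
  have "\<one> \<ominus> (\<one> \<ominus> x \<otimes> a \<otimes> m) = (x \<otimes> a) \<otimes> m"
    "\<zero> \<ominus> (\<ominus> (x \<otimes> m \<otimes> m)) = (x \<otimes> m) \<otimes> m"
    "\<one> \<ominus> (\<one> \<oplus> x \<otimes> a \<otimes> m) = (\<ominus> (x \<otimes> a)) \<otimes> m"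
    using aR mR x(2) by algebra+
  moreover have "u \<otimes> u \<otimes> x \<ominus> x \<otimes> a \<otimes> a = (\<ominus> (x \<otimes> u \<otimes> u \<otimes> (\<one> \<oplus> \<one> \<oplus> m))) \<otimes> m"
    unfolding a_def using uv(1,2) mR x(2) by algebra
  ultimately have "Mat2 \<one> (u \<otimes> u \<otimes> x) \<zero> \<one> \<in> N"
    using uv(1) aR mR x(2)
    by (intro subgroup_congruent_mem[OF normal_imp_subgroup[OF N] q M T])
      (simp_all add: q.I_l_closed[OF m])
  then show ?thesis by (simp add: transvection_def)
qed

text \<open>The commutator of \<open>T(x)\<close> with a lower transvection is computed twice, for \<open>y\<close> and \<open>- y\<close>,
  so that the diagonal parts cancel modulo \<open>x\<^sup>2 y\<close>.\<close>

lemma normal_socle_transvection: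
  assumes N: "N \<lhd> SL2 R" and q: "ideal q R" "principal_congruence_subgroup R q \<subseteq> N"
    and x: "transvection R x \<in> N" "x \<in> carrier R" and y: "y \<in> carrier R"
    and s: "x \<otimes> x \<otimes> y \<in> q"
  shows "transvection R (x \<otimes> y \<otimes> y \<oplus> x \<otimes> y \<otimes> y) \<in> N"
proof -
  interpret q: ideal q R by (rule q(1))
  interpret S: group "SL2 R" by (rule SL2_group)
  interpret N: normal N "SL2 R" by (rule N)
  have T: "transvection R (\<ominus> x) \<in> N"
    using N.m_inv_closed[OF x(1)] x(2) by (simp add: transvection_inv)
  \<comment> \<open>The commutator of the lower transvection by \<open>c\<close> with T(x).\<close>
  have A: "Mat2 (\<one> \<ominus> x \<otimes> \<one> \<otimes> c) (x \<otimes> \<one> \<otimes> \<one>) (\<ominus> (x \<otimes> c \<otimes> c)) (\<one> \<oplus> x \<otimes> \<one> \<otimes> c)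
      \<otimes>\<^bsub>SL2 R\<^esub> transvection R (\<ominus> x) \<in> N" if c: "c \<in> carrier R" for c
  proof -
    have "Mat2 \<one> \<zero> c \<one> \<in> carrier (SL2 R)"
      using lower_transvection_in_SL2[OF c] by (simp add: lower_transvection_def)
    from N.m_closed[OF normal_conj_transvection[OF N x this] T] show ?thesis .
  qed
  have A': "Mat2 (\<one> \<ominus> x \<otimes> c) (x \<otimes> x \<otimes> c) (\<ominus> (x \<otimes> c \<otimes> c)) (\<one> \<oplus> x \<otimes> c \<oplus> x \<otimes> x \<otimes> c \<otimes> c) \<in> N"
    if c: "c \<in> carrier R" for c
  proof -
    have "(\<one> \<ominus> x \<otimes> \<one> \<otimes> c) \<otimes> \<one> \<oplus> (x \<otimes> \<one> \<otimes> \<one>) \<otimes> \<zero> = \<one> \<ominus> x \<otimes> c"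
      "(\<one> \<ominus> x \<otimes> \<one> \<otimes> c) \<otimes> (\<ominus> x) \<oplus> (x \<otimes> \<one> \<otimes> \<one>) \<otimes> \<one> = x \<otimes> x \<otimes> c"
      "(\<ominus> (x \<otimes> c \<otimes> c)) \<otimes> \<one> \<oplus> (\<one> \<oplus> x \<otimes> \<one> \<otimes> c) \<otimes> \<zero> = \<ominus> (x \<otimes> c \<otimes> c)"
      "(\<ominus> (x \<otimes> c \<otimes> c)) \<otimes> (\<ominus> x) \<oplus> (\<one> \<oplus> x \<otimes> \<one> \<otimes> c) \<otimes> \<one> = \<one> \<oplus> x \<otimes> c \<oplus> x \<otimes> x \<otimes> c \<otimes> c"
      using x(2) c by algebra+
    then show ?thesis using A[OF c] unfolding transvection_def SL2_mult by simp
  qed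
  define P where "P = x \<otimes> y"
  define s where "s = x \<otimes> x \<otimes> y"
  define Q where "Q = x \<otimes> x \<otimes> y \<otimes> y"
  define k where "k = x \<otimes> y \<otimes> y"
  have PR: "P \<in> carrier R" and sR: "s \<in> carrier R" and QR: "Q \<in> carrier R" and kR: "k \<in> carrier R"
    using x(2) y by (simp_all add: P_def s_def Q_def k_def)
  have sq: "s \<in> q" using s by (simp add: s_def)
  have "Q = y \<otimes> s" "P \<otimes> P = y \<otimes> s" "k \<otimes> P = (y \<otimes> y) \<otimes> s"
    unfolding P_def s_def Q_def k_def using x(2) y by algebra+
  then have mem: "Q \<in> q" "P \<otimes> P \<in> q" "k \<otimes> P \<in> q"
    using q.I_l_closed[OF sq] y by simp_all
  \<comment> \<open>Passing from \<open>y\<close> to \<open>\<ominus> y\<close> changes the sign of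
    \<open>P\<close> and \<open>s\<close> but not of \<open>Q\<close> and \<open>k\<close>. In the
    product of the two commutators the terms linear in \<open>P\<close> therefore cancel on the
    diagonal, while the lower left entries add up to -2 k modulo \<open>q\<close>.\<close>
  have "\<one> \<ominus> x \<otimes> (\<ominus> y) = \<one> \<oplus> P" "x \<otimes> x \<otimes> (\<ominus> y) = \<ominus> s" "x \<otimes> (\<ominus> y) \<otimes> (\<ominus> y) = k"
    "\<one> \<oplus> x \<otimes> (\<ominus> y) \<oplus> x \<otimes> x \<otimes> (\<ominus> y) \<otimes> (\<ominus> y) = \<one> \<ominus> P \<oplus> Q"
    unfolding P_def s_def Q_def k_def using x(2) y by algebra+
  then have A2: "Mat2 (\<one> \<oplus> P) (\<ominus> s) (\<ominus> k) (\<one> \<ominus> P \<oplus> Q) \<in> N"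
    using A'[of "\<ominus> y"] y by simp
  have A1: "Mat2 (\<one> \<ominus> P) s (\<ominus> k) (\<one> \<oplus> P \<oplus> Q) \<in> N"
    using A'[OF y] by (simp add: P_def s_def Q_def k_def)
  define a where "a = (\<one> \<ominus> P) \<otimes> (\<one> \<oplus> P) \<oplus> s \<otimes> (\<ominus> k)"
  define b where "b = (\<one> \<ominus> P) \<otimes> (\<ominus> s) \<oplus> s \<otimes> (\<one> \<ominus> P \<oplus> Q)"
  define c where "c = (\<ominus> k) \<otimes> (\<one> \<oplus> P) \<oplus> (\<one> \<oplus> P \<oplus> Q) \<otimes> (\<ominus> k)"
  define d where "d = (\<ominus> k) \<otimes> (\<ominus> s) \<oplus> (\<one> \<oplus> P \<oplus> Q) \<otimes> (\<one> \<ominus> P \<oplus> Q)"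
  have M: "Mat2 a b c d \<in> N"
    using N.m_closed[OF A1 A2] unfolding SL2_mult a_def b_def c_def d_def by simp
  let ?w = "k \<oplus> k"
  have "\<one> \<ominus> a = P \<otimes> P \<oplus> k \<otimes> s" unfolding a_def using PR sR kR by algebra
  then have a: "\<one> \<ominus> a \<in> q" using mem q.I_l_closed[OF sq kR] by simp
  have "\<zero> \<ominus> b = (\<ominus> Q) \<otimes> s" unfolding b_def using PR sR QR by algebra
  then have b: "\<zero> \<ominus> b \<in> q" using q.I_l_closed[OF sq] QR by simp
  have "\<ominus> ?w \<ominus> c = k \<otimes> P \<oplus> k \<otimes> P \<oplus> k \<otimes> Q" unfolding c_def using PR QR kR by algebra
  then have c: "\<ominus> ?w \<ominus> c \<in> q" using mem q.I_l_closed[OF mem(1) kR] by simp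
  have "\<one> \<ominus> d = P \<otimes> P \<oplus> (\<ominus> k) \<otimes> s \<oplus> (\<ominus> (\<one> \<oplus> \<one> \<oplus> Q)) \<otimes> Q"
    unfolding d_def using PR sR QR kR by algebra
  then have d: "\<one> \<ominus> d \<in> q"
    using mem q.I_l_closed[OF sq, of "\<ominus> k"] q.I_l_closed[OF mem(1), of "\<ominus> (\<one> \<oplus> \<one> \<oplus> Q)"] QR kR by simp
  have wR: "?w \<in> carrier R" using kR by simp
  have "Mat2 \<one> \<zero> (\<ominus> ?w) \<one> \<in> carrier (SL2 R)"
    using lower_transvection_in_SL2[of "\<ominus> ?w"] wR by (simp add: lower_transvection_def)
  then have "Mat2 \<one> \<zero> (\<ominus> ?w) \<one> \<in> N"
    by (rule subgroup_congruent_mem[OF normal_imp_subgroup[OF N] q M _ a b c d])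
  then show ?thesis
    using normal_transvection_swap(2)[OF N, of "\<ominus> ?w"] wR
    by (simp add: lower_transvection_def k_def)
qed

end

section \<open>Principal congruence subgroups inside normal subgroups\<close>

lemma (in cring) principal_congruence_subgroup_conj:
  assumes q: "ideal q R" and M: "M \<in> principal_congruence_subgroup R q"
    and g: "g \<in> carrier (SL2 R)"
  shows "g \<otimes>\<^bsub>SL2 R\<^esub> M \<otimes>\<^bsub>SL2 R\<^esub> inv\<^bsub>SL2 R\<^esub> g \<in> principal_congruence_subgroup R q"
proof -
  interpret S: group "SL2 R" by (rule SL2_group)
  interpret q: ideal q R by (rule q)
  obtain a b c d where g': "g = Mat2 a b c d" by (cases g)
  obtain p r s t where M': "M = Mat2 p r s t" by (cases M)
  have MS: "M \<in> carrier (SL2 R)" using M by (simp add: principal_congruence_subgroup_def)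
  have car: "a \<in> carrier R" "b \<in> carrier R" "c \<in> carrier R" "d \<in> carrier R"
    and det: "a \<otimes> d \<ominus> b \<otimes> c = \<one>" using g by (auto simp: g' SL2_carrier_iff)
  have carM: "p \<in> carrier R" "r \<in> carrier R" "s \<in> carrier R" "t \<in> carrier R"
    using MS by (auto simp: M' SL2_carrier_iff)
  have mem: "p \<ominus> \<one> \<in> q" "r \<in> q" "s \<in> q" "t \<ominus> \<one> \<in> q"
    using M unfolding M' principal_congruence_subgroup_def by simp_all
  let ?Y = "g \<otimes>\<^bsub>SL2 R\<^esub> M \<otimes>\<^bsub>SL2 R\<^esub> inv\<^bsub>SL2 R\<^esub> g"
  have Y: "?Y = Mat2 ((a \<otimes> p \<oplus> b \<otimes> s) \<otimes> d \<oplus> (a \<otimes> r \<oplus> b \<otimes> t) \<otimes> (\<ominus> c))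
      ((a \<otimes> p \<oplus> b \<otimes> s) \<otimes> (\<ominus> b) \<oplus> (a \<otimes> r \<oplus> b \<otimes> t) \<otimes> a)
      ((c \<otimes> p \<oplus> d \<otimes> s) \<otimes> d \<oplus> (c \<otimes> r \<oplus> d \<otimes> t) \<otimes> (\<ominus> c))
      ((c \<otimes> p \<oplus> d \<otimes> s) \<otimes> (\<ominus> b) \<oplus> (c \<otimes> r \<oplus> d \<otimes> t) \<otimes> a)"
    using g unfolding g' M' by (simp add: SL2_inv SL2_mult)
  \<comment> \<open>The entries of g M g^{-1} - I as linear combinations of the entries of M - I,
    again with the determinant in place of one.\<close>
  have e: "(a \<otimes> p \<oplus> b \<otimes> s) \<otimes> d \<oplus> (a \<otimes> r \<oplus> b \<otimes> t) \<otimes> (\<ominus> c) \<ominus> (a \<otimes> d \<ominus> b \<otimes> c) =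
      (a \<otimes> d) \<otimes> (p \<ominus> \<one>) \<oplus> (b \<otimes> d) \<otimes> s \<oplus> (\<ominus> (a \<otimes> c)) \<otimes> r \<oplus> (\<ominus> (b \<otimes> c)) \<otimes> (t \<ominus> \<one>)"
    "(a \<otimes> p \<oplus> b \<otimes> s) \<otimes> (\<ominus> b) \<oplus> (a \<otimes> r \<oplus> b \<otimes> t) \<otimes> a =
      (\<ominus> (a \<otimes> b)) \<otimes> (p \<ominus> \<one>) \<oplus> (\<ominus> (b \<otimes> b)) \<otimes> s \<oplus> (a \<otimes> a) \<otimes> r \<oplus> (a \<otimes> b) \<otimes> (t \<ominus> \<one>)"
    "(c \<otimes> p \<oplus> d \<otimes> s) \<otimes> d \<oplus> (c \<otimes> r \<oplus> d \<otimes> t) \<otimes> (\<ominus> c) =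
      (c \<otimes> d) \<otimes> (p \<ominus> \<one>) \<oplus> (d \<otimes> d) \<otimes> s \<oplus> (\<ominus> (c \<otimes> c)) \<otimes> r \<oplus> (\<ominus> (c \<otimes> d)) \<otimes> (t \<ominus> \<one>)"
    "(c \<otimes> p \<oplus> d \<otimes> s) \<otimes> (\<ominus> b) \<oplus> (c \<otimes> r \<oplus> d \<otimes> t) \<otimes> a \<ominus> (a \<otimes> d \<ominus> b \<otimes> c) =
      (\<ominus> (b \<otimes> c)) \<otimes> (p \<ominus> \<one>) \<oplus> (\<ominus> (b \<otimes> d)) \<otimes> s \<oplus> (a \<otimes> c) \<otimes> r \<oplus> (a \<otimes> d) \<otimes> (t \<ominus> \<one>)"
    using car carM by algebra+
  have lin: "x1 \<otimes> (p \<ominus> \<one>) \<oplus> x2 \<otimes> s \<oplus> x3 \<otimes> r \<oplus> x4 \<otimes> (t \<ominus> \<one>) \<in> q"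
    if "x1 \<in> carrier R" "x2 \<in> carrier R" "x3 \<in> carrier R" "x4 \<in> carrier R" for x1 x2 x3 x4
    using that mem by (simp add: q.I_l_closed)
  have "e11 ?Y \<ominus> \<one> \<in> q" "e12 ?Y \<in> q" "e21 ?Y \<in> q" "e22 ?Y \<ominus> \<one> \<in> q"
    unfolding Y mat2.sel using e[unfolded det] lin car by simp_all
  moreover have "?Y \<in> carrier (SL2 R)" using g MS by simp
  ultimately show ?thesis by (simp add: principal_congruence_subgroup_def)
qed

text \<open>Transvections with parameters in \<open>q\<close> lie in \<open>N\<close> and bring
  \<open>M\<close> to the shape diag(u, v) modulo \<open>q'\<close>. This is Whitehead's matrix
  modulo \<open>q'\<close>, and that matrix lies in \<open>N\<close> because \<open>u\<close> and
  \<open>v\<close> are congruent to one modulo \<open>q\<close>.\<close>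

lemma (in dedekind_domain) normal_contains_congruence_subgroup:
  assumes N: "N \<lhd> SL2 R"
    and q': "ideal q' R" "q' \<noteq> {\<zero>}" "principal_congruence_subgroup R q' \<subseteq> N"
    and q: "ideal q R" "q' \<subseteq> q" "\<And>r. r \<in> q \<Longrightarrow> transvection R r \<in> N"
  shows "principal_congruence_subgroup R q \<subseteq> N"
proof
  fix M assume "M \<in> principal_congruence_subgroup R q"
  then obtain a b c d where M: "M = Mat2 a b c d" "Mat2 a b c d \<in> carrier (SL2 R)"
    and ab: "a \<ominus> \<one> \<in> q" "b \<in> q" and cd: "c \<in> q" "d \<ominus> \<one> \<in> q"
    by (cases M) (auto simp: principal_congruence_subgroup_def)
  interpret S: group "SL2 R" by (rule SL2_group)
  interpret N: normal N "SL2 R" by (rule N)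
  interpret q: ideal q R by (rule q(1))
  interpret q': ideal q' R by (rule q'(1))
  have car: "a \<in> carrier R" "b \<in> carrier R" "c \<in> carrier R" "d \<in> carrier R"
    and det: "a \<otimes> d \<ominus> b \<otimes> c = \<one>" using M(2) by (auto simp: SL2_carrier_iff)
  have L: "lower_transvection R r \<in> N" if "r \<in> q" for r
    using normal_transvection_swap(1)[OF N, of "\<ominus> r"] q(3)[of "\<ominus> r"] that q.Icarr[OF that] q.a_inv_closed
    by simp
  \<comment> \<open>The square of the determinant shows that the pair (a, b^2) is unimodular. Using
    it instead of (a, b) gives a unit a + b (b t) modulo \<open>q'\<close>, so the lower
    transvection that produces it has its parameter \<open>b \<otimes> t\<close> in
    \<open>q\<close>.\<close>
  have "a \<otimes> (a \<otimes> d \<otimes> d \<ominus> (b \<otimes> c \<otimes> d \<oplus> b \<otimes> c \<otimes> d)) \<oplus> (b \<otimes> b) \<otimes> (c \<otimes> c) =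
      (a \<otimes> d \<ominus> b \<otimes> c) \<otimes> (a \<otimes> d \<ominus> b \<otimes> c)" using car by algebra
  then have "a \<otimes> (a \<otimes> d \<otimes> d \<ominus> (b \<otimes> c \<otimes> d \<oplus> b \<otimes> c \<otimes> d)) \<oplus> (b \<otimes> b) \<otimes> (c \<otimes> c) = \<one>"
    unfolding det by simp
  from stable_range_modulo_ideal[OF q'(1,2) car(1) _ _ _ this]
  obtain t v where t: "t \<in> carrier R" and v: "v \<in> carrier R" and m': "\<one> \<ominus> (a \<oplus> b \<otimes> b \<otimes> t) \<otimes> v \<in> q'"
    using car by auto
  define u where "u = a \<oplus> b \<otimes> (b \<otimes> t)"
  define m where "m = \<one> \<ominus> u \<otimes> v"
  define c' where "c' = c \<oplus> d \<otimes> (b \<otimes> t)"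
  have uR: "u \<in> carrier R" and c'R: "c' \<in> carrier R" using car t by (simp_all add: u_def c'_def)
  have m: "m \<in> q'" using m' car t by (simp add: m_def u_def m_assoc)
  have mR: "m \<in> carrier R" by (rule q'.Icarr[OF m])
  have bt: "b \<otimes> t \<in> q" by (rule q.I_r_closed[OF ab(2) t])
  have c'q: "c' \<in> q" unfolding c'_def using cd(1) q.I_l_closed[OF bt car(4)] by simp
  have u1: "u \<ominus> \<one> \<in> q"
  proof -
    have "u \<ominus> \<one> = (a \<ominus> \<one>) \<oplus> b \<otimes> (b \<otimes> t)" unfolding u_def using car t by algebra
    then show ?thesis using ab q.I_l_closed[OF bt car(2)] by simp
  qed
  have v1: "\<one> \<ominus> v \<in> q"
  proof -
    have "\<one> \<ominus> v = m \<oplus> (u \<ominus> \<one>) \<otimes> v" unfolding m_def using uR v by algebra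
    then show ?thesis using m q(2) u1 v by (auto intro: q.I_r_closed)
  qed
  have W: "Mat2 \<zero> (\<ominus> \<one>) \<one> \<zero> \<in> carrier (SL2 R)"
    by (simp add: SL2_carrier_iff a_minus_def)
  have coset: "N #>\<^bsub>SL2 R\<^esub> (h \<otimes>\<^bsub>SL2 R\<^esub> g) = N #>\<^bsub>SL2 R\<^esub> g"
    if "h \<in> N" "g \<in> carrier (SL2 R)" for g h
  proof -
    have "h \<in> carrier (SL2 R)" using that(1) N.subset by auto
    then have "N #>\<^bsub>SL2 R\<^esub> (h \<otimes>\<^bsub>SL2 R\<^esub> g) = (N #>\<^bsub>SL2 R\<^esub> h) #>\<^bsub>SL2 R\<^esub> g"
      using S.coset_mult_assoc[OF N.subset] that(2) by simp
    then show ?thesis using N.rcos_const[OF SL2_group that(1)] by simp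
  qed
  have "transvection R (u \<ominus> \<one>) \<otimes>\<^bsub>SL2 R\<^esub> transvection R \<one> = transvection R u"
  proof -
    have "u \<ominus> \<one> \<oplus> \<one> = u" using uR by algebra
    then show ?thesis using uR by (simp add: transvection_mult)
  qed
  then have cT: "N #>\<^bsub>SL2 R\<^esub> transvection R u = N #>\<^bsub>SL2 R\<^esub> transvection R \<one>"
    using coset[OF q(3)[OF u1] transvection_in_SL2[OF one_closed]] by simp
  have "lower_transvection R (\<one> \<ominus> v) \<otimes>\<^bsub>SL2 R\<^esub> lower_transvection R (\<ominus> \<one>) = lower_transvection R (\<ominus> v)"
  proof -
    have "\<one> \<ominus> v \<oplus> \<ominus> \<one> = \<ominus> v" using v by algebra
    then show ?thesis using v by (simp add: lower_transvection_mult)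
  qed
  then have cL: "N #>\<^bsub>SL2 R\<^esub> lower_transvection R (\<ominus> v) = N #>\<^bsub>SL2 R\<^esub> lower_transvection R (\<ominus> \<one>)"
    using coset[OF L[OF v1] lower_transvection_in_SL2, of "\<ominus> \<one>"] by simp
  let ?G = "Mat2 (u \<otimes> (\<one> \<oplus> m)) (\<ominus> m) m v"
  have car_T: "transvection R u \<in> carrier (SL2 R)" "transvection R \<one> \<in> carrier (SL2 R)"
    "lower_transvection R (\<ominus> v) \<in> carrier (SL2 R)" "lower_transvection R (\<ominus> \<one>) \<in> carrier (SL2 R)"
    using uR v by (simp_all add: transvection_in_SL2 lower_transvection_in_SL2)
  \<comment> \<open>Modulo \<open>N\<close> the factors T(u) and L(-v) of Whitehead's product, L
    denoting lower transvections, may be replaced by T(1) and L(-1); the product is then the one for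
    u = v = 1, the identity.\<close>
  have "N #>\<^bsub>SL2 R\<^esub> ?G = N #>\<^bsub>SL2 R\<^esub> (transvection R \<one> \<otimes>\<^bsub>SL2 R\<^esub> lower_transvection R (\<ominus> \<one>)
      \<otimes>\<^bsub>SL2 R\<^esub> transvection R \<one> \<otimes>\<^bsub>SL2 R\<^esub> Mat2 \<zero> (\<ominus> \<one>) \<one> \<zero>)"
    unfolding whitehead_matrix(2)[OF uR v m_def]
    using car_T W cT cL by (simp add: N.rcos_sum[symmetric])
  also have "transvection R \<one> \<otimes>\<^bsub>SL2 R\<^esub> lower_transvection R (\<ominus> \<one>)
      \<otimes>\<^bsub>SL2 R\<^esub> transvection R \<one> \<otimes>\<^bsub>SL2 R\<^esub> Mat2 \<zero> (\<ominus> \<one>) \<one> \<zero> = \<one>\<^bsub>SL2 R\<^esub>"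
    using whitehead_matrix(2)[OF one_closed one_closed, of \<zero>]
    by (simp add: SL2_one a_minus_def r_neg)
  finally have "N #>\<^bsub>SL2 R\<^esub> ?G = N #>\<^bsub>SL2 R\<^esub> \<one>\<^bsub>SL2 R\<^esub>" .
  then have GN: "?G \<in> N"
    using S.rcos_self[OF whitehead_matrix(1)[OF uR v m_def] N.subgroup_axioms]
      S.coset_mult_one[OF N.subset] by simp
  let ?L = "lower_transvection R (\<ominus> (c' \<otimes> v))"
  let ?L' = "lower_transvection R (b \<otimes> t)"
  let ?T = "transvection R (\<ominus> (v \<otimes> b))"
  have tN: "?L \<in> N" "?L' \<in> N" "?T \<in> N"
    using L[OF q.a_inv_closed[OF q.I_r_closed[OF c'q v]]] L[OF bt]
      q(3)[OF q.a_inv_closed[OF q.I_l_closed[OF ab(2) v]]] by auto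
  have tS: "?L \<in> carrier (SL2 R)" "?L' \<in> carrier (SL2 R)" "?T \<in> carrier (SL2 R)"
    using tN N.subset by auto
  define d2 where "d2 = d \<ominus> c' \<otimes> v \<otimes> b \<otimes> (\<one> \<oplus> m)"
  have d2R: "d2 \<in> carrier R" using car c'R v mR by (simp add: d2_def)
  have M1: "M \<otimes>\<^bsub>SL2 R\<^esub> ?L' = Mat2 u b c' d"
    unfolding M(1) lower_transvection_def SL2_mult u_def c'_def using car t by simp
  have "u \<otimes> (\<ominus> (v \<otimes> b)) \<oplus> b = b \<otimes> m" unfolding m_def using uR v car by algebra
  then have M2: "M \<otimes>\<^bsub>SL2 R\<^esub> ?L' \<otimes>\<^bsub>SL2 R\<^esub> ?T = Mat2 u (b \<otimes> m) c' (c' \<otimes> (\<ominus> (v \<otimes> b)) \<oplus> d)"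
    unfolding M1 transvection_def SL2_mult using car uR c'R v by simp
  have "\<ominus> (c' \<otimes> v) \<otimes> u \<oplus> c' = c' \<otimes> m" unfolding m_def using uR v c'R by algebra
  moreover have "\<ominus> (c' \<otimes> v) \<otimes> (b \<otimes> m) \<oplus> (c' \<otimes> (\<ominus> (v \<otimes> b)) \<oplus> d) = d2"
    unfolding d2_def using car c'R v mR by algebra
  ultimately have "?L \<otimes>\<^bsub>SL2 R\<^esub> Mat2 u (b \<otimes> m) c' (c' \<otimes> (\<ominus> (v \<otimes> b)) \<oplus> d) = Mat2 u (b \<otimes> m) (c' \<otimes> m) d2"
    unfolding lower_transvection_def SL2_mult using car uR c'R v mR by simp
  then have M3: "?L \<otimes>\<^bsub>SL2 R\<^esub> (M \<otimes>\<^bsub>SL2 R\<^esub> ?L' \<otimes>\<^bsub>SL2 R\<^esub> ?T) = Mat2 u (b \<otimes> m) (c' \<otimes> m) d2"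
    by (simp only: M2)
  have M3S: "Mat2 u (b \<otimes> m) (c' \<otimes> m) d2 \<in> carrier (SL2 R)"
    using M tS unfolding M3[symmetric] by simp
  then have det3: "u \<otimes> d2 \<ominus> (b \<otimes> m) \<otimes> (c' \<otimes> m) = \<one>" by (simp add: SL2_carrier_iff)
  \<comment> \<open>Both \<open>v\<close> and \<open>d2\<close> invert \<open>u\<close> modulo
    \<open>m\<close>: the first by definition of \<open>m\<close>, the second by the determinant of
    the reduced matrix, whose off-diagonal entries are multiples of \<open>m\<close>. So they are
    congruent modulo \<open>m\<close>.\<close>
  have "d2 \<ominus> v = (\<one> \<ominus> u \<otimes> v) \<otimes> d2 \<oplus> v \<otimes> (u \<otimes> d2 \<ominus> \<one>)" using uR v d2R by algebra
  also have "u \<otimes> d2 \<ominus> \<one> = (b \<otimes> m) \<otimes> (c' \<otimes> m)"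
    unfolding det3[symmetric] using uR d2R car mR c'R by algebra
  also have "(\<one> \<ominus> u \<otimes> v) \<otimes> d2 \<oplus> v \<otimes> ((b \<otimes> m) \<otimes> (c' \<otimes> m)) = (d2 \<oplus> v \<otimes> b \<otimes> m \<otimes> c') \<otimes> m"
    unfolding m_def[symmetric] using d2R v car mR c'R by algebra
  finally have "d2 \<ominus> v = (d2 \<oplus> v \<otimes> b \<otimes> m \<otimes> c') \<otimes> m" .
  moreover have "u \<ominus> u \<otimes> (\<one> \<oplus> m) = (\<ominus> u) \<otimes> m" "b \<otimes> m \<ominus> (\<ominus> m) = (b \<oplus> \<one>) \<otimes> m"
    "c' \<otimes> m \<ominus> m = (c' \<ominus> \<one>) \<otimes> m" using uR car mR c'R by algebra+
  ultimately have "Mat2 u (b \<otimes> m) (c' \<otimes> m) d2 \<in> N"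
    using uR car d2R v c'R mR
    by (intro subgroup_congruent_mem[OF N.subgroup_axioms q'(1,3) GN M3S])
      (simp_all add: q'.I_l_closed[OF m])
  then have "?L \<otimes>\<^bsub>SL2 R\<^esub> (M \<otimes>\<^bsub>SL2 R\<^esub> ?L' \<otimes>\<^bsub>SL2 R\<^esub> ?T) \<in> N" by (simp add: M3)
  \<comment> \<open>The three auxiliary transvections lie in \<open>N\<close> and are stripped off
    one by one.\<close>
  then have "inv\<^bsub>SL2 R\<^esub> ?L \<otimes>\<^bsub>SL2 R\<^esub> (?L \<otimes>\<^bsub>SL2 R\<^esub> (M \<otimes>\<^bsub>SL2 R\<^esub> ?L' \<otimes>\<^bsub>SL2 R\<^esub> ?T)) \<in> N"
    using N.m_closed[OF N.m_inv_closed[OF tN(1)]] by simp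
  then have "M \<otimes>\<^bsub>SL2 R\<^esub> ?L' \<otimes>\<^bsub>SL2 R\<^esub> ?T \<in> N"
    using M tS by (simp add: S.m_assoc[symmetric])
  then have "M \<otimes>\<^bsub>SL2 R\<^esub> ?L' \<otimes>\<^bsub>SL2 R\<^esub> ?T \<otimes>\<^bsub>SL2 R\<^esub> inv\<^bsub>SL2 R\<^esub> ?T \<in> N"
    using N.m_closed[OF _ N.m_inv_closed[OF tN(3)]] by simp
  then have "M \<otimes>\<^bsub>SL2 R\<^esub> ?L' \<in> N"
    using M tS by (simp add: S.m_assoc)
  then have "M \<otimes>\<^bsub>SL2 R\<^esub> ?L' \<otimes>\<^bsub>SL2 R\<^esub> inv\<^bsub>SL2 R\<^esub> ?L' \<in> N"
    using N.m_closed[OF _ N.m_inv_closed[OF tN(2)]] by simp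
  then show "M \<in> N"
    using M tS by (simp add: S.m_assoc)
qed


section \<open>Transvections in a normal congruence subgroup\<close>

context cring
begin

text \<open>As 2 is outside \<open>p\<close>, the classes of 0, 1 and -1 are distinct, so three
  elements means that there are no other classes.\<close>

lemma card_residue_field_eq_3:
  assumes p: "primeideal p R" and two: "\<one> \<oplus> \<one> \<notin> p"
  shows "card (carrier (R Quot p)) = 3 \<longleftrightarrow>
    (\<forall>d\<in>carrier R. d \<in> p \<or> d \<ominus> \<one> \<in> p \<or> d \<oplus> \<one> \<in> p)"
proof -
  interpret p: primeideal p R by (rule p)
  let ?Q = "carrier (R Quot p)"
  have Q: "?Q = {p +> d | d. d \<in> carrier R}" by (auto simp: FactRing_def A_RCOSETS_def')
  have eq: "p +> a = p +> b \<longleftrightarrow> a \<ominus> b \<in> p" if "a \<in> carrier R" "b \<in> carrier R" for a b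
    using quotient_eq_iff_same_a_r_cos[OF p.ideal_axioms that] by simp
  have one: "\<one> \<notin> p" using p.one_imp_carrier p.I_notcarr by blast
  let ?C = "{p +> \<zero>, p +> \<one>, p +> (\<ominus> \<one>)}"
  have "\<zero> \<ominus> \<one> \<notin> p" "\<zero> \<ominus> \<ominus> \<one> \<notin> p" "\<one> \<ominus> \<ominus> \<one> \<notin> p"
    using one two p.a_inv_closed[of "\<ominus> \<one>"] by (auto simp: a_minus_def)
  then have C: "card ?C = 3" using eq[of \<zero> \<one>] eq[of \<zero> "\<ominus> \<one>"] eq[of \<one> "\<ominus> \<one>"] by simp
  have CQ: "?C \<subseteq> ?Q" unfolding Q using one_closed zero_closed a_inv_closed by blast
  have in_C: "p +> d \<in> ?C \<longleftrightarrow> d \<in> p \<or> d \<ominus> \<one> \<in> p \<or> d \<oplus> \<one> \<in> p" if "d \<in> carrier R" for d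
    using that eq[of d \<zero>] eq[of d \<one>] eq[of d "\<ominus> \<one>"] by (simp add: a_minus_def)
  show ?thesis
  proof
    assume Q3: "card ?Q = 3"
    \<comment> \<open>An infinite set has \<open>card\<close> equal to zero, so the value three
      includes finiteness.\<close>
    then have "finite ?Q" by (metis card.infinite zero_neq_numeral)
    then have "?C = ?Q" using card_subset_eq[OF _ CQ] C Q3 by simp
    then have "p +> d \<in> ?C" if "d \<in> carrier R" for d
      using that unfolding Q by blast
    then show "\<forall>d\<in>carrier R. d \<in> p \<or> d \<ominus> \<one> \<in> p \<or> d \<oplus> \<one> \<in> p"
      using in_C by simp
  next
    assume "\<forall>d\<in>carrier R. d \<in> p \<or> d \<ominus> \<one> \<in> p \<or> d \<oplus> \<one> \<in> p"
    then have "p +> d \<in> ?C" if "d \<in> carrier R" for d using in_C[OF that] that by simp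
    then have "?Q \<subseteq> ?C" unfolding Q by blast
    then have "?Q = ?C" using CQ by blast
    then show "card ?Q = 3" using C by simp
  qed
qed

text \<open>A residue field of odd characteristic with more than three elements has at least five, so
  four residue classes can be avoided.\<close>

lemma residue_field_avoid:
  assumes p: "primeideal p R" and two: "\<one> \<oplus> \<one> \<notin> p" and card: "card (carrier (R Quot p)) \<noteq> 3"
    and b: "b \<in> carrier R"
  shows "\<exists>d\<in>carrier R. d \<ominus> \<one> \<notin> p \<and> d \<oplus> \<one> \<notin> p \<and> b \<oplus> d \<ominus> \<one> \<notin> p \<and> b \<oplus> d \<oplus> \<one> \<notin> p"
proof (rule ccontr)
  interpret p: primeideal p R by (rule p)
  assume "\<not> ?thesis"
  then have cover: "d \<ominus> \<one> \<in> p \<or> d \<oplus> \<one> \<in> p \<or> b \<oplus> d \<ominus> \<one> \<in> p \<or> b \<oplus> d \<oplus> \<one> \<in> p"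
    if "d \<in> carrier R" for d using that by blast
  have one: "\<one> \<notin> p" using p.one_imp_carrier p.I_notcarr by blast
  have mone: "\<ominus> x \<in> p \<longleftrightarrow> x \<in> p" if "x \<in> carrier R" for x
    using that p.a_inv_closed[of x] p.a_inv_closed[of "\<ominus> x"] by auto
  have four: "(\<one> \<oplus> \<one>) \<otimes> (\<one> \<oplus> \<one>) \<notin> p" using two p.I_prime[of "\<one> \<oplus> \<one>" "\<one> \<oplus> \<one>"] by auto
  have no3: "\<not> (\<forall>d\<in>carrier R. d \<in> p \<or> d \<ominus> \<one> \<in> p \<or> d \<oplus> \<one> \<in> p)"
    using card card_residue_field_eq_3[OF p two] by simp
  \<comment> \<open>Zero is neither 1 nor -1 modulo \<open>p\<close>, so the covering at
    \<open>d = 0\<close> forces \<open>b\<close> to be one of them.\<close>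
  have "b \<ominus> \<one> \<in> p \<or> b \<oplus> \<one> \<in> p"
    using cover[of \<zero>] one mone[of \<one>] b by (simp add: a_minus_def)
  then show False
  proof
    assume b1: "b \<ominus> \<one> \<in> p"
    \<comment> \<open>With \<open>b\<close> congruent to 1 the covering classes are 0, 1, -1 and -2.
      The class of 2 can only be that of -1, that is, 3 vanishes; then -2 is 1 and the field
      consists of 0, 1 and -1.\<close>
    have cov: "d \<ominus> \<one> \<in> p \<or> d \<oplus> \<one> \<in> p \<or> d \<in> p \<or> d \<oplus> (\<one> \<oplus> \<one>) \<in> p" if d: "d \<in> carrier R" for d
    proof -
      have "b \<oplus> d \<ominus> \<one> \<ominus> (b \<ominus> \<one>) = d" "b \<oplus> d \<oplus> \<one> \<ominus> (b \<ominus> \<one>) = d \<oplus> (\<one> \<oplus> \<one>)"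
        using b d by algebra+
      then show ?thesis
        using cover[OF d] p.minus_mem[OF _ b1, of "b \<oplus> d \<ominus> \<one>"] p.minus_mem[OF _ b1, of "b \<oplus> d \<oplus> \<one>"]
        by metis
    qed
    have "(\<one> \<oplus> \<one>) \<ominus> \<one> = \<one>" by (simp add: a_minus_def a_assoc r_neg)
    moreover have "(\<one> \<oplus> \<one>) \<oplus> (\<one> \<oplus> \<one>) = (\<one> \<oplus> \<one>) \<otimes> (\<one> \<oplus> \<one>)" by (simp add: l_distr)
    ultimately have three: "\<one> \<oplus> \<one> \<oplus> \<one> \<in> p" using cov[of "\<one> \<oplus> \<one>"] one two four by auto
    have "d \<in> p \<or> d \<ominus> \<one> \<in> p \<or> d \<oplus> \<one> \<in> p" if d: "d \<in> carrier R" for d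
    proof -
      have "d \<oplus> (\<one> \<oplus> \<one>) \<ominus> (\<one> \<oplus> \<one> \<oplus> \<one>) = d \<ominus> \<one>" using d by algebra
      then show ?thesis using cov[OF d] p.minus_mem[OF _ three, of "d \<oplus> (\<one> \<oplus> \<one>)"] by metis
    qed
    then show False using no3 by blast
  next
    assume b1: "b \<oplus> \<one> \<in> p"
    \<comment> \<open>The mirror image: the covering classes are 0, 1, -1 and 2, and the class of -2
      is tested.\<close>
    have cov: "d \<ominus> \<one> \<in> p \<or> d \<oplus> \<one> \<in> p \<or> d \<in> p \<or> d \<ominus> (\<one> \<oplus> \<one>) \<in> p" if d: "d \<in> carrier R" for d
    proof -
      have "b \<oplus> d \<oplus> \<one> \<ominus> (b \<oplus> \<one>) = d" "b \<oplus> d \<ominus> \<one> \<ominus> (b \<oplus> \<one>) = d \<ominus> (\<one> \<oplus> \<one>)"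
        using b d by algebra+
      then show ?thesis
        using cover[OF d] p.minus_mem[OF _ b1, of "b \<oplus> d \<ominus> \<one>"] p.minus_mem[OF _ b1, of "b \<oplus> d \<oplus> \<one>"]
        by metis
    qed
    have "\<ominus> (\<one> \<oplus> \<one>) \<oplus> \<one> = \<ominus> \<one>" by (simp add: minus_add a_assoc l_neg)
    moreover have "\<ominus> (\<one> \<oplus> \<one>) \<ominus> (\<one> \<oplus> \<one>) = \<ominus> ((\<one> \<oplus> \<one>) \<otimes> (\<one> \<oplus> \<one>))"
      by (simp add: l_distr a_minus_def minus_add)
    moreover have "\<ominus> (\<one> \<oplus> \<one>) \<ominus> \<one> = \<ominus> (\<one> \<oplus> \<one> \<oplus> \<one>)"
      by (simp add: a_minus_def minus_add)
    ultimately have three: "\<one> \<oplus> \<one> \<oplus> \<one> \<in> p"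
      using cov[of "\<ominus> (\<one> \<oplus> \<one>)"] one two four mone[of \<one>] mone[of "\<one> \<oplus> \<one>"]
        mone[of "(\<one> \<oplus> \<one>) \<otimes> (\<one> \<oplus> \<one>)"] mone[of "\<one> \<oplus> \<one> \<oplus> \<one>"] by auto
    have "d \<in> p \<or> d \<ominus> \<one> \<in> p \<or> d \<oplus> \<one> \<in> p" if d: "d \<in> carrier R" for d
    proof -
      have "d \<ominus> (\<one> \<oplus> \<one>) \<oplus> (\<one> \<oplus> \<one> \<oplus> \<one>) = d \<oplus> \<one>" using d by algebra
      then show ?thesis using cov[OF d] p.a_closed[OF _ three, of "d \<ominus> (\<one> \<oplus> \<one>)"] by metis
    qed
    then show False using no3 by blast
  qed
qed

end

section \<open>From squares of units to the level\<close>

context dedekind_domain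
begin

text \<open>Chinese remaindering writes \<open>b\<close> as a difference \<open>(b + d) - d\<close> where \<open>b + d \<plusminus> 1\<close> and \<open>d \<plusminus> 1\<close>
  are units modulo \<open>q\<close>, and \<open>4 c = (c + 1)\<^sup>2 - (c - 1)\<^sup>2\<close>.\<close>

lemma norm_3_multiplier:
  assumes q: "ideal q R" "q \<noteq> {\<zero>}"
    and two: "h \<in> carrier R" "\<one> \<ominus> (\<one> \<oplus> \<one>) \<otimes> h \<in> q"
    and B: "B \<subseteq> carrier R" "q \<subseteq> B"
      "\<And>a b. a \<in> B \<Longrightarrow> b \<in> B \<Longrightarrow> a \<oplus> b \<in> B"
      "\<And>a b. a \<in> B \<Longrightarrow> b \<in> B \<Longrightarrow> a \<ominus> b \<in> B"
      "\<And>a b. a \<in> B \<Longrightarrow> b \<in> B \<Longrightarrow> a \<otimes> b \<in> B"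
      "\<And>u v. u \<in> carrier R \<Longrightarrow> v \<in> carrier R \<Longrightarrow> \<one> \<ominus> u \<otimes> v \<in> q \<Longrightarrow> u \<otimes> u \<in> B"
    and b: "b \<in> carrier R"
      "\<And>p. primeideal p R \<Longrightarrow> q \<subseteq> p \<Longrightarrow> card (carrier (R Quot p)) = 3 \<Longrightarrow> b \<in> p"
  shows "b \<in> B"
proof -
  interpret q: ideal q R by (rule q(1))
  have good: "c \<in> B" if c: "c \<in> carrier R"
    and u: "\<And>p. primeideal p R \<Longrightarrow> q \<subseteq> p \<Longrightarrow> c \<oplus> \<one> \<notin> p \<and> c \<ominus> \<one> \<notin> p" for c
  proof -
    have "\<exists>v\<in>carrier R. \<one> \<ominus> (c \<oplus> \<one>) \<otimes> v \<in> q" "\<exists>v\<in>carrier R. \<one> \<ominus> (c \<ominus> \<one>) \<otimes> v \<in> q"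
      by (rule unit_modulo_ideal[OF q(1)]; use c u in simp)+
    then have sq: "(c \<oplus> \<one>) \<otimes> (c \<oplus> \<one>) \<in> B" "(c \<ominus> \<one>) \<otimes> (c \<ominus> \<one>) \<in> B"
      using B(6)[of "c \<oplus> \<one>"] B(6)[of "c \<ominus> \<one>"] c by auto
    \<comment> \<open>\<open>h\<close> inverts 2 modulo \<open>q\<close>, so it is a unit there and
      its square, which stands for 1/4, belongs to \<open>B\<close>.\<close>
    have "\<one> \<ominus> h \<otimes> (\<one> \<oplus> \<one>) \<in> q" using two m_comm[of h "\<one> \<oplus> \<one>"] by simp
    then have hh: "h \<otimes> h \<in> B" using B(6)[of h "\<one> \<oplus> \<one>"] two(1) by simp
    let ?e = "h \<otimes> h \<otimes> ((c \<oplus> \<one>) \<otimes> (c \<oplus> \<one>) \<ominus> (c \<ominus> \<one>) \<otimes> (c \<ominus> \<one>))"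
    \<comment> \<open>The error c - 4 h^2 c factors as c (1 + 2 h) (1 - 2 h), and the last factor
      lies in \<open>q\<close>.\<close>
    let ?k = "(c \<otimes> (\<one> \<oplus> (\<one> \<oplus> \<one>) \<otimes> h)) \<otimes> (\<one> \<ominus> (\<one> \<oplus> \<one>) \<otimes> h)"
    have "?e \<in> B" by (rule B(5)[OF hh B(4)[OF sq]])
    moreover have "?k \<in> B"
      using q.I_l_closed[OF two(2), of "c \<otimes> (\<one> \<oplus> (\<one> \<oplus> \<one>) \<otimes> h)"] B(2) c two(1) by auto
    ultimately have "?e \<oplus> ?k \<in> B" by (rule B(3))
    moreover have "?e \<oplus> ?k = c" using c two(1) by algebra
    ultimately show ?thesis by simp
  qed
  have two_np: "\<one> \<oplus> \<one> \<notin> p" if p: "primeideal p R" "q \<subseteq> p" for p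
  proof
    interpret p: primeideal p R by (rule p(1))
    assume "\<one> \<oplus> \<one> \<in> p"
    then have "(\<one> \<oplus> \<one>) \<otimes> h \<in> p" by (rule p.I_r_closed[OF _ two(1)])
    moreover have "\<one> \<ominus> (\<one> \<oplus> \<one>) \<otimes> h \<in> p" using two(2) p(2) by blast
    ultimately have "\<one> \<ominus> (\<one> \<oplus> \<one>) \<otimes> h \<oplus> (\<one> \<oplus> \<one>) \<otimes> h \<in> p" by simp
    moreover have "\<one> \<ominus> (\<one> \<oplus> \<one>) \<otimes> h \<oplus> (\<one> \<oplus> \<one>) \<otimes> h = \<one>" using two(1) by algebra
    ultimately show False using p.one_imp_carrier p.I_notcarr by simp
  qed
  define P where "P = {p. primeideal p R \<and> q \<subseteq> p}"
  have ex: "\<exists>d\<in>carrier R. d \<ominus> \<one> \<notin> p \<and> d \<oplus> \<one> \<notin> p \<and> b \<oplus> d \<ominus> \<one> \<notin> p \<and> b \<oplus> d \<oplus> \<one> \<notin> p"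
    if p: "p \<in> P" for p
  proof (cases "card (carrier (R Quot p)) = 3")
    case False
    then show ?thesis using p two_np b(1) residue_field_avoid[of p b] by (simp add: P_def)
  next
    \<comment> \<open>Here \<open>b\<close> lies in \<open>p\<close>, so \<open>d = 0\<close> works:
      all four values are congruent to 1 or -1.\<close>
    case True
    interpret p: primeideal p R using p by (simp add: P_def)
    have bp: "b \<in> p" using b(2) p True by (simp add: P_def)
    have one: "\<one> \<notin> p" using p.one_imp_carrier p.I_notcarr by blast
    have mone: "\<ominus> \<one> \<notin> p" using one p.a_inv_closed[of "\<ominus> \<one>"] by auto
    have "b \<ominus> \<one> \<notin> p"
    proof
      assume "b \<ominus> \<one> \<in> p"
      then have "b \<ominus> (b \<ominus> \<one>) \<in> p" using bp by (rule p.minus_mem[rotated])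
      moreover have "b \<ominus> (b \<ominus> \<one>) = \<one>" using b(1) by algebra
      ultimately show False using one by simp
    qed
    moreover have "b \<oplus> \<one> \<notin> p"
    proof
      assume "b \<oplus> \<one> \<in> p"
      then have "b \<oplus> \<one> \<ominus> b \<in> p" using bp by (rule p.minus_mem)
      moreover have "b \<oplus> \<one> \<ominus> b = \<one>" using b(1) by algebra
      ultimately show False using one by simp
    qed
    ultimately show ?thesis
      using one mone b(1) by (intro bexI[of _ \<zero>]) (auto simp: a_minus_def)
  qed
  define f where "f = (\<lambda>p. SOME d. d \<in> carrier R \<and>
    d \<ominus> \<one> \<notin> p \<and> d \<oplus> \<one> \<notin> p \<and> b \<oplus> d \<ominus> \<one> \<notin> p \<and> b \<oplus> d \<oplus> \<one> \<notin> p)"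
  have f: "f p \<in> carrier R \<and> f p \<ominus> \<one> \<notin> p \<and> f p \<oplus> \<one> \<notin> p \<and> b \<oplus> f p \<ominus> \<one> \<notin> p \<and> b \<oplus> f p \<oplus> \<one> \<notin> p"
    if "p \<in> P" for p
    unfolding f_def by (rule someI_ex) (use ex[OF that] in blast)
  have "\<exists>c\<in>carrier R. \<forall>p\<in>P. c \<ominus> f p \<in> p"
    using finite_primes_above[OF q] nonzero_of_supset[OF q(2,1)] f
    by (intro chinese_remainder_primes) (simp_all add: P_def)
  then obtain d where d: "d \<in> carrier R" "\<And>p. p \<in> P \<Longrightarrow> d \<ominus> f p \<in> p" by blast
  \<comment> \<open>Since \<open>d\<close> is congruent to \<open>f p\<close> modulo
    \<open>p\<close>, it avoids the same classes; \<open>g\<close> will be \<plusminus>1 or b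
    \<plusminus> 1.\<close>
  have transfer: "g \<oplus> d \<notin> p" if p: "p \<in> P" and g: "g \<in> carrier R" "g \<oplus> f p \<notin> p" for g p
  proof
    interpret p: primeideal p R using p by (simp add: P_def)
    assume "g \<oplus> d \<in> p"
    then have "g \<oplus> d \<ominus> (d \<ominus> f p) \<in> p" by (rule p.minus_mem[OF _ d(2)[OF p]])
    moreover have "g \<oplus> d \<ominus> (d \<ominus> f p) = g \<oplus> f p" using g(1) d(1) f[OF p] by algebra
    ultimately show False using g(2) by simp
  qed
  have "d \<in> B"
  proof (rule good[OF d(1)])
    fix p assume "primeideal p R" "q \<subseteq> p"
    then have p: "p \<in> P" by (simp add: P_def)
    show "d \<oplus> \<one> \<notin> p \<and> d \<ominus> \<one> \<notin> p"
      using transfer[OF p, of \<one>] transfer[OF p, of "\<ominus> \<one>"] f[OF p] d(1)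
        a_comm[of \<one>] a_comm[of "\<ominus> \<one>"]
      by (simp add: a_minus_def)
  qed
  moreover have "b \<oplus> d \<in> B"
  proof (rule good)
    show "b \<oplus> d \<in> carrier R" using b(1) d(1) by simp
    fix p assume "primeideal p R" "q \<subseteq> p"
    then have p: "p \<in> P" by (simp add: P_def)
    have "b \<oplus> d \<oplus> \<one> = b \<oplus> \<one> \<oplus> d" "b \<oplus> d \<ominus> \<one> = b \<ominus> \<one> \<oplus> d"
      "b \<oplus> f p \<oplus> \<one> = b \<oplus> \<one> \<oplus> f p" "b \<oplus> f p \<ominus> \<one> = b \<ominus> \<one> \<oplus> f p"
      using b(1) d(1) f[OF p] by (simp_all add: a_minus_def a_ac)
    then show "b \<oplus> d \<oplus> \<one> \<notin> p \<and> b \<oplus> d \<ominus> \<one> \<notin> p"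
      using transfer[OF p, of "b \<oplus> \<one>"] transfer[OF p, of "b \<ominus> \<one>"] f[OF p] b(1) by simp
  qed
  ultimately have "b \<oplus> d \<ominus> d \<in> B" by (intro B(4))
  moreover have "b \<oplus> d \<ominus> d = b" using b(1) d(1) by algebra
  ultimately show ?thesis by simp
qed

text \<open>Turns the additive group of all \<open>r\<close> with T(r) in \<open>N\<close> into the
  ideal \<open>q\<close>. An \<open>x\<close> outside \<open>q\<close> would have a multiple
  \<open>w\<close> outside \<open>q\<close> whose principal ideal still consists of such
  \<open>r\<close>, against the maximality of \<open>q\<close>. Both parts of Condition L enter
  here.\<close>

lemma normal_transvections_ideal:
  assumes N: "N \<lhd> SL2 R"
    and q': "ideal q' R" "q' \<noteq> {\<zero>}" "principal_congruence_subgroup R q' \<subseteq> N"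
    and q: "ideal q R" "\<And>r. r \<in> q \<Longrightarrow> transvection R r \<in> N"
    and q_max: "\<And>J. ideal J R \<Longrightarrow> (\<And>r. r \<in> J \<Longrightarrow> transvection R r \<in> N) \<Longrightarrow> J \<subseteq> q"
    and L: "condition_L R q"
    and x: "x \<in> carrier R" "transvection R x \<in> N"
  shows "x \<in> q"
proof (rule ccontr)
  assume xq: "x \<notin> q"
  interpret S: group "SL2 R" by (rule SL2_group)
  interpret N: normal N "SL2 R" by (rule N)
  interpret q: ideal q R by (rule q(1))
  have q0: "q \<noteq> {\<zero>}" using L by (simp add: condition_L_def)
  have "q' \<subseteq> q"
  proof (rule q_max[OF q'(1)])
    fix r assume r: "r \<in> q'"
    interpret q': ideal q' R by (rule q'(1))
    have "transvection R r \<in> principal_congruence_subgroup R q'"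
      using r transvection_in_SL2[OF q'.Icarr[OF r]]
      by (simp add: principal_congruence_subgroup_def transvection_def a_minus_def r_neg)
    then show "transvection R r \<in> N" using q'(3) by blast
  qed
  then have PN: "principal_congruence_subgroup R q \<subseteq> N"
    by (rule normal_contains_congruence_subgroup[OF N q' q(1) _ q(2)])
  define S where "S = {r \<in> carrier R. transvection R r \<in> N}"
  have S_add: "r \<oplus> s \<in> S" if "r \<in> S" "s \<in> S" for r s
    using that N.m_closed[of "transvection R r" "transvection R s"] by (simp add: S_def transvection_mult)
  have S_neg: "\<ominus> r \<in> S" if "r \<in> S" for r
    using that N.m_inv_closed[of "transvection R r"] by (simp add: S_def transvection_inv)
  have S_minus: "r \<ominus> s \<in> S" if "r \<in> S" "s \<in> S" for r s
    unfolding a_minus_def using S_add[OF that(1) S_neg[OF that(2)]] .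
  have SR: "r \<in> carrier R" if "r \<in> S" for r using that by (simp add: S_def)
  have qS: "q \<subseteq> S" using q(2) q.Icarr by (auto simp: S_def)
  have S_max: "J \<subseteq> q" if "ideal J R" "J \<subseteq> S" for J
    using q_max[OF that(1)] that(2) by (auto simp: S_def)
  \<comment> \<open>The ring of multipliers of \<open>S\<close>; it contains \<open>q\<close> and
    the squares of units modulo \<open>q\<close>, so \<open>norm_3_multiplier\<close> applies to
    it.\<close>
  define B where "B = {b \<in> carrier R. \<forall>s\<in>S. b \<otimes> s \<in> S}"
  have "\<one> \<in> q <+>\<^bsub>R\<^esub> (PIdl (\<one> \<oplus> \<one>))" using L by (simp add: condition_L_def)
  then obtain t w where t: "t \<in> q" and w: "w \<in> PIdl (\<one> \<oplus> \<one>)" and tw: "\<one> = t \<oplus> w"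
    unfolding set_add_def' by blast
  obtain h where h: "h \<in> carrier R" "w = h \<otimes> (\<one> \<oplus> \<one>)" using w unfolding cgenideal_def by blast
  have "t \<oplus> h \<otimes> (\<one> \<oplus> \<one>) \<ominus> (\<one> \<oplus> \<one>) \<otimes> h = t" using h(1) q.Icarr[OF t] by algebra
  then have two: "\<one> \<ominus> (\<one> \<oplus> \<one>) \<otimes> h \<in> q" using t by (simp only: tw[symmetric] h(2)[symmetric])
  have two_np: "\<one> \<oplus> \<one> \<notin> p" if p: "primeideal p R" "q \<subseteq> p" for p
  proof
    interpret p: primeideal p R by (rule p(1))
    assume "\<one> \<oplus> \<one> \<in> p"
    then have "w \<in> p" using p.I_l_closed h by simp
    then have "t \<oplus> w \<in> p" using t p(2) by auto
    then show False using p.one_imp_carrier p.I_notcarr by (simp only: tw[symmetric])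
  qed
  have norm_3: "b \<in> B" if "b \<in> carrier R"
    "\<And>p. primeideal p R \<Longrightarrow> q \<subseteq> p \<Longrightarrow> card (carrier (R Quot p)) = 3 \<Longrightarrow> b \<in> p" for b
  proof (rule norm_3_multiplier[OF q(1) q0 h(1) two _ _ _ _ _ _ that])
    show "B \<subseteq> carrier R" by (auto simp: B_def)
    show "q \<subseteq> B"
    proof
      fix r assume r: "r \<in> q"
      have "r \<otimes> s \<in> S" if "s \<in> S" for s using q.I_r_closed[OF r SR[OF that]] qS by blast
      then show "r \<in> B" using q.Icarr[OF r] by (simp add: B_def)
    qed
    show "a \<oplus> b \<in> B" if "a \<in> B" "b \<in> B" for a b
      using that S_add SR by (simp add: B_def l_distr)
    show "a \<ominus> b \<in> B" if "a \<in> B" "b \<in> B" for a b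
      using that S_minus SR by (simp add: B_def a_minus_def l_distr l_minus)
    show "a \<otimes> b \<in> B" if "a \<in> B" "b \<in> B" for a b
      using that SR by (simp add: B_def m_assoc)
    show "u \<otimes> u \<in> B" if "u \<in> carrier R" "v \<in> carrier R" "\<one> \<ominus> u \<otimes> v \<in> q" for u v
      using that normal_square_mult[OF N q(1) PN _ _ that] by (simp add: B_def S_def)
  qed
  define P where "P = {p. primeideal p R \<and> q \<subseteq> p \<and> card (carrier (R Quot p)) = 3}"
  have finP: "finite P"
    using finite_subset[OF _ finite_primes_above[OF q(1) q0], of P] by (auto simp: P_def)
  define r where "r = (\<lambda>A. {b \<in> carrier R. \<forall>p\<in>A. b \<in> p})"
  have r_ideal: "ideal (r A) R" if A: "A \<subseteq> P" for A
  proof -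
    have I: "ideal p R" if "p \<in> A" for p
      using A that primeideal.axioms(1) by (auto simp: P_def)
    show ?thesis
      using ideal.I_l_closed[OF I] additive_subgroup.a_closed[OF ideal.axioms(1)[OF I]]
        additive_subgroup.zero_closed[OF ideal.axioms(1)[OF I]]
      by (intro cring_idealI) (auto simp: r_def)
  qed
  \<comment> \<open>These multiples of \<open>x\<close> form an ideal, and it lies in
    \<open>S\<close> because \<open>r P\<close> is contained in \<open>B\<close>; so maximality of
    \<open>q\<close> applies.\<close>
  have "{b \<otimes> x | b. b \<in> r P} \<subseteq> q"
  proof (rule S_max)
    interpret rP: ideal "r P" R by (rule r_ideal) simp
    show "ideal {b \<otimes> x | b. b \<in> r P} R"
    proof (rule cring_idealI)
      show "{b \<otimes> x | b. b \<in> r P} \<subseteq> carrier R" using x(1) rP.Icarr by auto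
      show "\<zero> \<in> {b \<otimes> x | b. b \<in> r P}" using rP.zero_closed x(1) by (auto intro!: exI[of _ \<zero>])
    next
      fix y z assume "y \<in> {b \<otimes> x | b. b \<in> r P}" "z \<in> {b \<otimes> x | b. b \<in> r P}"
      then obtain b c where "b \<in> r P" "c \<in> r P" "y = b \<otimes> x" "z = c \<otimes> x" by blast
      moreover from this have "y \<oplus> z = (b \<oplus> c) \<otimes> x" using x(1) rP.Icarr by (simp add: l_distr)
      ultimately show "y \<oplus> z \<in> {b \<otimes> x | b. b \<in> r P}" using rP.a_closed by blast
    next
      fix s y assume s: "s \<in> carrier R" "y \<in> {b \<otimes> x | b. b \<in> r P}"
      then obtain b where b: "b \<in> r P" "y = b \<otimes> x" by blast
      then have "s \<otimes> y = (s \<otimes> b) \<otimes> x" using x(1) rP.Icarr s(1) by (simp add: m_assoc)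
      then show "s \<otimes> y \<in> {b \<otimes> x | b. b \<in> r P}" using rP.I_l_closed[OF b(1) s(1)] by blast
    qed
    have xS: "x \<in> S" using x by (simp add: S_def)
    have "b \<otimes> x \<in> S" if "b \<in> r P" for b
    proof -
      have "b \<in> B"
      proof (rule norm_3)
        show "b \<in> carrier R" using that unfolding r_def by blast
        fix p assume "primeideal p R" "q \<subseteq> p" "card (carrier (R Quot p)) = 3"
        then have "p \<in> P" unfolding P_def by blast
        moreover have "\<forall>p\<in>P. b \<in> p" using that unfolding r_def by blast
        ultimately show "b \<in> p" by blast
      qed
      then show ?thesis using xS by (simp add: B_def)
    qed
    then show "{b \<otimes> x | b. b \<in> r P} \<subseteq> S" by blast
  qed
  then have rP: "b \<otimes> x \<in> q" if "b \<in> r P" for b using that by blast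
  \<comment> \<open>A largest member \<open>A\<close> is a set of primes whose intersection does not
    yet multiply \<open>x\<close> into \<open>q\<close>, while adding any further \<open>p\<close>
    from \<open>P\<close> achieves this. So some y x with \<open>y \<in> r A\<close> is outside
    \<open>q\<close> but is annihilated modulo \<open>q\<close> by the single prime
    \<open>p\<close>. The empty set belongs to \<open>F\<close> since \<open>r {}\<close> is the
    whole ring.\<close>
  define F where "F = {A. A \<subseteq> P \<and> (\<exists>b\<in>r A. b \<otimes> x \<notin> q)}"
  have "finite F" using finP by (auto simp: F_def)
  moreover have "{} \<in> F" using xq x(1) by (auto simp: F_def r_def intro!: bexI[of _ \<one>])
  then have "F \<noteq> {}" by blast
  ultimately have "\<exists>A\<in>F. \<forall>A'\<in>F. A \<subseteq> A' \<longrightarrow> A = A'" by (rule finite_has_maximal)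
  then obtain A where A: "A \<in> F" "\<And>A'. A' \<in> F \<Longrightarrow> A \<subseteq> A' \<Longrightarrow> A = A'" by blast
  obtain y where y: "y \<in> r A" "y \<otimes> x \<notin> q" using A(1) by (auto simp: F_def)
  have yR: "y \<in> carrier R" using y(1) unfolding r_def by blast
  have "A \<noteq> P" using y rP by auto
  then obtain p where p: "p \<in> P" "p \<notin> A" using A(1) by (auto simp: F_def)
  have pp: "primeideal p R" "q \<subseteq> p" "card (carrier (R Quot p)) = 3" using p(1) by (auto simp: P_def)
  interpret p: primeideal p R by (rule pp(1))
  have rpA: "b \<otimes> x \<in> q" if "b \<in> r A" "b \<in> p" for b
  proof (rule ccontr)
    assume nq: "b \<otimes> x \<notin> q"
    have "b \<in> r (insert p A)" using that unfolding r_def by blast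
    then have "insert p A \<in> F" using nq p(1) A(1) unfolding F_def by blast
    then show False using A(2)[of "insert p A"] p(2) by blast
  qed
  have yp: "y \<notin> p" using rpA y by blast
  define z where "z = y \<otimes> x"
  have zR: "z \<in> carrier R" using yR x(1) by (simp add: z_def)
  have pz: "s \<otimes> z \<in> q" if s: "s \<in> p" for s
  proof -
    have "A \<subseteq> P" using A(1) by (simp add: F_def)
    then interpret rA: ideal "r A" R by (rule r_ideal)
    have "(s \<otimes> y) \<otimes> x \<in> q" using rpA[OF rA.I_l_closed[OF y(1) p.Icarr[OF s]] p.I_r_closed[OF s yR]] .
    then show ?thesis using yR x(1) p.Icarr[OF s] by (simp add: z_def m_assoc)
  qed
  \<comment> \<open>Otherwise \<open>z\<close> would show that \<open>p\<close> divides
    \<open>q\<close> exactly once, which part (ii) of Condition L excludes for a residue field with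
    three elements.\<close>
  have "z \<in> p"
  proof (rule ccontr)
    assume "z \<notin> p"
    then have "ideal_ord R p q = 1" using ideal_ord_eq_1[OF q(1) q0 pp(1,2) zR _ pz] by blast
    then show False using L pp(1,3) by (auto simp: condition_L_def)
  qed
  then have xp: "x \<in> p" using p.I_prime[OF yR x(1)] yp by (simp add: z_def)
  have "x \<otimes> z = x \<otimes> x \<otimes> y" using yR x(1) by (simp add: z_def m_ac)
  then have s: "x \<otimes> x \<otimes> y \<in> q" using pz[OF xp] by simp
  define w where "w = x \<otimes> y \<otimes> y \<oplus> x \<otimes> y \<otimes> y"
  have wS: "w \<in> S"
    using normal_socle_transvection[OF N q(1) PN x(2,1) yR s] x(1) yR by (simp add: w_def S_def)
  have wR: "w \<in> carrier R" by (rule SR[OF wS])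
  have wz: "w = (y \<oplus> y) \<otimes> z" unfolding w_def z_def using x(1) yR by algebra
  have pw: "e \<otimes> w \<in> q" if e: "e \<in> p" for e
  proof -
    have "e \<otimes> w = (y \<oplus> y) \<otimes> (e \<otimes> z)" unfolding wz using yR zR p.Icarr[OF e] by algebra
    then show ?thesis using q.I_l_closed[OF pz[OF e]] yR by simp
  qed
  \<comment> \<open>Every ring element is 0, 1 or -1 modulo \<open>p\<close>, and \<open>p\<close>
    annihilates \<open>w\<close> modulo \<open>q\<close>; so each multiple of \<open>w\<close> is 0,
    w or -w modulo \<open>q\<close>.\<close>
  have "PIdl w \<subseteq> S"
  proof
    fix v assume "v \<in> PIdl w"
    then obtain e where e: "e \<in> carrier R" "v = e \<otimes> w" unfolding cgenideal_def by blast
    have "e \<in> p \<or> e \<ominus> \<one> \<in> p \<or> e \<oplus> \<one> \<in> p"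
      using card_residue_field_eq_3[OF pp(1) two_np[OF pp(1,2)]] pp(3) e(1) by blast
    then consider "e \<in> p" | "e \<ominus> \<one> \<in> p" | "e \<oplus> \<one> \<in> p" by blast
    then show "v \<in> S"
    proof cases
      case 1
      then show ?thesis using pw[OF 1] e(2) qS by auto
    next
      case 2
      have "e \<otimes> w = w \<oplus> (e \<ominus> \<one>) \<otimes> w" using e(1) wR by algebra
      then show ?thesis using S_add[OF wS] pw[OF 2] e(2) qS by auto
    next
      case 3
      have "e \<otimes> w = (e \<oplus> \<one>) \<otimes> w \<ominus> w" using e(1) wR by algebra
      then show ?thesis using S_minus[OF _ wS] pw[OF 3] e(2) qS by auto
    qed
  qed
  then have "w \<in> q" using S_max[OF cgenideal_ideal[OF wR]] cgenideal_self[OF wR] by blast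
  \<comment> \<open>Neither 2 nor \<open>y\<close> lies in \<open>p\<close>, so
    \<open>y \<oplus> y\<close> is invertible modulo \<open>p\<close>. As \<open>p\<close>
    annihilates \<open>z\<close> modulo \<open>q\<close>, membership of \<open>w\<close> in
    \<open>q\<close> passes to \<open>z\<close>.\<close>
  have "y \<oplus> y = (\<one> \<oplus> \<one>) \<otimes> y" using yR by (simp add: l_distr)
  then have "y \<oplus> y \<notin> p" using p.I_prime[of "\<one> \<oplus> \<one>" y] two_np[OF pp(1,2)] yp yR by auto
  then obtain k m where km: "k \<in> carrier R" "m \<in> p" "(y \<oplus> y) \<otimes> k \<oplus> m = \<one>"
    using inverse_mod_prime[OF pp(1) nonzero_of_supset[OF q0 q(1) pp(2)], of "y \<oplus> y"] yR by auto
  have "z = ((y \<oplus> y) \<otimes> k \<oplus> m) \<otimes> z" using km(3) zR by simp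
  also have "\<dots> = k \<otimes> w \<oplus> m \<otimes> z" unfolding wz using yR km(1) p.Icarr[OF km(2)] zR by algebra
  also have "\<dots> \<in> q" using q.I_l_closed[OF \<open>w \<in> q\<close> km(1)] pz[OF km(2)] by simp
  finally show False using y(2) by (simp add: z_def)
qed

end


section \<open>The permutation action on cosets\<close>

text \<open>The quotient by the kernel is in bijection with the image, whose order divides that of
  the codomain by Lagrange.\<close>

lemma (in group_hom) card_rcosets_kernel_dvd:
  shows "card (rcosets (kernel G H h)) dvd order H"
proof -
  let ?I = "H\<lparr>carrier := h ` carrier G\<rparr>"
  have I: "subgroup (h ` carrier G) H" by (rule img_is_subgroup)
  interpret I: group ?I by (rule subgroup.subgroup_is_group[OF I H.group_axioms])
  interpret hI: group_hom G ?I h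
    by unfold_locales (auto simp: hom_def)
  have k: "kernel G ?I h = kernel G H h" by (simp add: kernel_def)
  have "bij_betw (\<lambda>C. the_elem (h ` C)) (carrier (G Mod kernel G H h)) (h ` carrier G)"
    using hI.FactGroup_onto FactGroup_inj_on unfolding k bij_betw_def by simp
  then have "card (rcosets (kernel G H h)) = card (h ` carrier G)"
    using bij_betw_same_card by (simp add: FactGroup_def) 
  then show ?thesis using H.lagrange[OF I] by (metis dvd_triv_right)
qed

text \<open>\<open>BijGroup\<close> uses functions that are undefined outside \<open>S\<close>,
  while permutations are the identity there; restricting and extending translate between the
  two.\<close>

lemma order_BijGroup:
  assumes "finite S"
  shows "order (BijGroup S) = fact (card S)"
proof -
  have "bij_betw (\<lambda>f. restrict f S) {p. p permutes S} (Bij S)"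
  proof (rule bij_betwI[where g = "\<lambda>f x. if x \<in> S then f x else x"])
    show "(\<lambda>f. restrict f S) \<in> {p. p permutes S} \<rightarrow> Bij S"
      by (auto simp: Bij_def dest!: permutes_imp_bij intro: bij_betw_cong[THEN iffD1, rotated])
    show "(\<lambda>f x. if x \<in> S then f x else x) \<in> Bij S \<rightarrow> {p. p permutes S}"
    proof
      fix f assume "f \<in> Bij S"
      then have "bij_betw (\<lambda>x. if x \<in> S then f x else x) S S"
        by (auto simp: Bij_def intro: bij_betw_cong[THEN iffD1, rotated])
      then show "(\<lambda>x. if x \<in> S then f x else x) \<in> {p. p permutes S}"
        by (auto intro: bij_imp_permutes)
    qed
    show "(\<lambda>x. if x \<in> S then restrict p S x else x) = p" if "p \<in> {p. p permutes S}" for p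
      using that by (auto simp: permutes_def)
    show "restrict (\<lambda>x. if x \<in> S then f x else x) S = f" if "f \<in> Bij S" for f
      using that by (auto simp: Bij_def extensional_def restrict_def)
  qed
  then have "card (Bij S) = card {p. p permutes S}" by (simp add: bij_betw_same_card)
  then show ?thesis using card_permutations[OF refl assms] by (simp add: order_def BijGroup_def)
qed

context group
begin

text \<open>Right multiplication by the inverse is what makes right cosets carry a left action,
  compatible with the order of composition in \<open>BijGroup\<close>.\<close>

lemma rcosets_action:
  assumes H: "subgroup H G"
  shows "group_hom G (BijGroup (rcosets H)) (\<lambda>g. \<lambda>K\<in>rcosets H. K #> inv g)"
proof -
  let ?E = "rcosets H"
  let ?f = "\<lambda>g. \<lambda>K\<in>?E. K #> inv g"
  have HG: "H \<subseteq> carrier G" by (rule subgroup.subset[OF H])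
  have cos: "K #> g \<in> ?E" if K: "K \<in> ?E" and g: "g \<in> carrier G" for K g
  proof -
    obtain x where x: "x \<in> carrier G" "K = H #> x" using K by (auto simp: RCOSETS_def)
    then show ?thesis using coset_mult_assoc[OF HG x(1) g] rcosetsI[OF HG, of "x \<otimes> g"] g by simp
  qed
  have KG: "K \<subseteq> carrier G" if "K \<in> ?E" for K
    using that rcosets_part_G[OF H] by auto
  have cancel: "K #> g #> inv g = K" "K #> inv g #> g = K" if "K \<in> ?E" "g \<in> carrier G" for K g
    using coset_mult_assoc[OF KG[OF that(1)]] that KG[OF that(1)] coset_mult_one by simp_all
  have B: "?f g \<in> Bij ?E" if g: "g \<in> carrier G" for g
  proof -
    have "bij_betw (?f g) ?E ?E"
      by (rule bij_betwI[where g = "\<lambda>K. K #> g"]) (use cos cancel g in auto)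
    then show ?thesis by (simp add: Bij_def)
  qed
  have mult: "?f (g \<otimes> h) = compose ?E (?f g) (?f h)" if "g \<in> carrier G" "h \<in> carrier G" for g h
    using that cos coset_mult_assoc[OF KG]
    by (auto simp: compose_def inv_mult_group restrict_def fun_eq_iff)
  interpret B: group "BijGroup ?E" by (rule group_BijGroup)
  show ?thesis
    using B mult by unfold_locales (auto simp: hom_def BijGroup_def)
qed

text \<open>The kernel is the normal core of \<open>H\<close>, stated with the conjugates that occur
  in \<open>level\<close>. The element \<open>M\<close> fixes the coset of \<open>x\<close> exactly
  if \<open>x \<otimes> M \<otimes> inv x\<close> lies in \<open>H\<close>.\<close>

lemma rcosets_action_kernel:
  assumes H: "subgroup H G"
  shows "M \<in> kernel G (BijGroup (rcosets H)) (\<lambda>g. \<lambda>K\<in>rcosets H. K #> inv g) \<longleftrightarrow>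
    M \<in> carrier G \<and> (\<forall>g\<in>carrier G. M \<in> g <# H #> inv g)"
proof (cases "M \<in> carrier G")
  case M: True
  have HG: "H \<subseteq> carrier G" by (rule subgroup.subset[OF H])
  have conj: "M \<in> g <# H #> inv g \<longleftrightarrow> inv g \<otimes> M \<otimes> g \<in> H" if g: "g \<in> carrier G" for g
  proof
    assume "M \<in> g <# H #> inv g"
    then obtain h where h: "h \<in> H" "M = g \<otimes> h \<otimes> inv g" by (auto simp: l_coset_def r_coset_def)
    then have "inv g \<otimes> M \<otimes> g = h" using g HG by (auto simp: m_assoc subset_iff inv_solve_left')
    then show "inv g \<otimes> M \<otimes> g \<in> H" using h by simp
  next
    assume *: "inv g \<otimes> M \<otimes> g \<in> H"
    have "M = g \<otimes> (inv g \<otimes> M \<otimes> g) \<otimes> inv g" using g M by (simp add: m_assoc[symmetric])  (simp add: m_assoc)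
    then show "M \<in> g <# H #> inv g" using * unfolding l_coset_def r_coset_def by blast
  qed
  have stab: "(H #> x) #> inv M = H #> x \<longleftrightarrow> x \<otimes> M \<otimes> inv x \<in> H" if x: "x \<in> carrier G" for x
  proof -
    have "(H #> x) #> inv M = H #> x \<longleftrightarrow> H #> (x \<otimes> inv M) = H #> x"
      using coset_mult_assoc[OF HG x] M by simp
    also have "\<dots> \<longleftrightarrow> x \<in> H #> (x \<otimes> inv M)"
      using rcos_self[OF x H] repr_independence[OF _ _ H, of x "x \<otimes> inv M"] x M by auto
    also have "\<dots> \<longleftrightarrow> x \<otimes> inv (x \<otimes> inv M) \<in> H"
      using subgroup.rcos_module[OF H group_axioms, of "x \<otimes> inv M" x] x M by simp
    also have "x \<otimes> inv (x \<otimes> inv M) = x \<otimes> M \<otimes> inv x" using x M by (simp add: inv_mult_group m_assoc)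
    finally show ?thesis .
  qed
  have "M \<in> kernel G (BijGroup (rcosets H)) (\<lambda>g. \<lambda>K\<in>rcosets H. K #> inv g) \<longleftrightarrow>
      (\<forall>K\<in>rcosets H. K #> inv M = K)"
    using M by (auto simp: kernel_def BijGroup_def restrict_def fun_eq_iff)
  also have "\<dots> \<longleftrightarrow> (\<forall>x\<in>carrier G. x \<otimes> M \<otimes> inv x \<in> H)"
    using stab by (auto simp: RCOSETS_def)
  \<comment> \<open>Inversion permutes the group, so \<open>x\<close> may be replaced by
    \<open>inv g\<close>.\<close>
  also have "\<dots> \<longleftrightarrow> (\<forall>g\<in>carrier G. inv g \<otimes> M \<otimes> g \<in> H)"
    using inv_closed inv_inv by metis
  also have "\<dots> \<longleftrightarrow> (\<forall>g\<in>carrier G. M \<in> g <# H #> inv g)" using conj by blast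
  finally show ?thesis using M by simp
qed (simp add: kernel_def)

end


section \<open>The index and the level\<close>

theorem theoremC:
  fixes D (structure) and H :: "'a mat2 set" and n :: nat
  assumes "dedekind_domain D"
    and "congruence_subgroup D H"
    and "finite (rcosets\<^bsub>SL2 D\<^esub> H)" and "n = card (rcosets\<^bsub>SL2 D\<^esub> H)"
    and "condition_L D (level D H)"
  shows "card (carrier (D Quot level D H)) dvd fact n \<and>
    (H \<lhd> SL2 D \<longrightarrow> card (carrier (D Quot level D H)) dvd n)"
proof -
  interpret dedekind_domain D by (rule assms(1))
  interpret S: group "SL2 D" by (rule SL2_group)
  interpret A: group "add_monoid D" by (rule add.group_axioms)
  have H: "subgroup H (SL2 D)" using assms(2) by (simp add: congruence_subgroup_def)
  obtain q' where q': "ideal q' D" "q' \<noteq> {\<zero>}" "principal_congruence_subgroup D q' \<subseteq> H"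
    using assms(2) by (auto simp: congruence_subgroup_def)
  let ?q = "level D H"
  let ?B = "BijGroup (rcosets\<^bsub>SL2 D\<^esub> H)"
  define f where "f = (\<lambda>g. \<lambda>K\<in>rcosets\<^bsub>SL2 D\<^esub> H. K #>\<^bsub>SL2 D\<^esub> inv\<^bsub>SL2 D\<^esub> g)"
  interpret f: group_hom "SL2 D" ?B f unfolding f_def by (rule S.rcosets_action[OF H])
  \<comment> \<open>The core of \<open>H\<close>, introduced as a kernel so that its normality is
    immediate.\<close>
  define N where "N = kernel (SL2 D) ?B f"
  have N_iff: "M \<in> N \<longleftrightarrow> M \<in> carrier (SL2 D) \<and>
      (\<forall>g\<in>carrier (SL2 D). M \<in> g <#\<^bsub>SL2 D\<^esub> H #>\<^bsub>SL2 D\<^esub> inv\<^bsub>SL2 D\<^esub> g)" for M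
    unfolding N_def f_def by (rule S.rcosets_action_kernel[OF H])
  have N: "N \<lhd> SL2 D" unfolding N_def by (rule f.normal_kernel)
  have conj_mem: "M \<in> g <#\<^bsub>SL2 D\<^esub> H #>\<^bsub>SL2 D\<^esub> inv\<^bsub>SL2 D\<^esub> g"
    if "M \<in> carrier (SL2 D)" "g \<in> carrier (SL2 D)"
      "inv\<^bsub>SL2 D\<^esub> g \<otimes>\<^bsub>SL2 D\<^esub> M \<otimes>\<^bsub>SL2 D\<^esub> inv\<^bsub>SL2 D\<^esub> (inv\<^bsub>SL2 D\<^esub> g) \<in> H" for M g
  proof -
    have "M = g \<otimes>\<^bsub>SL2 D\<^esub> (inv\<^bsub>SL2 D\<^esub> g \<otimes>\<^bsub>SL2 D\<^esub> M \<otimes>\<^bsub>SL2 D\<^esub> inv\<^bsub>SL2 D\<^esub> (inv\<^bsub>SL2 D\<^esub> g)) \<otimes>\<^bsub>SL2 D\<^esub> inv\<^bsub>SL2 D\<^esub> g"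
      using that(1,2) by (simp add: S.m_assoc[symmetric]) (simp add: S.m_assoc)
    then show ?thesis using that(3) unfolding l_coset_def r_coset_def by blast
  qed
  \<comment> \<open>A principal congruence subgroup is normal, so with \<open>H\<close> it also lies
    in every conjugate of \<open>H\<close>.\<close>
  have q'N: "principal_congruence_subgroup D q' \<subseteq> N"
  proof
    fix M assume M: "M \<in> principal_congruence_subgroup D q'"
    then have MS: "M \<in> carrier (SL2 D)" by (simp add: principal_congruence_subgroup_def)
    show "M \<in> N"
      unfolding N_iff using MS conj_mem[OF MS] principal_congruence_subgroup_conj[OF q'(1) M] q'(3)
      by (meson S.inv_closed subsetD)
  qed
  have q: "ideal ?q D" using level_greatest(1)[OF H] by blast
  have qN: "transvection D r \<in> N" if r: "r \<in> ?q" for r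
    unfolding N_iff using level_greatest(1)[OF H] transvection_in_SL2[OF ideal.Icarr[OF q r]] r by blast
  have q_max: "J \<subseteq> ?q" if "ideal J D" "\<And>r. r \<in> J \<Longrightarrow> transvection D r \<in> N" for J
    by (rule level_greatest(2)[OF H]) (use that N_iff in blast)
  have T_iff: "transvection D r \<in> N \<longleftrightarrow> r \<in> ?q" if "r \<in> carrier D" for r
    using normal_transvections_ideal[OF N q'(1,2) q'N q qN q_max assms(5) that] qN by blast
  have T_hom: "transvection D \<in> hom (add_monoid D) (SL2 D)"
    by (rule homI) (simp_all add: transvection_in_SL2 transvection_mult)
  have Q: "carrier (D Quot ?q) = rcosets\<^bsub>add_monoid D\<^esub> ?q"
    by (simp add: FactRing_def A_RCOSETS_def)
  interpret T: group_hom "add_monoid D" "SL2 D" "transvection D"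
    by unfold_locales (rule T_hom)
  interpret Tf: group_hom "add_monoid D" ?B "f \<circ> transvection D"
    by unfold_locales (rule hom_compose[OF T_hom f.homh])
  \<comment> \<open>Hence D/l(H) embeds into the symmetric group on the n cosets, which has order
    n!.\<close>
  have "kernel (add_monoid D) ?B (f \<circ> transvection D) = ?q"
    using T_iff ideal.Icarr[OF q] transvection_in_SL2 by (auto simp: kernel_def N_def)
  then have "card (carrier (D Quot ?q)) dvd order ?B"
    using Tf.card_rcosets_kernel_dvd by (simp add: Q)
  then have "card (carrier (D Quot ?q)) dvd fact n"
    by (simp add: order_BijGroup[OF assms(3)] assms(4))
  \<comment> \<open>A normal \<open>H\<close> is its own core, so D/l(H) embeds into the quotient by
    \<open>H\<close>, a group of order n.\<close>
  moreover have "card (carrier (D Quot ?q)) dvd n" if HN: "H \<lhd> SL2 D"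
  proof -
    interpret HN: normal H "SL2 D" by (rule HN)
    interpret F: group "SL2 D Mod H" by (rule HN.factorgroup_is_group)
    interpret Tf: group_hom "add_monoid D" "SL2 D Mod H" "(\<lambda>g. H #>\<^bsub>SL2 D\<^esub> g) \<circ> transvection D"
      by unfold_locales (rule hom_compose[OF T_hom HN.r_coset_hom_Mod])
    have "H #>\<^bsub>SL2 D\<^esub> transvection D r = H \<longleftrightarrow> r \<in> ?q" if r: "r \<in> carrier D" for r
    proof -
      have TS: "transvection D r \<in> carrier (SL2 D)" by (rule transvection_in_SL2[OF r])
      have "H #>\<^bsub>SL2 D\<^esub> transvection D r = H \<longleftrightarrow> transvection D r \<in> H"
        using S.coset_join1[OF _ TS H] HN.rcos_const[OF S.group_axioms] HN.subset by blast
      also have "\<dots> \<longleftrightarrow> transvection D r \<in> N"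
      proof
        assume TH: "transvection D r \<in> H"
        show "transvection D r \<in> N"
          unfolding N_iff using TS conj_mem[OF TS _ HN.inv_op_closed2[OF S.inv_closed TH]] by blast
      next
        assume "transvection D r \<in> N"
        then have "transvection D r \<in> \<one>\<^bsub>SL2 D\<^esub> <#\<^bsub>SL2 D\<^esub> H #>\<^bsub>SL2 D\<^esub> inv\<^bsub>SL2 D\<^esub> \<one>\<^bsub>SL2 D\<^esub>"
          unfolding N_iff by blast
        then show "transvection D r \<in> H"
          using HN.subset by (simp add: S.lcos_mult_one S.coset_mult_one)
      qed
      finally show ?thesis using T_iff[OF r] by simp
    qed
    then have "kernel (add_monoid D) (SL2 D Mod H) ((\<lambda>g. H #>\<^bsub>SL2 D\<^esub> g) \<circ> transvection D) = ?q"
      using ideal.Icarr[OF q] by (auto simp: kernel_def)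
    then have "card (carrier (D Quot ?q)) dvd order (SL2 D Mod H)"
      using Tf.card_rcosets_kernel_dvd by (simp add: Q)
    then show ?thesis by (simp add: order_def FactGroup_def assms(4))
  qed
  ultimately show ?thesis by blast
qed

end
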